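(* Let $\mathbb{K}$ be an infinite field and let $\mathbb{V} = \mathbb{P}^{n_1} \times \dots \times \mathbb{P}^{n_q}$ over $\mathbb{K}$. Let $X \subset \mathbb{V}$ be a zero-dimensional ACM subscheme. Then $\Delta \mathcal{H}_X = \mathcal{H}_A$ for an artinian $\mathbb{Z}^q$-graded quotient $A$ of $\mathbb{S}_0$. Conversely, for any artinian $\mathbb{Z}^q$-graded quotient $A$ of $\mathbb{S}_0$, there exists a zero-dimensional ACM subscheme $X \subset \mathbb{V}$ such that $\Delta \mathcal{H}_X = \mathcal{H}_A$.
   Context: Let $q, n_1, \dots, n_q$ be positive integers. The coordinate ring of $\mathbb{V}$ is $\mathbb{S} = \mathbb{K}[x_{ij} \mid 1 \le i \le q,\ 0 \le j \le n_i]$, $\mathbb{Z}^q$-graded by $\deg(x_{ij}) = e_i$, the $i$-th standard basis element of $\mathbb{Z}^q$. Put $\mathbb{S}_0 = \mathbb{S}/(x_{10}, \dots, x_{q0}) = \mathbb{K}[x_{ij} \mid 1 \le i \le q,\ 1 \le j \le n_i]$ with the induced $\mathbb{Z}^q$-grading $\deg(x_{ij}) = e_i$; a $\mathbb{Z}^q$-graded quotient of $\mathbb{S}_0$ is a quotient by a $\mathbb{Z}^q$-homogeneous ideal. For a finitely generated $\mathbb{Z}^q$-graded $\mathbb{S}$-module $M$, the Hilbert function is $\mathcal{H}_M(a) = \dim_{\mathbb{K}} M_a$ for $a \in \mathbb{Z}^q$ (quotients of $\mathbb{S}_0$ are regarded as $\mathbb{S}$-modules). For a zero-dimensional subscheme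 $X \subset \mathbb{V}$, $I(X) \subset \mathbb{S}$ is the ideal generated by the $\mathbb{Z}^q$-homogeneous forms vanishing on $X$, and $\mathcal{H}_X = \mathcal{H}_{\mathbb{S}/I(X)}$. One has $1 \le \operatorname{depth}(\mathbb{S}/I(X)) \le \dim(\mathbb{S}/I(X)) = q$, where the depth of $\mathbb{S}/I(X)$ is the maximal length of an $\mathbb{S}/I(X)$-regular sequence contained in the ideal of $\mathbb{S}$ generated by all the variables; $X$ is called arithmetically Cohen-Macaulay (ACM) if $\operatorname{depth}(\mathbb{S}/I(X)) = q$. For $\mathcal{F}\colon \mathbb{Z}^q \to \mathbb{Z}$, the difference function $\Delta \mathcal{F} \colon \mathbb{Z}^q \to \mathbb{Z}$ is $$\Delta \mathcal{F}(a) = \mathcal{F}(a) + \sum_{1 \le p \le q} (-1)^p \sum_{1 \le i_1 < \dots < i_p \le q} \mathcal{F}(a - e_{i_1} - \dots - e_{i_p}).$$ *)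

theory Defs
  imports
    "HOL-Algebra.QuotRing"
    "HOL-Algebra.Embedded_Algebras"
    "HOL-Library.Poly_Mapping"
    "HOL-Library.Extended_Nat"
    "HOL-Analysis.Finite_Cartesian_Product"
begin

text \<open>
  The index set \<open>{1..q}\<close> is the finite type \<open>'q\<close>, so \<open>q = CARD('q)\<close>, the tuple
  \<open>(n_1, \<dots>, n_q)\<close> is a function \<open>n :: 'q \<Rightarrow> nat\<close>, the grading group is \<open>int ^ 'q\<close>, and
  \<open>axis i 1\<close> is its \<open>i\<close>-th standard basis element. The pair \<open>(i, j)\<close> stands for the variable
  \<open>x_ij\<close>. Besides polynomials we need Laurent polynomials, since the coordinate rings of the
  standard affine charts of the multiprojective space are rings of Laurent polynomials of degree 0.
\<close>

type_synonym ('q, 'k) polynomial = "('q \<times> nat \<Rightarrow>\<^sub>0 nat) \<Rightarrow>\<^sub>0 'k"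
type_synonym ('q, 'k) laurent = "('q \<times> nat \<Rightarrow>\<^sub>0 int) \<Rightarrow>\<^sub>0 'k"

definition ring_on :: "'a::comm_ring_1 set \<Rightarrow> 'a ring" where
  "ring_on A = \<lparr>carrier = A, monoid.mult = (*), one = 1, zero = 0, add = (+)\<rparr>"

definition multidegree :: "('q::finite \<times> nat \<Rightarrow>\<^sub>0 int) \<Rightarrow> int ^ 'q" where
  "multidegree m = (\<Sum>v\<in>Poly_Mapping.keys m. axis (fst v) (Poly_Mapping.lookup m v))"


section \<open>Multigraded polynomial rings, their quotients and Hilbert functions\<close>

definition vars :: "('q \<Rightarrow> nat) \<Rightarrow> ('q \<times> nat) set" where
  "vars n = {(i, j). j \<le> n i}"

definition vars0 :: "('q \<Rightarrow> nat) \<Rightarrow> ('q \<times> nat) set" where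
  "vars0 n = {(i, j). 1 \<le> j \<and> j \<le> n i}"

text \<open>
  The ring \<open>\<bbbS>\<close> is \<open>poly_ring (vars n)\<close> and \<open>\<bbbS>\<^sub>0\<close> is \<open>poly_ring (vars0 n)\<close>.
\<close>

definition poly_ring :: "('q \<times> nat) set \<Rightarrow> ('q, 'k::field) polynomial ring" where
  "poly_ring V = ring_on {p. \<forall>m\<in>Poly_Mapping.keys p. Poly_Mapping.keys m \<subseteq> V}"

definition var :: "'q \<times> nat \<Rightarrow> ('q, 'k::field) polynomial" where
  "var v = Poly_Mapping.single (Poly_Mapping.single v 1) 1"

definition constants :: "('q, 'k::field) polynomial set" where
  "constants = range (Poly_Mapping.single 0)"

definition component :: "('q::finite \<times> nat) set \<Rightarrow> int ^ 'q \<Rightarrow> ('q, 'k::field) polynomial set" where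
  "component V a = {p \<in> carrier (poly_ring V).
     \<forall>m\<in>Poly_Mapping.keys p. multidegree (Poly_Mapping.map int m) = a}"

definition homogeneous_ideal ::
    "('q::finite \<times> nat) set \<Rightarrow> ('q, 'k::field) polynomial set \<Rightarrow> bool" where
  "homogeneous_ideal V I \<longleftrightarrow>
     ideal I (poly_ring V) \<and> I = Idl\<^bsub>poly_ring V\<^esub> (I \<inter> (\<Union>a. component V a))"

text \<open>
  \<open>hilbert V I a\<close> is the dimension of the degree \<open>a\<close> component of \<open>poly_ring V / I\<close>, over the
  image of the field of constants in that ring.
\<close>

definition hilbert ::
    "('q::finite \<times> nat) set \<Rightarrow> ('q, 'k::field) polynomial set \<Rightarrow> int ^ 'q \<Rightarrow> int" where
  "hilbert V I a =
     (let proj = (\<lambda>f. I +>\<^bsub>poly_ring V\<^esub> f)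
      in int (ring.dim (poly_ring V Quot I) (proj ` constants) (proj ` component V a)))"

definition difference :: "(int ^ 'q::finite \<Rightarrow> int) \<Rightarrow> int ^ 'q \<Rightarrow> int" where
  "difference F a = F a + (\<Sum>p = 1..CARD('q). (- 1) ^ p *
     (\<Sum>T | T \<subseteq> UNIV \<and> card T = p. F (a - (\<Sum>i\<in>T. axis i 1))))"

definition artinian_ring :: "('a, 'b) ring_scheme \<Rightarrow> bool" where
  "artinian_ring R \<longleftrightarrow> cring R \<and>
     (\<forall>I :: nat \<Rightarrow> 'a set. (\<forall>k. ideal (I k) R \<and> I (Suc k) \<subseteq> I k) \<longrightarrow> (\<exists>N. \<forall>k\<ge>N. I k = I N))"

text \<open>
  The graded quotient \<open>\<bbbS>\<^sub>0 / J\<close> is artinian. Zero-dimensional schemes are nonempty here, and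
  correspondingly the zero ring is not counted as an artinian quotient.
\<close>

definition artinian_graded_quotient ::
    "('q::finite \<Rightarrow> nat) \<Rightarrow> ('q, 'k::field) polynomial set \<Rightarrow> bool" where
  "artinian_graded_quotient n J \<longleftrightarrow>
     homogeneous_ideal (vars0 n) J \<and> J \<noteq> carrier (poly_ring (vars0 n)) \<and>
     artinian_ring (poly_ring (vars0 n) Quot J)"


section \<open>Depth and Krull dimension\<close>

text \<open>
  \<open>fs\<close> is a regular sequence on the module \<open>R / I\<close>; the quotient of \<open>R / I\<close> by the first \<open>k\<close>
  elements of \<open>fs\<close> is \<open>R\<close> modulo the ideal generated by \<open>I\<close> and these elements.
\<close>

definition regular_sequence :: "('a, 'b) ring_scheme \<Rightarrow> 'a set \<Rightarrow> 'a list \<Rightarrow> bool" where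
  "regular_sequence R I fs \<longleftrightarrow> set fs \<subseteq> carrier R \<and>
     (\<forall>k < length fs. \<forall>g \<in> carrier R.
        fs ! k \<otimes>\<^bsub>R\<^esub> g \<in> Idl\<^bsub>R\<^esub> (I \<union> set (take k fs)) \<longrightarrow> g \<in> Idl\<^bsub>R\<^esub> (I \<union> set (take k fs))) \<and>
     Idl\<^bsub>R\<^esub> (I \<union> set fs) \<noteq> carrier R"

definition depth :: "('q \<times> nat) set \<Rightarrow> ('q, 'k::field) polynomial set \<Rightarrow> enat" where
  "depth V I = Sup {enat (length fs) | fs.
     regular_sequence (poly_ring V) I fs \<and> set fs \<subseteq> Idl\<^bsub>poly_ring V\<^esub> (var ` V)}"

definition krull_dim :: "('a, 'b) ring_scheme \<Rightarrow> enat" where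
  "krull_dim R = Sup {enat (length Ps - 1) | Ps.
     Ps \<noteq> [] \<and> (\<forall>P\<in>set Ps. primeideal P R) \<and> sorted_wrt (\<subset>) Ps}"


section \<open>Closed subschemes of a product of projective spaces\<close>

text \<open>
  A chart \<open>\<sigma>\<close> selects one variable \<open>x_(i, \<sigma> i)\<close> for each factor; it stands for the affine open
  set \<open>U_\<sigma>\<close> on which all of these variables are invertible. For a set \<open>D\<close> of variables,
  \<open>sections n D\<close> is the degree 0 part of the localization of \<open>\<bbbS>\<close> at the variables in \<open>D\<close>. So
  \<open>sections n (inverted \<sigma>)\<close> is the coordinate ring of \<open>U_\<sigma>\<close>, and
  \<open>sections n (inverted \<sigma> \<union> inverted \<tau>)\<close> is that of \<open>U_\<sigma> \<inter> U_\<tau>\<close>; restriction to the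
  intersection is inclusion.
\<close>

definition charts :: "('q \<Rightarrow> nat) \<Rightarrow> ('q \<Rightarrow> nat) set" where
  "charts n = {\<sigma>. \<forall>i. \<sigma> i \<le> n i}"

definition inverted :: "('q \<Rightarrow> nat) \<Rightarrow> ('q \<times> nat) set" where
  "inverted \<sigma> = {(i, \<sigma> i) | i. True}"

definition sections ::
    "('q::finite \<Rightarrow> nat) \<Rightarrow> ('q \<times> nat) set \<Rightarrow> ('q, 'k::field) laurent ring" where
  "sections n D = ring_on {p. \<forall>m\<in>Poly_Mapping.keys p. Poly_Mapping.keys m \<subseteq> vars n \<and>
     (\<forall>v. Poly_Mapping.lookup m v < 0 \<longrightarrow> v \<in> D) \<and> multidegree m = 0}"

text \<open>
  A closed subscheme is a quasi-coherent sheaf of ideals, given by its ideals on the charts, which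
  must generate the same ideal on each intersection of two charts. The values of \<open>X\<close> outside
  \<open>charts n\<close> are irrelevant.
\<close>

type_synonym ('q, 'k) scheme_data = "('q \<Rightarrow> nat) \<Rightarrow> ('q, 'k) laurent set"

definition closed_subscheme ::
    "('q::finite \<Rightarrow> nat) \<Rightarrow> ('q, 'k::field) scheme_data \<Rightarrow> bool" where
  "closed_subscheme n X \<longleftrightarrow>
     (\<forall>\<sigma>\<in>charts n. ideal (X \<sigma>) (sections n (inverted \<sigma>))) \<and>
     (\<forall>\<sigma>\<in>charts n. \<forall>\<tau>\<in>charts n.
        Idl\<^bsub>sections n (inverted \<sigma> \<union> inverted \<tau>)\<^esub> (X \<sigma>) =
        Idl\<^bsub>sections n (inverted \<sigma> \<union> inverted \<tau>)\<^esub> (X \<tau>))"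

definition nonempty_scheme ::
    "('q::finite \<Rightarrow> nat) \<Rightarrow> ('q, 'k::field) scheme_data \<Rightarrow> bool" where
  "nonempty_scheme n X \<longleftrightarrow> (\<exists>\<sigma>\<in>charts n. X \<sigma> \<noteq> carrier (sections n (inverted \<sigma>)))"

text \<open>
  The empty scheme would also get dimension 0 from this supremum (in \<open>enat\<close>), hence the separate
  condition in \<open>zero_dimensional_subscheme\<close>.
\<close>

definition scheme_dim :: "('q::finite \<Rightarrow> nat) \<Rightarrow> ('q, 'k::field) scheme_data \<Rightarrow> enat" where
  "scheme_dim n X = (SUP \<sigma>\<in>charts n. krull_dim (sections n (inverted \<sigma>) Quot X \<sigma>))"

definition zero_dimensional_subscheme ::
    "('q::finite \<Rightarrow> nat) \<Rightarrow> ('q, 'k::field) scheme_data \<Rightarrow> bool" where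
  "zero_dimensional_subscheme n X \<longleftrightarrow>
     closed_subscheme n X \<and> nonempty_scheme n X \<and> scheme_dim n X = 0"

text \<open>
  \<open>on_chart \<sigma> a F\<close> is the quotient of the form \<open>F\<close> of degree \<open>a\<close> by the monomial
  \<open>\<Prod>i. x_(i, \<sigma> i) ^ a_i\<close>.
\<close>

definition on_chart ::
    "('q::finite \<Rightarrow> nat) \<Rightarrow> int ^ 'q \<Rightarrow> ('q, 'k::field) polynomial \<Rightarrow> ('q, 'k) laurent" where
  "on_chart \<sigma> a F = (\<Sum>m\<in>Poly_Mapping.keys F.
     Poly_Mapping.single
       (Poly_Mapping.map int m - (\<Sum>i\<in>UNIV. Poly_Mapping.single (i, \<sigma> i) (a $ i)))
       (Poly_Mapping.lookup F m))"

definition vanishing_forms ::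
    "('q::finite \<Rightarrow> nat) \<Rightarrow> ('q, 'k::field) scheme_data \<Rightarrow> int ^ 'q \<Rightarrow> ('q, 'k) polynomial set" where
  "vanishing_forms n X a = {F \<in> component (vars n) a. \<forall>\<sigma>\<in>charts n. on_chart \<sigma> a F \<in> X \<sigma>}"

definition vanishing_ideal ::
    "('q::finite \<Rightarrow> nat) \<Rightarrow> ('q, 'k::field) scheme_data \<Rightarrow> ('q, 'k) polynomial set" where
  "vanishing_ideal n X = Idl\<^bsub>poly_ring (vars n)\<^esub> (\<Union>a. vanishing_forms n X a)"

definition ACM :: "('q::finite \<Rightarrow> nat) \<Rightarrow> ('q, 'k::field) scheme_data \<Rightarrow> bool" where
  "ACM n X \<longleftrightarrow> depth (vars n) (vanishing_ideal n X) = enat CARD('q)"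

end

(*
  Since X meets every chart in an artinian ring, over an infinite field there is for each i a linear
  form h_i of degree e_i, with nonzero coefficient at x_i0, that is a unit on X. Modulo I(X) and the
  h_i all variables are nilpotent. As the depth is q, the Koszul complex of the h_i on S / I(X) is
  exact below degree q, and since the h_i are homogeneous they form a regular sequence. Each h_i in
  turn takes one difference of the Hilbert function in the direction e_i, and eliminating x_i0 by
  means of h_i leaves an artinian quotient of S_0.

  Conversely, an ideal J of S_0 generates an ideal J S for which the x_i0 form a regular sequence, so
  that J S is saturated with respect to them; it is the ideal of a scheme supported at the point
  where all other variables vanish.
*)
theory Submission
  imports Defs
begin

text \<open>The depth hypothesis supplies some regular sequence in the irrelevant ideal, in general
  inhomogeneous and unrelated to the h_i; the only link is that its members have powers in the ideal
  generated by I(X) and the h_i. Koszul cohomology bridges the two: it is formed with the h_i, but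
  is made to vanish degree by degree along the given sequence. Going back to a regular sequence
  takes Nakayama's lemma, available because multiplication by h_i raises the total degree, which is
  bounded below.

  Krull dimension zero makes the coordinate ring of X on a chart finite-dimensional, by Noether
  normalization. There sum_j s^j x_ij is a unit for all but finitely many s, since modulo a prime
  ideal a Vandermonde argument would otherwise kill a coordinate equal to 1; one s outside the
  exceptions serves all charts and factors. The variables are nilpotent because on each chart x_ij /
  h_i satisfies a monic equation, whose homogenization is a power of x_ij modulo h_i; the product of
  these forms over all charts vanishes on X.\<close>

section \<open>Ideals and regular sequences\<close>

text \<open>Rings are carrier sets inside a type of class \<open>comm_ring_1\<close>, so that
  computations use the operations of the type; \<open>ring_on\<close> connects them with the
  algebraic structures in the statement.\<close>

locale comm_subring =
  fixes R :: "'a::comm_ring_1 set"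
  assumes zero_mem [simp]: "0 \<in> R" and one_mem [simp]: "1 \<in> R"
    and add_mem: "\<And>x y. x \<in> R \<Longrightarrow> y \<in> R \<Longrightarrow> x + y \<in> R"
    and uminus_mem: "\<And>x. x \<in> R \<Longrightarrow> - x \<in> R"
    and mult_mem: "\<And>x y. x \<in> R \<Longrightarrow> y \<in> R \<Longrightarrow> x * y \<in> R"
begin

lemma diff_mem: "x \<in> R \<Longrightarrow> y \<in> R \<Longrightarrow> x - y \<in> R"
  using add_mem[of x "- y"] uminus_mem by simp

lemma sum_mem: "(\<And>i. i \<in> A \<Longrightarrow> f i \<in> R) \<Longrightarrow> sum f A \<in> R"
  by (induction A rule: infinite_finite_induct) (auto intro: add_mem)

lemma prod_mem: "(\<And>i. i \<in> A \<Longrightarrow> f i \<in> R) \<Longrightarrow> prod f A \<in> R"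
  by (induction A rule: infinite_finite_induct) (auto intro: mult_mem)

lemma power_mem: "x \<in> R \<Longrightarrow> x ^ k \<in> R"
  by (induction k) (auto intro: mult_mem)

lemmas mem_intros = zero_mem one_mem add_mem uminus_mem mult_mem diff_mem sum_mem prod_mem power_mem

end

locale ideal_in = comm_subring R for R :: "'a::comm_ring_1 set" +
  fixes I :: "'a set"
  assumes I_sub: "I \<subseteq> R" and I_zero [simp]: "0 \<in> I"
    and I_add: "\<And>x y. x \<in> I \<Longrightarrow> y \<in> I \<Longrightarrow> x + y \<in> I"
    and I_mult: "\<And>r x. r \<in> R \<Longrightarrow> x \<in> I \<Longrightarrow> r * x \<in> I"
begin

lemma I_memR: "x \<in> I \<Longrightarrow> x \<in> R"
  using I_sub by blast

lemma I_uminus: "x \<in> I \<Longrightarrow> - x \<in> I"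
  using I_mult[of "-1" x] uminus_mem[OF one_mem] by simp

lemma I_diff: "x \<in> I \<Longrightarrow> y \<in> I \<Longrightarrow> x - y \<in> I"
  using I_add[of x "- y"] I_uminus by simp

lemma I_mult2: "r \<in> R \<Longrightarrow> x \<in> I \<Longrightarrow> x * r \<in> I"
  using I_mult[of r x] by (simp add: mult.commute)

lemma I_sum: "(\<And>i. i \<in> A \<Longrightarrow> f i \<in> I) \<Longrightarrow> sum f A \<in> I"
  by (induction A rule: infinite_finite_induct) (auto intro: I_add)

lemma cong_add: "x - y \<in> I \<Longrightarrow> x' - y' \<in> I \<Longrightarrow> (x + x') - (y + y') \<in> I"
  using I_add[of "x - y" "x' - y'"] by (simp add: algebra_simps)

lemma cong_trans: "x - y \<in> I \<Longrightarrow> y - z \<in> I \<Longrightarrow> x - z \<in> I"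
  using I_add[of "x - y" "y - z"] by simp

lemma cong_mem: "x - y \<in> I \<Longrightarrow> y \<in> I \<Longrightarrow> x \<in> I"
  using I_add[of "x - y" y] by simp

lemma cong_mult: "x \<in> R \<Longrightarrow> y' \<in> R \<Longrightarrow> x - y \<in> I \<Longrightarrow> x' - y' \<in> I \<Longrightarrow> x * x' - y * y' \<in> I"
  using I_add[OF I_mult[of x "x' - y'"] I_mult2[of y' "x - y"]] by (simp add: algebra_simps)

lemma eq_carrier_iff: "I = R \<longleftrightarrow> 1 \<in> I"
  using I_sub I_mult[of _ 1] by auto

end

lemma ring_on_simps [simp]:
  "carrier (ring_on R) = R" "x \<otimes>\<^bsub>ring_on R\<^esub> y = x * y" "x \<oplus>\<^bsub>ring_on R\<^esub> y = x + y"
  "\<one>\<^bsub>ring_on R\<^esub> = 1" "\<zero>\<^bsub>ring_on R\<^esub> = 0"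
  by (simp_all add: ring_on_def)

context comm_subring
begin

lemma cring_ring_on: "cring (ring_on R)"
proof (intro cringI abelian_groupI comm_monoidI)
  fix x assume "x \<in> carrier (ring_on R)"
  then show "\<exists>y\<in>carrier (ring_on R). y \<oplus>\<^bsub>ring_on R\<^esub> x = \<zero>\<^bsub>ring_on R\<^esub>"
    by (intro bexI[of _ "- x"]) (auto intro: uminus_mem)
qed (auto intro: mem_intros simp: algebra_simps)

lemma ring_ring_on: "ring (ring_on R)"
  using cring_ring_on cring.axioms(1) by blast

lemma a_inv_ring_on: "x \<in> R \<Longrightarrow> \<ominus>\<^bsub>ring_on R\<^esub> x = - x"
proof -
  assume x: "x \<in> R"
  interpret r: cring "ring_on R" by (rule cring_ring_on)
  show ?thesis using r.minus_equality[of "- x" x] x uminus_mem by simp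
qed

lemma ideal_ring_on_iff: "ideal I (ring_on R) \<longleftrightarrow> ideal_in R I"
proof
  assume i: "ideal I (ring_on R)"
  interpret i: ideal I "ring_on R" by (rule i)
  show "ideal_in R I"
  proof
    show "I \<subseteq> R" using i.a_subset by simp
    show "0 \<in> I" using additive_subgroup.zero_closed[OF i.additive_subgroup_axioms] by simp
    show "x + y \<in> I" if "x \<in> I" "y \<in> I" for x y using additive_subgroup.a_closed[OF i.additive_subgroup_axioms that] by simp
    show "r * x \<in> I" if "r \<in> R" "x \<in> I" for r x using i.I_l_closed[of x r] that by simp
  qed
next
  assume "ideal_in R I"
  then interpret i: ideal_in R I .
  show "ideal I (ring_on R)"
  proof (rule idealI[OF ring_ring_on])
    show "subgroup I (add_monoid (ring_on R))"
    proof (rule subgroup.intro)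
      show "inv\<^bsub>add_monoid (ring_on R)\<^esub> x \<in> I" if "x \<in> I" for x
        using a_inv_ring_on[of x] that i.I_uminus i.I_memR by (simp add: a_inv_def)
    qed (use i.I_sub i.I_zero i.I_add in auto)
  qed (auto intro: i.I_mult i.I_mult2)
qed

lemma Idl_ideal_in: "A \<subseteq> R \<Longrightarrow> ideal_in R (Idl\<^bsub>ring_on R\<^esub> A)"
  using ring.genideal_ideal[OF ring_ring_on, of A] by (simp add: ideal_ring_on_iff)

lemma Idl_superset: "A \<subseteq> R \<Longrightarrow> A \<subseteq> Idl\<^bsub>ring_on R\<^esub> A"
  using ring.genideal_self[OF ring_ring_on, of A] by simp

lemma Idl_minimal: "ideal_in R I \<Longrightarrow> A \<subseteq> I \<Longrightarrow> Idl\<^bsub>ring_on R\<^esub> A \<subseteq> I"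
  using ring.genideal_minimal[OF ring_ring_on, of I A] by (simp add: ideal_ring_on_iff)

lemma Idl_eqI:
  "ideal_in R I \<Longrightarrow> A \<subseteq> I \<Longrightarrow> (\<And>I'. ideal_in R I' \<Longrightarrow> A \<subseteq> I' \<Longrightarrow> I \<subseteq> I') \<Longrightarrow> Idl\<^bsub>ring_on R\<^esub> A = I"
  by (meson Idl_ideal_in Idl_minimal Idl_superset ideal_in.I_sub subset_antisym subset_trans)

text \<open>The ideal generated by \<open>I\<close> and \<open>set fs\<close> in explicit form
  (\<open>Idl_adj\<close>), so that membership comes with witnesses. The head of the list is
  adjoined last: the suffixes of the list give the intermediate ideals.\<close>

primrec adj :: "'a set \<Rightarrow> 'a list \<Rightarrow> 'a set" where
  "adj I [] = I"
| "adj I (f # fs) = {i + r * f | i r. i \<in> adj I fs \<and> r \<in> R}"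

lemma adj_ConsI: "i \<in> adj I fs \<Longrightarrow> r \<in> R \<Longrightarrow> i + r * f \<in> adj I (f # fs)"
  by auto

lemma adj_ideal: "ideal_in R I \<Longrightarrow> set fs \<subseteq> R \<Longrightarrow> ideal_in R (adj I fs)"
proof (induction fs)
  case (Cons f fs)
  then interpret i: ideal_in R "adj I fs" by simp
  have f: "f \<in> R" using Cons by simp
  show ?case
  proof
    show "adj I (f # fs) \<subseteq> R" using f i.I_sub by (auto intro!: add_mem mult_mem)
    show "0 \<in> adj I (f # fs)" by (auto intro!: exI[of _ "0::'a"])
  next
    fix x y assume "x \<in> adj I (f # fs)" "y \<in> adj I (f # fs)"
    then obtain i r j s where x: "x = i + r * f" "y = j + s * f"
      "i \<in> adj I fs" "j \<in> adj I fs" "r \<in> R" "s \<in> R" by auto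
    then have "(i + j) + (r + s) * f \<in> adj I (f # fs)" by (intro adj_ConsI i.I_add add_mem)
    then show "x + y \<in> adj I (f # fs)" using x by (simp add: algebra_simps del: adj.simps)
  next
    fix t x assume t: "t \<in> R" and "x \<in> adj I (f # fs)"
    then obtain i r where x: "x = i + r * f" "i \<in> adj I fs" "r \<in> R" by auto
    with t have "t * i + (t * r) * f \<in> adj I (f # fs)" by (intro adj_ConsI i.I_mult mult_mem)
    then show "t * x \<in> adj I (f # fs)" using x by (simp add: algebra_simps del: adj.simps)
  qed
qed simp

lemma adj_superset: "ideal_in R I \<Longrightarrow> set fs \<subseteq> R \<Longrightarrow> I \<union> set fs \<subseteq> adj I fs"
proof (induction fs)
  case (Cons f fs)
  interpret i: ideal_in R "adj I fs" using Cons adj_ideal by simp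
  have "f \<in> adj I (f # fs)" by (simp, intro exI[of _ 0] exI[of _ 1]) simp
  moreover have "adj I fs \<subseteq> adj I (f # fs)"
  proof
    fix x assume "x \<in> adj I fs"
    then show "x \<in> adj I (f # fs)" by (simp, intro exI[of _ x] exI[of _ 0]) simp
  qed
  ultimately show ?case using Cons by auto
qed simp

lemma adj_minimal:
  assumes "ideal_in R I'" "I \<subseteq> I'" "set fs \<subseteq> I'"
  shows "adj I fs \<subseteq> I'"
proof -
  interpret i: ideal_in R I' by fact
  show ?thesis using assms(2,3) by (induction fs) (auto intro!: i.I_add i.I_mult)
qed

lemma Idl_adj:
  assumes "ideal_in R I" "set fs \<subseteq> R"
  shows "Idl\<^bsub>ring_on R\<^esub> (I \<union> set fs) = adj I fs"
  by (rule Idl_eqI) (use assms adj_ideal adj_superset adj_minimal in \<open>auto 0 3\<close>)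

lemma adj_cong_set:
  "ideal_in R I \<Longrightarrow> set fs \<subseteq> R \<Longrightarrow> set fs = set gs \<Longrightarrow> adj I fs = adj I gs"
  using Idl_adj by metis

lemma adj_adj:
  assumes I: "ideal_in R I" and fs: "set fs \<subseteq> R" and gs: "set gs \<subseteq> R"
  shows "adj (adj I fs) gs = adj I (gs @ fs)"
  by (induction gs) auto

text \<open>Regularity apart from the properness of the last ideal. Here the head is consumed first,
  contrary to \<open>adj\<close>, because inductions along a regular sequence pass from
  \<open>I\<close> to \<open>I + (f)\<close>.\<close>

primrec nzd_seq :: "'a set \<Rightarrow> 'a list \<Rightarrow> bool" where
  "nzd_seq I [] \<longleftrightarrow> True"
| "nzd_seq I (f # fs) \<longleftrightarrow> (\<forall>g\<in>R. f * g \<in> I \<longrightarrow> g \<in> I) \<and> nzd_seq (adj I [f]) fs"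

lemma regular_sequence_iff:
  assumes "ideal_in R I"
  shows "regular_sequence (ring_on R) I fs \<longleftrightarrow>
    set fs \<subseteq> R \<and> nzd_seq I fs \<and> adj I fs \<noteq> R"
proof (cases "set fs \<subseteq> R")
  case True
  have "(\<forall>k<length fs. \<forall>g\<in>R. fs ! k * g \<in> adj I (take k fs) \<longrightarrow> g \<in> adj I (take k fs)) \<longleftrightarrow>
      nzd_seq I fs" using assms True
  proof (induction fs arbitrary: I)
    case (Cons f fs)
    \<comment> \<open>Adjoining in two stages puts \<open>f\<close> at the far end of the list,
      whereas the next prefix has it at the front; both lists describe the same ideal.\<close>
    have 1: "adj (adj I [f]) (take k fs) = adj I (f # take k fs)" for k
    proof -
      have s: "set (take k fs) \<subseteq> R" using Cons.prems(2) set_take_subset[of k fs] by auto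
      have "adj (adj I [f]) (take k fs) = adj I (take k fs @ [f])"
        by (rule adj_adj) (use Cons.prems s in auto)
      also have "\<dots> = adj I (f # take k fs)"
        by (rule adj_cong_set) (use Cons.prems s in auto)
      finally show ?thesis .
    qed
    have "ideal_in R (adj I [f])" by (rule adj_ideal) (use Cons.prems in auto)
    note IH = Cons.IH[OF this, unfolded 1]
    show ?case
      using IH Cons.prems by (auto simp del: adj.simps(2) simp: All_less_Suc2)
  qed simp
  moreover have "Idl\<^bsub>ring_on R\<^esub> (I \<union> set (take k fs)) = adj I (take k fs)" for k
    by (rule Idl_adj) (use assms True set_take_subset[of k fs] in auto)
  moreover have "Idl\<^bsub>ring_on R\<^esub> (I \<union> set fs) = adj I fs"
    by (rule Idl_adj) (use assms True in auto)
  ultimately show ?thesis using True by (simp add: regular_sequence_def)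
qed (simp add: regular_sequence_def)

end

section \<open>Koszul complexes\<close>

text \<open>
  A cochain of the Koszul complex of a sequence of length \<open>l\<close> is a function on Boolean words of
  length \<open>l\<close>; a word is the indicator of a set of positions, and the degree of the cochain is the
  number of \<open>True\<close> entries at which it is read. The complex of \<open>f # fs\<close> is the mapping cone of
  multiplication by \<open>f\<close> on the complex of \<open>fs\<close>.
\<close>

primrec koszul :: "'a::comm_ring_1 list \<Rightarrow> (bool list \<Rightarrow> 'a) \<Rightarrow> bool list \<Rightarrow> 'a" where
  "koszul [] c w = 0"
| "koszul (f # fs) c w =
     (if hd w then f * c (False # tl w) - koszul fs (\<lambda>v. c (True # v)) (tl w)
      else koszul fs (\<lambda>v. c (False # v)) (tl w))"

definition words :: "nat \<Rightarrow> nat \<Rightarrow> bool list set" where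
  "words l i = {w. length w = l \<and> count_list w True = i}"

lemma words_0: "words 0 i = (if i = 0 then {[]} else {})"
  by (auto simp: words_def)

lemma Cons_in_words: "b # w \<in> words (Suc l) i \<longleftrightarrow>
    (if b then \<exists>j. i = Suc j \<and> w \<in> words l j else w \<in> words l i)"
  by (auto simp: words_def)

lemma words_SucE:
  assumes "w \<in> words (Suc l) i"
  obtains (False) v where "w = False # v" "v \<in> words l i"
  | (True) v j where "w = True # v" "i = Suc j" "v \<in> words l j"
  using assms by (cases w) (auto simp: Cons_in_words words_def split: if_splits)

lemma count_list_True_le: "count_list w True \<le> length w"
  by (induction w) auto

lemma finite_words: "finite (words l i)"
proof -
  have "finite {w. set w \<subseteq> (UNIV :: bool set) \<and> length w = l}" by (rule finite_lists_length_eq) simp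
  then show ?thesis by (rule rev_finite_subset) (auto simp: words_def)
qed

lemma words_full: "words l l = {replicate l True}"
proof (induction l)
  case (Suc l)
  have "w \<notin> words l (Suc l)" for w
    using count_list_True_le[of w] by (simp add: words_def)
  then show ?case using Suc by (auto simp: Cons_in_words elim: words_SucE)
qed (simp add: words_0)

lemma words_gt: "i > l \<Longrightarrow> words l i = {}"
proof -
  assume "i > l"
  then have "w \<notin> words l i" for w
    using count_list_True_le[of w] by (simp add: words_def)
  then show ?thesis by blast
qed

lemma koszul_add: "koszul fs (\<lambda>w. c w + c' w) w = koszul fs c w + koszul fs c' w"
  by (induction fs arbitrary: c c' w) (auto simp: algebra_simps)

lemma koszul_uminus: "koszul fs (\<lambda>w. - c w) w = - koszul fs c w"
  by (induction fs arbitrary: c w) (auto simp: algebra_simps)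

lemma koszul_diff: "koszul fs (\<lambda>w. c w - c' w) w = koszul fs c w - koszul fs c' w"
  using koszul_add[of fs c "\<lambda>w. - c' w"] by (simp add: koszul_uminus)

lemma koszul_scale: "koszul fs (\<lambda>w. r * c w) w = r * koszul fs c w"
  by (induction fs arbitrary: c w) (auto simp: algebra_simps)

lemma koszul_zero [simp]: "koszul fs (\<lambda>w. 0) w = 0"
  by (induction fs arbitrary: w) auto

lemma koszul_sum: "koszul fs (\<lambda>w. \<Sum>t\<in>T. c t w) w = (\<Sum>t\<in>T. koszul fs (c t) w)"
  by (induction T rule: infinite_finite_induct) (auto simp: koszul_add)

lemma koszul_koszul: "koszul fs (koszul fs c) w = 0"
  by (induction fs arbitrary: c w) (auto simp: koszul_diff koszul_scale)

lemma koszul_words_0: "w \<in> words (length fs) 0 \<Longrightarrow> koszul fs c w = 0"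
  by (induction fs arbitrary: c w) (auto elim!: words_SucE)

text \<open>Multiplication by \<open>fs ! k\<close> is null-homotopic on the complex of \<open>fs\<close>.\<close>

primrec koszul_htpy :: "nat \<Rightarrow> (bool list \<Rightarrow> 'a::comm_ring_1) \<Rightarrow> bool list \<Rightarrow> 'a" where
  "koszul_htpy 0 c w = (if hd w then 0 else c (True # tl w))"
| "koszul_htpy (Suc k) c w =
     (if hd w then - koszul_htpy k (\<lambda>v. c (True # v)) (tl w)
      else koszul_htpy k (\<lambda>v. c (False # v)) (tl w))"

lemma koszul_htpy_diff: "koszul_htpy k (\<lambda>w. c w - c' w) w = koszul_htpy k c w - koszul_htpy k c' w"
  by (induction k arbitrary: c c' w) auto

lemma koszul_htpy_scale: "koszul_htpy k (\<lambda>w. r * c w) w = r * koszul_htpy k c w"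
  by (induction k arbitrary: c w) auto

lemma koszul_homotopy:
  "k < length fs \<Longrightarrow> length w = length fs \<Longrightarrow>
    koszul fs (koszul_htpy k c) w + koszul_htpy k (koszul fs c) w = fs ! k * c w"
proof (induction fs arbitrary: k c w)
  case (Cons f fs)
  then obtain b v where w: "w = b # v" "length v = length fs" by (cases w) auto
  show ?case
  proof (cases k)
    case 0
    then show ?thesis using w by (cases b) auto
  next
    case (Suc j)
    then have IH: "koszul fs (koszul_htpy j (\<lambda>v. c (b # v))) v
        + koszul_htpy j (koszul fs (\<lambda>v. c (b # v))) v = fs ! j * c (b # v)"
      using w Cons.IH[of j v "\<lambda>v. c (b # v)"] Cons.prems(1) by simp
    have "koszul_htpy j (\<lambda>v. f * c (False # v) - koszul fs (\<lambda>v. c (True # v)) v) v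
        = f * koszul_htpy j (\<lambda>v. c (False # v)) v - koszul_htpy j (koszul fs (\<lambda>v. c (True # v))) v"
      unfolding koszul_htpy_diff koszul_htpy_scale ..
    then show ?thesis using Suc w IH by (cases b) (simp_all add: koszul_uminus)
  qed
qed simp

section \<open>Exactness of Koszul complexes modulo an ideal\<close>

context comm_subring
begin

lemma koszul_mem: "set fs \<subseteq> R \<Longrightarrow> (\<forall>w. c w \<in> R) \<Longrightarrow> koszul fs c w \<in> R"
proof (induction fs arbitrary: c w)
  case (Cons f fs)
  have "koszul fs (\<lambda>v. c (b # v)) w' \<in> R" for b w'
    by (rule Cons.IH) (use Cons.prems in auto)
  moreover have "c w' \<in> R" for w' using Cons.prems(2) by blast
  moreover have "f \<in> R" using Cons.prems(1) by simp
  ultimately show ?case by (simp add: diff_mem mult_mem)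
qed simp

lemma koszul_htpy_mem: "(\<forall>w. c w \<in> R) \<Longrightarrow> koszul_htpy k c w \<in> R"
proof (induction k arbitrary: c w)
  case 0
  then have "c w' \<in> R" for w' by blast
  then show ?case by simp
next
  case (Suc k)
  have "koszul_htpy k (\<lambda>v. c (b # v)) w' \<in> R" for b w'
    by (rule Suc.IH) (use Suc.prems in auto)
  then show ?case by (simp add: uminus_mem)
qed

lemma koszul_mem_ideal:
  assumes I: "ideal_in R I"
  shows "set fs \<subseteq> R \<Longrightarrow> w \<in> words (length fs) (Suc i) \<Longrightarrow>
    (\<And>v. v \<in> words (length fs) i \<Longrightarrow> c v \<in> I) \<Longrightarrow> koszul fs c w \<in> I"
proof (induction fs arbitrary: c w i)
  case Nil
  then show ?case using I by (simp add: ideal_in.I_zero)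
next
  case (Cons f fs)
  interpret ideal_in R I by (rule I)
  from Cons.prems(2) have "w \<in> words (Suc (length fs)) (Suc i)" by simp
  then show ?case
  proof (cases rule: words_SucE)
    case (False v)
    have "koszul fs (\<lambda>v. c (False # v)) v \<in> I"
      by (rule Cons.IH[OF _ False(2)])
        (use Cons.prems(1) in simp, rule Cons.prems(3), simp add: Cons_in_words)
    then show ?thesis using False(1) by simp
  next
    case (True v j)
    have "koszul fs (\<lambda>v. c (True # v)) v \<in> I"
    \<comment> \<open>In degree 0 the second summand is a differential read at a word without
      \<open>True\<close>, where it is 0; the induction hypothesis does not reach degree -1.\<close>
    proof (cases i)
      case 0
      then show ?thesis using True by (simp add: koszul_words_0)
    next
      case (Suc k)
      have v: "v \<in> words (length fs) (Suc k)" using True(2,3) Suc by simp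
      show ?thesis
        by (rule Cons.IH[OF _ v])
          (use Cons.prems(1) in simp, rule Cons.prems(3), simp add: Cons_in_words Suc)
    qed
    moreover have "c (False # v) \<in> I"
      by (rule Cons.prems(3)) (use True in \<open>simp add: Cons_in_words\<close>)
    ultimately show ?thesis using True(1) Cons.prems(1) by (simp add: I_diff I_mult)
  qed
qed

lemma koszul_htpy_mem_ideal:
  assumes I: "ideal_in R I"
  shows "k < l \<Longrightarrow> w \<in> words l i \<Longrightarrow>
    (\<And>v. v \<in> words l (Suc i) \<Longrightarrow> c v \<in> I) \<Longrightarrow> koszul_htpy k c w \<in> I"
proof (induction k arbitrary: c w i l)
  case 0
  interpret ideal_in R I by (rule I)
  obtain m where l: "l = Suc m" using 0 by (cases l) auto
  from 0(2) show ?case unfolding l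
  proof (cases rule: words_SucE)
    case (False v)
    have "c (True # v) \<in> I" by (rule 0(3)) (simp add: Cons_in_words l False(2))
    then show ?thesis using False(1) by simp
  qed simp
next
  case (Suc k)
  interpret ideal_in R I by (rule I)
  obtain m where l: "l = Suc m" using Suc.prems by (cases l) auto
  from Suc.prems(2) show ?case unfolding l
  proof (cases rule: words_SucE)
    case (False v)
    have "koszul_htpy k (\<lambda>v. c (False # v)) v \<in> I"
      by (rule Suc.IH[OF _ False(2)])
        (use Suc.prems(1) l in simp, rule Suc.prems(3), simp add: Cons_in_words l)
    then show ?thesis using False(1) by simp
  next
    case (True v j)
    have "koszul_htpy k (\<lambda>v. c (True # v)) v \<in> I"
      by (rule Suc.IH[OF _ True(3)])
        (use Suc.prems(1) l in simp, rule Suc.prems(3), simp add: Cons_in_words l True(2))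
    then show ?thesis using True(1) by (simp add: I_uminus)
  qed
qed

text \<open>Exactness in degree \<open>i\<close> of the Koszul complex of \<open>fs\<close> over
  \<open>R / I\<close>, written with lifts to \<open>R\<close> and congruences modulo
  \<open>I\<close>. In degree 0 the coboundary of \<open>b\<close> vanishes, so the condition says
  that every cocycle has its values in \<open>I\<close>.\<close>

definition koszul_exact :: "'a set \<Rightarrow> 'a list \<Rightarrow> nat \<Rightarrow> bool" where
  "koszul_exact I fs i \<longleftrightarrow> (\<forall>c. (\<forall>w. c w \<in> R) \<longrightarrow>
     (\<forall>w\<in>words (length fs) (Suc i). koszul fs c w \<in> I) \<longrightarrow>
     (\<exists>b. (\<forall>w. b w \<in> R) \<and> (\<forall>w\<in>words (length fs) i. c w - koszul fs b w \<in> I)))"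

text \<open>With \<open>f\<close> regular on \<open>R / I\<close>, the long exact cohomology
  sequence of multiplication by \<open>f\<close> shows that exactness in degree \<open>i - 1\<close>
  modulo \<open>I + (f)\<close> makes \<open>f\<close> injective on the cohomology in degree
  \<open>i\<close>. The entries of \<open>fs\<close> kill this cohomology, hence so does
  \<open>f ^ t\<close>; both facts together make it zero.\<close>

lemma koszul_exact_nzd:
  assumes I: "ideal_in R I" and fs: "set fs \<subseteq> R" and f: "f \<in> R"
    and nzd: "\<And>g. g \<in> R \<Longrightarrow> f * g \<in> I \<Longrightarrow> g \<in> I"
    and pow: "f ^ t \<in> adj I fs"
    and ex: "\<And>j. i = Suc j \<Longrightarrow> koszul_exact (adj I [f]) fs j"
  shows "koszul_exact I fs i"
  unfolding koszul_exact_def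
proof (intro allI impI)
  interpret ideal_in R I by (rule I)
  fix c :: "bool list \<Rightarrow> 'a"
  let ?W = "words (length fs)"
  assume c: "(\<forall>w. c w \<in> R)" and cocycle: "\<forall>w\<in>?W (Suc i). koszul fs c w \<in> I"
  \<comment> \<open>\<open>B\<close> is the annihilator of the cohomology class of \<open>c\<close>;
    the goal is that it contains 1.\<close>
  define B where "B = {r \<in> R. \<exists>b. (\<forall>w. b w \<in> R) \<and> (\<forall>w\<in>?W i. r * c w - koszul fs b w \<in> I)}"
  have cR: "c w \<in> R" for w using c by auto
  have "ideal_in R B"
  proof
    show "B \<subseteq> R" by (auto simp: B_def)
    show "0 \<in> B" by (auto simp: B_def intro!: exI[of _ "\<lambda>_. 0::'a"])
  next
    fix x y assume "x \<in> B" "y \<in> B"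
    then obtain b b' where b: "x \<in> R" "y \<in> R" "(\<forall>w. b w \<in> R)" "(\<forall>w. b' w \<in> R)"
      "\<And>w. w \<in> ?W i \<Longrightarrow> x * c w - koszul fs b w \<in> I"
      "\<And>w. w \<in> ?W i \<Longrightarrow> y * c w - koszul fs b' w \<in> I" unfolding B_def by blast
    have "(x + y) * c w - koszul fs (\<lambda>w. b w + b' w) w \<in> I" if "w \<in> ?W i" for w
      using I_add[OF b(5,6)[OF that]] by (simp add: koszul_add algebra_simps)
    moreover have "\<forall>w. b w + b' w \<in> R" using b by (auto intro!: add_mem)
    moreover have "x + y \<in> R" using b(1,2) by (rule add_mem)
    ultimately show "x + y \<in> B"
      unfolding B_def by (intro CollectI conjI exI[of _ "\<lambda>w. b w + b' w"]) auto
  next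
    fix r x assume r: "r \<in> R" and "x \<in> B"
    then obtain b where b: "x \<in> R" "(\<forall>w. b w \<in> R)"
      "\<And>w. w \<in> ?W i \<Longrightarrow> x * c w - koszul fs b w \<in> I" unfolding B_def by blast
    have "(r * x) * c w - koszul fs (\<lambda>w. r * b w) w \<in> I" if "w \<in> ?W i" for w
      using I_mult[OF r b(3)[OF that]] by (simp add: koszul_scale algebra_simps)
    moreover have "\<forall>w. r * b w \<in> R" using b r by (auto intro!: mult_mem)
    moreover have "r * x \<in> R" using r b(1) by (rule mult_mem)
    ultimately show "r * x \<in> B"
      unfolding B_def by (intro CollectI conjI exI[of _ "\<lambda>w. r * b w"]) auto
  qed
  moreover have "I \<subseteq> B"
    using I_memR by (auto simp: B_def intro!: exI[of _ "\<lambda>_. 0::'a"] I_mult2 cR)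
  moreover have "set fs \<subseteq> B"
  proof
    fix g assume "g \<in> set fs"
    then obtain k where k: "k < length fs" "g = fs ! k" by (auto simp: in_set_conv_nth)
    \<comment> \<open>By the null-homotopy, \<open>g * c\<close> is the coboundary of
      \<open>koszul_htpy k c\<close> up to the contraction of \<open>koszul fs c\<close>, which lies
      in \<open>I\<close>.\<close>
    have "g * c w - koszul fs (koszul_htpy k c) w \<in> I" if w: "w \<in> ?W i" for w
    proof -
      have "koszul_htpy k (koszul fs c) w \<in> I"
        by (rule koszul_htpy_mem_ideal[OF I k(1) w]) (use cocycle in auto)
      moreover have "length w = length fs" using w by (simp add: words_def)
      ultimately show ?thesis using koszul_homotopy[OF k(1), of w c] k(2)
        by (metis add_diff_cancel_left')
    qed
    moreover have "\<forall>w. koszul_htpy k c w \<in> R" using koszul_htpy_mem[OF c] by auto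
    moreover have "g \<in> R" using \<open>g \<in> set fs\<close> fs by auto
    ultimately show "g \<in> B" unfolding B_def by blast
  qed
  ultimately have "adj I fs \<subseteq> B" by (rule adj_minimal)
  then have "f ^ t \<in> B" using pow by auto
  \<comment> \<open>Injectivity of \<open>f\<close> on the cohomology, spelled out: one factor
    \<open>f\<close> is cancelled.\<close>
  moreover have "f ^ s \<in> B" if "f ^ Suc s \<in> B" for s
  proof -
    from that have "\<exists>b. (\<forall>w. b w \<in> R) \<and> (\<forall>w\<in>?W i. f ^ Suc s * c w - koszul fs b w \<in> I)"
      by (simp only: B_def mem_Collect_eq)
    then obtain b where b1: "\<forall>w. b w \<in> R"
      and b2: "\<forall>w\<in>?W i. f ^ Suc s * c w - koszul fs b w \<in> I" by (elim exE conjE)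
    note b = b1 b2[rule_format]
    have fsc: "f ^ s * c w \<in> R" for w using f cR by (intro mult_mem power_mem)
    have "\<exists>e. (\<forall>w. e w \<in> R) \<and> (\<forall>w\<in>?W i. f ^ s * c w - koszul fs e w \<in> I)"
    proof (cases i)
      case 0
      have "f ^ s * c w \<in> I" if "w \<in> ?W i" for w
      proof -
        have "koszul fs b w = 0" using that 0 by (simp add: koszul_words_0)
        then show ?thesis using b(2)[OF that] nzd[of "f ^ s * c w"] fsc by (simp add: mult.assoc)
      qed
      then show ?thesis by (intro exI[of _ "\<lambda>_. 0"]) auto
    next
      case (Suc j)
      interpret A: ideal_in R "adj I [f]" by (rule adj_ideal) (use I f in auto)
      \<comment> \<open>Modulo \<open>f\<close> the cochain \<open>b\<close> becomes a cocycle, so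
        it is a coboundary there. Its difference to that coboundary is \<open>f * e\<close> modulo
        \<open>I\<close>, and \<open>e\<close> is the cochain that bounds
        \<open>f ^ s * c\<close>.\<close>
      have "koszul fs b w \<in> adj I [f]" if "w \<in> ?W (Suc j)" for w
      proof -
        have "koszul fs b w = - (f ^ Suc s * c w - koszul fs b w) + (f ^ s * c w) * f"
          by (simp add: algebra_simps)
        also have "\<dots> \<in> adj I [f]"
          by (rule adj_ConsI) (use that Suc I_uminus[OF b(2)[of w]] fsc in \<open>auto simp del: power_Suc\<close>)
        finally show ?thesis .
      qed
      then have "\<exists>a. (\<forall>w. a w \<in> R) \<and> (\<forall>w\<in>?W j. b w - koszul fs a w \<in> adj I [f])"
        using ex[OF Suc, unfolded koszul_exact_def, rule_format, of b] b(1) by simp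
      then obtain a where a1: "\<forall>w. a w \<in> R"
        and a2: "\<forall>w\<in>?W j. b w - koszul fs a w \<in> adj I [f]" by (elim exE conjE)
      note a = a1 a2[rule_format]
      have "\<exists>e. e \<in> R \<and> (w \<in> ?W j \<longrightarrow> b w - koszul fs a w - f * e \<in> I)" for w
      proof (cases "w \<in> ?W j")
        case True
        then show ?thesis using a(2)[OF True] by (auto simp: mult.commute)
      qed (use zero_mem in blast)
      then obtain e where e: "\<And>w. e w \<in> R"
        "\<And>w. w \<in> ?W j \<Longrightarrow> b w - koszul fs a w - f * e w \<in> I" by metis
      have "f ^ s * c w - koszul fs e w \<in> I" if w: "w \<in> ?W i" for w
      proof -
        have "koszul fs (\<lambda>w. b w - koszul fs a w - f * e w) w \<in> I"
          using koszul_mem_ideal[OF I fs _ e(2)] w Suc by simp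
        then have "koszul fs b w - f * koszul fs e w \<in> I"
          by (simp add: koszul_diff koszul_scale koszul_koszul)
        from I_add[OF b(2)[OF w] this] have "f * (f ^ s * c w - koszul fs e w) \<in> I"
          by (simp add: algebra_simps)
        moreover have "f ^ s * c w - koszul fs e w \<in> R"
          using fsc koszul_mem[OF fs, of e] e by (auto intro!: diff_mem)
        ultimately show ?thesis by (rule nzd[rotated])
      qed
      then show ?thesis using e by auto
    qed
    then show ?thesis unfolding B_def using f by (auto intro: power_mem)
  qed
  ultimately have "f ^ 0 \<in> B" by (induction t) auto
  then show "\<exists>b. (\<forall>w. b w \<in> R) \<and> (\<forall>w\<in>?W i. c w - koszul fs b w \<in> I)" unfolding B_def by simp
qed

lemma adj_mono: "I \<subseteq> I' \<Longrightarrow> adj I fs \<subseteq> adj I' fs"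
  by (induction fs) (simp, force)

text \<open>Each further regular element in \<open>gs\<close> buys one more exact degree: the
  induction passes to \<open>I + (g)\<close> with the degree lowered by one, and the condition on
  powers survives enlarging \<open>I\<close>.\<close>

theorem koszul_exact_if_nzd_seq:
  "ideal_in R I \<Longrightarrow> set fs \<subseteq> R \<Longrightarrow> set gs \<subseteq> R \<Longrightarrow> nzd_seq I gs \<Longrightarrow>
    (\<And>g. g \<in> set gs \<Longrightarrow> \<exists>t. g ^ t \<in> adj I fs) \<Longrightarrow> i < length gs \<Longrightarrow> koszul_exact I fs i"
proof (induction gs arbitrary: I i)
  case (Cons g gs)
  have A: "ideal_in R (adj I [g])" by (rule adj_ideal) (use Cons.prems in auto)
  have sub: "adj I fs \<subseteq> adj (adj I [g]) fs"
    by (rule adj_mono) (use adj_superset[of I "[g]"] Cons.prems in auto)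
  obtain t where t: "g ^ t \<in> adj I fs" using Cons.prems(5)[of g] by auto
  show ?case
  proof (rule koszul_exact_nzd[OF Cons.prems(1,2) _ _ t])
    show "koszul_exact (adj I [g]) fs j" if "i = Suc j" for j
    proof (rule Cons.IH[OF A])
      show "\<exists>t. g' ^ t \<in> adj (adj I [g]) fs" if "g' \<in> set gs" for g'
        using Cons.prems(5)[of g'] that sub by auto
    qed (use Cons.prems that in auto)
  qed (use Cons.prems in auto)
qed simp

text \<open>At the only word of top degree the differential is a signed combination of
  \<open>fs\<close> with free coefficients. Together with the converse
  \<open>adj_koszul_full\<close> this identifies the top cohomology with
  \<open>R / adj I fs\<close>.\<close>

lemma koszul_full_mem_adj:
  "ideal_in R I \<Longrightarrow> set fs \<subseteq> R \<Longrightarrow> (\<forall>w. b w \<in> R) \<Longrightarrow> koszul fs b (replicate (length fs) True) \<in> adj I fs"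
proof (induction fs arbitrary: b)
  case (Cons f fs)
  interpret A: ideal_in R "adj I fs" by (rule adj_ideal) (use Cons in auto)
  let ?T = "replicate (length fs) True"
  have "koszul fs (\<lambda>v. b (True # v)) ?T \<in> adj I fs"
    by (rule Cons.IH) (use Cons in auto)
  then have "- koszul fs (\<lambda>v. b (True # v)) ?T + b (False # ?T) * f \<in> adj I (f # fs)"
    by (intro adj_ConsI A.I_uminus) (use Cons in auto)
  then show ?case by (simp add: algebra_simps del: adj.simps)
qed (simp add: ideal_in.I_zero)

lemma adj_koszul_full:
  "ideal_in R I \<Longrightarrow> set fs \<subseteq> R \<Longrightarrow> p \<in> adj I fs \<Longrightarrow>
    \<exists>b. (\<forall>w. b w \<in> R) \<and> p - koszul fs b (replicate (length fs) True) \<in> I"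
proof (induction fs arbitrary: p)
  case Nil
  then show ?case by (auto intro!: exI[of _ "\<lambda>_. 0::'a"])
next
  case (Cons f fs)
  from Cons.prems(3) obtain i r where p: "p = i + r * f" "i \<in> adj I fs" "r \<in> R" by auto
  obtain b where b: "(\<forall>w. b w \<in> R)" "i - koszul fs b (replicate (length fs) True) \<in> I"
    using Cons.IH[of i] Cons.prems p(2) by auto
  have "\<forall>w. (if hd w then - b (tl w) else r) \<in> R" using b p by (auto intro!: uminus_mem)
  then show ?case
    using b p by (intro exI[of _ "\<lambda>w. if hd w then - b (tl w) else r"])
      (simp add: koszul_uminus algebra_simps)
qed

text \<open>The constant cochain 1 is a cocycle in top degree, since no words lie beyond it.\<close>

lemma koszul_exact_top:
  assumes "ideal_in R I" "set fs \<subseteq> R" "koszul_exact I fs (length fs)"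
  shows "1 \<in> adj I fs"
proof -
  interpret A: ideal_in R "adj I fs" by (rule adj_ideal) (use assms in auto)
  obtain b where "(\<forall>w. b w \<in> R)" "1 - koszul fs b (replicate (length fs) True) \<in> I"
    using assms(3)[unfolded koszul_exact_def, rule_format, of "\<lambda>_. 1"]
    by (auto simp: words_gt words_full)
  moreover have "I \<subseteq> adj I fs" using adj_superset assms by blast
  ultimately show ?thesis using koszul_full_mem_adj[OF assms(1,2)] A.cong_mem by blast
qed

text \<open>A relation \<open>f * u \<in> adj I fs\<close> is a cocycle in the last degree but one
  of the complex of \<open>f # fs\<close>, with value \<open>u\<close> at the word that omits only
  \<open>f\<close>. If it is a coboundary, then \<open>u\<close> is a coboundary in the top degree
  of the complex of \<open>fs\<close>.\<close>

lemma koszul_exact_Cons_nzd: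
  assumes I: "ideal_in R I" and fs: "set fs \<subseteq> R" and "f \<in> R" and u: "u \<in> R" "f * u \<in> adj I fs"
    and ex: "koszul_exact I (f # fs) (length fs)"
  shows "u \<in> adj I fs"
proof -
  interpret A: ideal_in R "adj I fs" by (rule adj_ideal) (use I fs in auto)
  let ?T = "replicate (length fs) True"
  obtain a where a: "(\<forall>w. a w \<in> R)" "f * u - koszul fs a ?T \<in> I"
    using adj_koszul_full[OF I fs u(2)] by auto
  define c where "c w = (if hd w then a (tl w) else u)" for w
  have "(\<forall>w. c w \<in> R)" using a u by (auto simp: c_def)
  moreover have "koszul (f # fs) c w \<in> I" if "w \<in> words (length (f # fs)) (Suc (length fs))" for w
    using that a words_full[of "Suc (length fs)"] by (simp add: c_def)
  ultimately obtain b where b: "(\<forall>w. b w \<in> R)"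
    "\<And>w. w \<in> words (length (f # fs)) (length fs) \<Longrightarrow> c w - koszul (f # fs) b w \<in> I"
    using ex unfolding koszul_exact_def by metis
  have "False # ?T \<in> words (length (f # fs)) (length fs)"
    using words_full[of "length fs"] by (simp add: Cons_in_words)
  from b(2)[OF this] have "u - koszul fs (\<lambda>v. b (False # v)) ?T \<in> I" by (simp add: c_def)
  moreover have "koszul fs (\<lambda>v. b (False # v)) ?T \<in> adj I fs"
    by (rule koszul_full_mem_adj) (use I fs b in auto)
  moreover have "I \<subseteq> adj I fs" using adj_superset I fs by blast
  ultimately show ?thesis using A.cong_mem by blast
qed

end

text \<open>
  In the presence of a grading bounded below, exactness descends to shorter sequences of elements
  of degree 1, because Nakayama's lemma holds for all graded modules.
\<close>

locale graded_subring = comm_subring R for R :: "'a::comm_ring_1 set" +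
  fixes part :: "nat \<Rightarrow> 'a \<Rightarrow> 'a"
  assumes part_mem: "\<And>t x. x \<in> R \<Longrightarrow> part t x \<in> R"
    and part_add: "\<And>t x y. part t (x + y) = part t x + part t y"
    and part_decomp: "\<And>x. x \<in> R \<Longrightarrow> \<exists>T0. \<forall>T\<ge>T0. x = (\<Sum>t<T. part t x)"
begin

text \<open>Degree 1 is expressed through the projections \<open>part\<close>, in the form in which
  the Koszul differential uses it (\<open>part_koszul\<close>).\<close>

definition linear_form :: "'a \<Rightarrow> bool" where
  "linear_form f \<longleftrightarrow> f \<in> R \<and> (\<forall>x\<in>R. part 0 (f * x) = 0 \<and> (\<forall>t. part (Suc t) (f * x) = f * part t x))"

definition graded_ideal :: "'a set \<Rightarrow> bool" where
  "graded_ideal I \<longleftrightarrow> ideal_in R I \<and> (\<forall>x\<in>I. \<forall>t. part t x \<in> I)"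

lemma part_zero [simp]: "part t 0 = 0"
  using part_add[of t 0 0] by simp

lemma part_uminus: "part t (- x) = - part t x"
  using part_add[of t x "- x"] by (simp add: eq_neg_iff_add_eq_0 add.commute)

lemma part_diff: "part t (x - y) = part t x - part t y"
  using part_add[of t x "- y"] by (simp add: part_uminus)

lemma part_koszul:
  "(\<And>f. f \<in> set fs \<Longrightarrow> linear_form f) \<Longrightarrow> (\<forall>w. c w \<in> R) \<Longrightarrow>
    part 0 (koszul fs c w) = 0 \<and> part (Suc t) (koszul fs c w) = koszul fs (\<lambda>v. part t (c v)) w"
proof (induction fs arbitrary: c w)
  case (Cons f fs)
  have IH: "part 0 (koszul fs (\<lambda>v. c (b # v)) w') = 0 \<and>
      part (Suc t) (koszul fs (\<lambda>v. c (b # v)) w') = koszul fs (\<lambda>v. part t (c (b # v))) w'" for b w'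
    by (rule Cons.IH) (use Cons.prems in auto)
  have "c w' \<in> R" for w' using Cons.prems(2) by blast
  then have "part 0 (f * c w') = 0 \<and> part (Suc t) (f * c w') = f * part t (c w')" for w'
    using Cons.prems(1)[of f] by (simp add: linear_form_def)
  then show ?case using IH by (simp add: part_diff)
qed simp

text \<open>The complex of \<open>f # fs\<close> is a cone, so its exactness in degree
  \<open>i + 1\<close> says that every class of degree \<open>i\<close> for \<open>fs\<close> is
  \<open>f\<close> times another one. As \<open>f\<close> raises the internal degree by one and
  internal degrees start at 0, repeated division by \<open>f\<close> ends in 0.\<close>

lemma koszul_exact_tail:
  assumes I: "graded_ideal I" and lin: "\<And>g. g \<in> set (f # fs) \<Longrightarrow> linear_form g"
    and ex: "koszul_exact I (f # fs) (Suc i)"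
  shows "koszul_exact I fs i"
proof -
  interpret ideal_in R I using I by (simp add: graded_ideal_def)
  have fs: "set fs \<subseteq> R" and f: "f \<in> R" using lin by (auto simp: linear_form_def)
  let ?W = "words (length fs)"
  define Z where "Z c \<longleftrightarrow> (\<forall>w. c w \<in> R) \<and> (\<forall>w\<in>?W (Suc i). koszul fs c w \<in> I)" for c
  define B where "B c \<longleftrightarrow> (\<exists>b. (\<forall>w. b w \<in> R) \<and> (\<forall>w\<in>?W i. c w - koszul fs b w \<in> I))" for c
  have step: "\<exists>b a. Z b \<and> (\<forall>w. a w \<in> R) \<and> (\<forall>w\<in>?W i. c w - (f * b w - koszul fs a w) \<in> I)"
    if Z: "Z c" for c
  proof -
    \<comment> \<open>The cocycle \<open>c\<close> is placed on the words that contain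
      \<open>f\<close> and extended by 0, which raises its degree by one.\<close>
    define c' where "c' w = (if hd w then c (tl w) else 0)" for w
    have "(\<forall>w. c' w \<in> R)" using Z by (auto simp: c'_def Z_def)
    moreover have "koszul (f # fs) c' w \<in> I" if "w \<in> words (length (f # fs)) (Suc (Suc i))" for w
    proof -
      from that have "w \<in> words (Suc (length fs)) (Suc (Suc i))" by simp
      then show ?thesis by (cases rule: words_SucE) (use Z in \<open>auto simp: c'_def Z_def intro: I_uminus\<close>)
    qed
    ultimately obtain b where b: "(\<forall>w. b w \<in> R)"
      "\<And>w. w \<in> words (length (f # fs)) (Suc i) \<Longrightarrow> c' w - koszul (f # fs) b w \<in> I"
      using ex unfolding koszul_exact_def by metis
    have "koszul fs (\<lambda>v. b (False # v)) v \<in> I" if "v \<in> ?W (Suc i)" for v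
      using b(2)[of "False # v"] that I_uminus[of "- koszul fs (\<lambda>v. b (False # v)) v"]
      by (simp add: c'_def Cons_in_words)
    moreover have "c v - (f * b (False # v) - koszul fs (\<lambda>v. b (True # v)) v) \<in> I"
      if "v \<in> ?W i" for v
      using b(2)[of "True # v"] that by (simp add: c'_def Cons_in_words)
    ultimately show ?thesis using b(1)
      by (intro exI[of _ "\<lambda>v. b (False # v)"] exI[of _ "\<lambda>v. b (True # v)"]) (auto simp: Z_def)
  qed
  \<comment> \<open>Induction on the internal degree: the part of degree \<open>t + 1\<close> of
    \<open>f * b\<close> is \<open>f\<close> times the part of degree \<open>t\<close> of the
    cocycle \<open>b\<close>.\<close>
  have homog: "B (\<lambda>w. part t (c w))" if "Z c" for t c
    using that
  proof (induction t arbitrary: c)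
    case 0
    obtain b a where ba: "Z b" "(\<forall>w. a w \<in> R)" "\<And>w. w \<in> ?W i \<Longrightarrow> c w - (f * b w - koszul fs a w) \<in> I"
      using step[OF 0] by blast
    have "part 0 (c w) \<in> I" if "w \<in> ?W i" for w
    proof -
      have "part 0 (c w - (f * b w - koszul fs a w)) \<in> I"
        using I ba(3)[OF that] by (simp add: graded_ideal_def)
      moreover have "part 0 (f * b w) = 0" using lin[of f] ba(1) by (auto simp: linear_form_def Z_def)
      moreover have "part 0 (koszul fs a w) = 0" using part_koszul[of fs a w] lin ba(2) by auto
      ultimately show ?thesis by (simp add: part_diff)
    qed
    then show ?case unfolding B_def by (intro exI[of _ "\<lambda>_. 0"]) auto
  next
    case (Suc t)
    obtain b a where ba: "Z b" "(\<forall>w. a w \<in> R)" "\<And>w. w \<in> ?W i \<Longrightarrow> c w - (f * b w - koszul fs a w) \<in> I"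
      using step[OF Suc.prems] by blast
    obtain e where e: "(\<forall>w. e w \<in> R)" "\<And>w. w \<in> ?W i \<Longrightarrow> part t (b w) - koszul fs e w \<in> I"
      using Suc.IH[OF ba(1)] unfolding B_def by blast
    define b' where "b' w = f * e w - part t (a w)" for w
    have "part (Suc t) (c w) - koszul fs b' w \<in> I" if w: "w \<in> ?W i" for w
    proof -
      have "part (Suc t) (c w - (f * b w - koszul fs a w)) \<in> I"
        using I ba(3)[OF w] by (simp add: graded_ideal_def)
      moreover have "part (Suc t) (f * b w) = f * part t (b w)"
        using lin[of f] ba(1) by (auto simp: linear_form_def Z_def)
      moreover have "part (Suc t) (koszul fs a w) = koszul fs (\<lambda>w. part t (a w)) w"
        using part_koszul[of fs a w] lin ba(2) by auto
      ultimately have 1: "part (Suc t) (c w) - (f * part t (b w) - koszul fs (\<lambda>w. part t (a w)) w) \<in> I"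
        by (simp add: part_diff)
      have "f * (part t (b w) - koszul fs e w) \<in> I" using e(2)[OF w] f by (rule I_mult[rotated])
      from I_add[OF 1 this] show ?thesis
        unfolding b'_def koszul_diff koszul_scale by (simp add: algebra_simps)
    qed
    moreover have "(\<forall>w. b' w \<in> R)"
      using e(1) ba(2) f by (auto simp: b'_def intro!: diff_mem mult_mem part_mem)
    ultimately show ?case unfolding B_def by blast
  qed
  have "B c" if Z: "Z c" for c
  proof -
    have cR: "c w \<in> R" for w using Z by (auto simp: Z_def)
    obtain T0 where T0: "\<And>w T. T \<ge> T0 w \<Longrightarrow> c w = (\<Sum>t<T. part t (c w))"
      using part_decomp[OF cR] by metis
    define T where "T = Max (insert 0 (T0 ` ?W i))"
    have T: "c w = (\<Sum>t<T. part t (c w))" if "w \<in> ?W i" for w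
      by (rule T0) (use that finite_words in \<open>auto simp: T_def intro!: Max_ge\<close>)
    obtain b where b: "\<And>t. \<forall>w. b t w \<in> R"
      "\<And>t w. w \<in> ?W i \<Longrightarrow> part t (c w) - koszul fs (b t) w \<in> I"
      using homog[OF Z] unfolding B_def by metis
    have "c w - koszul fs (\<lambda>w. \<Sum>t<T. b t w) w \<in> I" if w: "w \<in> ?W i" for w
    proof -
      have "(\<Sum>t<T. part t (c w) - koszul fs (b t) w) \<in> I" by (rule I_sum) (rule b(2)[OF w])
      then show ?thesis using T[OF w] by (simp add: sum_subtractf koszul_sum)
    qed
    moreover have "\<forall>w. (\<Sum>t<T. b t w) \<in> R" using b(1) by (auto intro!: sum_mem)
    ultimately show ?thesis
      unfolding B_def by (intro exI[of _ "\<lambda>w. \<Sum>t<T. b t w"]) auto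
  qed
  then show ?thesis unfolding koszul_exact_def Z_def B_def by blast
qed

text \<open>Deleting the entries of \<open>xs\<close> one by one lowers the exact degrees by one
  each time, and what remains for \<open>f # ys\<close> is just enough for
  \<open>koszul_exact_Cons_nzd\<close>.\<close>

theorem nzd_suffix:
  assumes I: "graded_ideal I" and lin: "\<And>g. g \<in> set (xs @ f # ys) \<Longrightarrow> linear_form g"
    and ex: "\<And>i. i < length (xs @ f # ys) \<Longrightarrow> koszul_exact I (xs @ f # ys) i"
    and u: "u \<in> R" "f * u \<in> adj I ys"
  shows "u \<in> adj I ys"
proof -
  have "koszul_exact I (f # ys) i" if "i < length (f # ys)" for i
    using ex lin that
  proof (induction xs arbitrary: i)
    case (Cons x xs)
    show ?case
    proof (rule Cons.IH)
      fix j assume "j < length (xs @ f # ys)"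
      then show "koszul_exact I (xs @ f # ys) j"
        using koszul_exact_tail[OF I, of x "xs @ f # ys" j] Cons.prems(1,2) by simp
    qed (use Cons.prems in auto)
  qed simp
  then show ?thesis
    by (intro koszul_exact_Cons_nzd[OF _ _ _ u])
      (use I lin in \<open>auto simp: graded_ideal_def linear_form_def\<close>)
qed

end

section \<open>Linear algebra modulo an ideal\<close>

locale scalars = comm_subring R for R :: "'a::comm_ring_1 set" +
  fixes \<kappa> :: "'k::field \<Rightarrow> 'a"
  assumes scalar_add: "\<kappa> (a + b) = \<kappa> a + \<kappa> b"
    and scalar_mult: "\<kappa> (a * b) = \<kappa> a * \<kappa> b"
    and scalar_one [simp]: "\<kappa> 1 = 1"
    and scalar_mem: "\<kappa> a \<in> R"
begin

lemma scalar_zero [simp]: "\<kappa> 0 = 0"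
  using scalar_add[of 0 0] by simp

lemma scalar_uminus: "\<kappa> (- a) = - \<kappa> a"
  using scalar_add[of a "- a"] by (simp add: eq_neg_iff_add_eq_0 add.commute)

lemma scalar_diff: "\<kappa> (a - b) = \<kappa> a - \<kappa> b"
  using scalar_add[of a "- b"] by (simp add: scalar_uminus)

definition lin_comb :: "'a set \<Rightarrow> ('a \<Rightarrow> 'k) \<Rightarrow> 'a" where
  "lin_comb B f = (\<Sum>b\<in>B. \<kappa> (f b) * b)"

definition lin_subspace :: "'a set \<Rightarrow> bool" where
  "lin_subspace U \<longleftrightarrow> 0 \<in> U \<and> (\<forall>u\<in>U. \<forall>v\<in>U. u + v \<in> U) \<and> (\<forall>c. \<forall>u\<in>U. \<kappa> c * u \<in> U)"

text \<open>Representatives in \<open>U\<close> of a basis of the image of \<open>U\<close> in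
  \<open>R / I\<close>. Coefficients are indexed by the elements of \<open>B\<close> themselves, so
  bases are sets and not families.\<close>

definition basis_mod :: "'a set \<Rightarrow> 'a set \<Rightarrow> 'a set \<Rightarrow> bool" where
  "basis_mod I U B \<longleftrightarrow> finite B \<and> B \<subseteq> U \<and>
     (\<forall>f. lin_comb B f \<in> I \<longrightarrow> (\<forall>b\<in>B. f b = 0)) \<and> (\<forall>u\<in>U. \<exists>f. u - lin_comb B f \<in> I)"

lemma lin_comb_add: "lin_comb B (\<lambda>b. f b + g b) = lin_comb B f + lin_comb B g"
  by (simp add: lin_comb_def scalar_add algebra_simps sum.distrib)

lemma lin_comb_diff: "lin_comb B (\<lambda>b. f b - g b) = lin_comb B f - lin_comb B g"
  by (simp add: lin_comb_def scalar_diff algebra_simps sum_subtractf)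

lemma lin_comb_scale: "lin_comb B (\<lambda>b. c * f b) = \<kappa> c * lin_comb B f"
  by (simp add: lin_comb_def scalar_mult sum_distrib_left mult.assoc)

lemma lin_comb_cong: "(\<And>b. b \<in> B \<Longrightarrow> f b = g b) \<Longrightarrow> lin_comb B f = lin_comb B g"
  by (simp add: lin_comb_def)

lemma lin_comb_insert: "finite B \<Longrightarrow> w \<notin> B \<Longrightarrow> lin_comb (insert w B) f = \<kappa> (f w) * w + lin_comb B f"
  by (simp add: lin_comb_def)

lemma lin_comb_subspace:
  assumes "lin_subspace U" "B \<subseteq> U"
  shows "lin_comb B f \<in> U"
  unfolding lin_comb_def using assms(2)
  by (induction B rule: infinite_finite_induct) (use assms(1) in \<open>auto simp: lin_subspace_def\<close>)

lemma lin_subspace_diff: "lin_subspace U \<Longrightarrow> u \<in> U \<Longrightarrow> v \<in> U \<Longrightarrow> u - v \<in> U"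
  unfolding lin_subspace_def using scalar_uminus[of 1] by (metis add_uminus_conv_diff mult_minus1 scalar_one)

lemma lin_subspace_carrier: "lin_subspace R"
  by (auto simp: lin_subspace_def intro: add_mem mult_mem scalar_mem)

lemma ideal_lin_subspace: "ideal_in R I \<Longrightarrow> lin_subspace I"
  by (auto simp: lin_subspace_def intro: ideal_in.I_zero ideal_in.I_add ideal_in.I_mult scalar_mem)

lemma basis_mod_exists:
  assumes I: "lin_subspace I" and "finite W" "W \<subseteq> U" "\<forall>u\<in>U. \<exists>f. u - lin_comb W f \<in> I"
  shows "\<exists>B\<subseteq>W. basis_mod I U B"
  using assms(2-)
proof (induction W rule: finite_psubset_induct)
  case (psubset W)
  show ?case
  proof (cases "\<forall>f. lin_comb W f \<in> I \<longrightarrow> (\<forall>b\<in>W. f b = 0)")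
    case True
    then show ?thesis using psubset.hyps psubset.prems by (intro exI[of _ W]) (auto simp: basis_mod_def)
  next
    case False
    then obtain f w where f: "lin_comb W f \<in> I" "w \<in> W" "f w \<noteq> 0" by auto
    define W' where "W' = W - {w}"
    have W: "W = insert w W'" "w \<notin> W'" "finite W'" using f(2) psubset.hyps by (auto simp: W'_def)
    have w: "\<kappa> (f w) * w + lin_comb W' f \<in> I" using f(1) W by (simp add: lin_comb_insert)
    have W's: "\<exists>g. u - lin_comb W' g \<in> I" if u: "u \<in> U" for u
    proof -
      obtain h where h: "u - lin_comb W h \<in> I"
        using bspec[OF psubset.prems(2) u] by (elim exE)
      \<comment> \<open>With this factor the relation cancels the coefficient of
        \<open>w\<close>.\<close>
      let ?c = "h w / f w"
      have "\<kappa> ?c * (\<kappa> (f w) * w + lin_comb W' f) \<in> I"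
        using w I by (simp add: lin_subspace_def)
      then have 1: "\<kappa> (h w) * w + \<kappa> ?c * lin_comb W' f \<in> I"
        using f(3) by (simp add: distrib_left mult.assoc[symmetric] scalar_mult[symmetric])
      have "u - lin_comb W h + (\<kappa> (h w) * w + \<kappa> ?c * lin_comb W' f) \<in> I"
        using I h 1 by (simp add: lin_subspace_def)
      moreover have "u - lin_comb W h + (\<kappa> (h w) * w + \<kappa> ?c * lin_comb W' f)
          = u - lin_comb W' (\<lambda>b. h b - ?c * f b)"
        unfolding lin_comb_diff lin_comb_scale W(1) lin_comb_insert[OF W(3,2)]
        by (simp add: algebra_simps)
      ultimately show ?thesis by metis
    qed
    have W'W: "W' \<subset> W" using W by auto
    have "\<exists>B\<subseteq>W'. basis_mod I U B"
      by (rule psubset.IH[OF W'W]) (use psubset.prems(1) W's W'W in auto)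
    then show ?thesis using W'W by (meson psubset_imp_subset subset_trans)
  qed
qed

text \<open>Dimension count for the exact sequence given by multiplication with \<open>l\<close>
  from \<open>U'\<close> to \<open>U\<close>, both modulo \<open>I\<close>, with cokernel
  \<open>U\<close> modulo \<open>I + (l)\<close>; \<open>dec\<close> is exactness in the middle. The
  new basis is \<open>B\<close> together with the multiples of \<open>C\<close> by
  \<open>l\<close>.\<close>

lemma basis_mod_nzd:
  assumes I: "ideal_in R I" and l: "l \<in> R" and nzd: "\<And>g. g \<in> R \<Longrightarrow> l * g \<in> I \<Longrightarrow> g \<in> I"
    and U: "lin_subspace U" "U \<subseteq> R" and U': "lin_subspace U'" "U' \<subseteq> R" and lU': "\<And>u. u \<in> U' \<Longrightarrow> l * u \<in> U"
    and dec: "\<And>u. u \<in> U \<Longrightarrow> u \<in> adj I [l] \<Longrightarrow> \<exists>r\<in>U'. u - l * r \<in> I"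
    and B: "basis_mod (adj I [l]) U B" and C: "basis_mod I U' C"
  shows "\<exists>D. basis_mod I U D \<and> card D = card B + card C"
proof -
  interpret ideal_in R I by (rule I)
  interpret A: ideal_in R "adj I [l]" by (rule adj_ideal) (use I l in auto)
  have fin: "finite B" "finite C" and sub: "B \<subseteq> U" "C \<subseteq> U'"
    and Bi: "\<And>f b. lin_comb B f \<in> adj I [l] \<Longrightarrow> b \<in> B \<Longrightarrow> f b = 0"
    and Ci: "\<And>f c. lin_comb C f \<in> I \<Longrightarrow> c \<in> C \<Longrightarrow> f c = 0"
    and Bs: "\<And>u. u \<in> U \<Longrightarrow> \<exists>f. u - lin_comb B f \<in> adj I [l]"
    and Cs: "\<And>u. u \<in> U' \<Longrightarrow> \<exists>f. u - lin_comb C f \<in> I"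
    using B C by (auto simp: basis_mod_def simp del: adj.simps)
  have lC: "l * lin_comb C f = (\<Sum>c\<in>C. \<kappa> (f c) * (l * c))" for f
    by (simp add: lin_comb_def sum_distrib_left ac_simps)
  have CR: "lin_comb C f \<in> R" for f using lin_comb_subspace[OF U'(1) sub(2)] U'(2) by blast
  have inA: "l * r \<in> adj I [l]" if "r \<in> R" for r
    using adj_ConsI[of 0 I "[]" r l] that by (simp add: mult.commute)
  have IA: "x \<in> adj I [l]" if "x \<in> I" for x
    using adj_superset[OF I, of "[l]"] l that by auto
  have indep: "(\<forall>b\<in>B. f b = 0) \<and> (\<forall>c\<in>C. g c = 0)"
    if "lin_comb B f + l * lin_comb C g \<in> I" for f g
  proof -
    have "(lin_comb B f + l * lin_comb C g) - l * lin_comb C g \<in> adj I [l]"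
      by (intro A.I_diff IA that inA CR)
    then have f: "\<forall>b\<in>B. f b = 0" using Bi by (metis add_diff_cancel_right')
    then have "lin_comb B f = 0" by (simp add: lin_comb_def)
    then have "lin_comb C g \<in> I" using that nzd[OF CR] by simp
    then show ?thesis using f Ci by blast
  qed
  \<comment> \<open>Injectivity is shown for the representatives in \<open>R\<close>: if two of them
    had the same multiple, the relation with coefficients 1 and -1 would contradict
    independence.\<close>
  have inj: "inj_on ((*) l) C"
  proof (rule inj_onI, rule ccontr)
    fix c d assume cd: "c \<in> C" "d \<in> C" "l * c = l * d" "c \<noteq> d"
    define g where "g x = (if x = c then 1 else if x = d then -1 else 0 :: 'k)" for x
    have "l * lin_comb C g = (\<Sum>x\<in>C. (if x = c then l * c else 0) - (if x = d then l * d else 0))"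
      unfolding lC by (rule sum.cong) (use cd in \<open>auto simp: g_def scalar_uminus\<close>)
    also have "\<dots> = 0" using cd fin by (simp add: sum_subtractf)
    finally have "\<forall>x\<in>C. g x = 0" using indep[of "\<lambda>_. 0" g] by (simp add: lin_comb_def)
    then have "g c = 0" using cd(1) by blast
    then show False by (simp add: g_def)
  qed
  have disj: "B \<inter> (*) l ` C = {}"
  proof (rule ccontr)
    assume "B \<inter> (*) l ` C \<noteq> {}"
    then obtain c where c: "c \<in> C" "l * c \<in> B" by auto
    have "lin_comb B (\<lambda>x. if x = l * c then 1 else 0) = (\<Sum>x\<in>B. if x = l * c then l * c else 0)"
      unfolding lin_comb_def by (rule sum.cong) auto
    also have "\<dots> = l * c" using c fin by simp
    also have "\<dots> \<in> adj I [l]" by (rule inA) (use c(1) sub(2) U'(2) in blast)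
    finally have "(if l * c = l * c then 1 else 0) = (0::'k)" using c(2) by (rule Bi)
    then show False by simp
  qed
  define D where "D = B \<union> (*) l ` C"
  have Dsum: "lin_comb D f = lin_comb B f + l * lin_comb C (\<lambda>c. f (l * c))" for f
  proof -
    have "lin_comb D f = lin_comb B f + (\<Sum>x\<in>(*) l ` C. \<kappa> (f x) * x)"
      unfolding D_def lin_comb_def using fin disj by (intro sum.union_disjoint) auto
    also have "(\<Sum>x\<in>(*) l ` C. \<kappa> (f x) * x) = l * lin_comb C (\<lambda>c. f (l * c))"
      unfolding lC by (simp add: sum.reindex[OF inj])
    finally show ?thesis .
  qed
  have "basis_mod I U D"
    unfolding basis_mod_def
  proof (intro conjI allI impI ballI)
    show "finite D" "D \<subseteq> U" using fin sub lU' by (auto simp: D_def)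
  next
    fix f b assume f: "lin_comb D f \<in> I" and b: "b \<in> D"
    have fb: "\<forall>b\<in>B. f b = 0" "\<forall>c\<in>C. f (l * c) = 0"
      using indep[OF f[unfolded Dsum]] by (rule conjunct1, rule conjunct2)
    show "f b = 0" using b fb unfolding D_def by blast
  next
    fix u assume u: "u \<in> U"
    obtain f where f: "u - lin_comb B f \<in> adj I [l]" using Bs[OF u] by (elim exE)
    moreover have "u - lin_comb B f \<in> U"
      using lin_subspace_diff[OF U(1) u] lin_comb_subspace[OF U(1) sub(1)] by blast
    ultimately obtain r where r: "r \<in> U'" "u - lin_comb B f - l * r \<in> I" using dec by blast
    obtain g where g: "r - lin_comb C g \<in> I" using Cs[OF r(1)] by (elim exE)
    \<comment> \<open>The coefficient at \<open>l * c\<close> is looked up through \<open>c\<close>,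
      which \<open>inj\<close> recovers from the product.\<close>
    define h where "h x = (if x \<in> B then f x else g (inv_into C ((*) l) x))" for x
    have "lin_comb B h = lin_comb B f" by (rule lin_comb_cong) (simp add: h_def)
    moreover have "lin_comb C (\<lambda>c. h (l * c)) = lin_comb C g"
      by (rule lin_comb_cong) (use disj inj in \<open>auto simp: h_def inv_into_f_f\<close>)
    moreover have "u - lin_comb B f - l * r + l * (r - lin_comb C g) \<in> I"
      using I_add[OF r(2) I_mult[OF l g]] .
    ultimately have "u - lin_comb D h \<in> I" by (simp add: Dsum algebra_simps)
    then show "\<exists>f. u - lin_comb D f \<in> I" by blast
  qed
  moreover have "card D = card B + card C"
    unfolding D_def using fin disj inj by (simp add: card_Un_disjoint card_image)
  ultimately show ?thesis by blast
qed

section \<open>Comparison with the dimension over a subfield of the quotient ring\<close>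

lemma subfield_scalars: "subfield (range \<kappa>) (ring_on R)"
proof -
  interpret r: cring "ring_on R" by (rule cring_ring_on)
  interpret s: comm_subring "range \<kappa>"
  proof
    show "0 \<in> range \<kappa>" by (rule range_eqI[of _ _ 0]) simp
    show "1 \<in> range \<kappa>" by (rule range_eqI[of _ _ 1]) simp
  qed (auto simp: scalar_add[symmetric] scalar_mult[symmetric] scalar_uminus[symmetric])
  have inj: "\<kappa> c = 0 \<longleftrightarrow> c = 0" for c
    using scalar_mult[of c "inverse c"] by (cases "c = 0") auto
  have "field (ring_on (range \<kappa>))"
  proof (rule cring.cring_fieldI2[OF s.cring_ring_on])
    fix a assume "a \<in> carrier (ring_on (range \<kappa>))" "a \<noteq> \<zero>\<^bsub>ring_on (range \<kappa>)\<^esub>"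
    then obtain c where c: "a = \<kappa> c" "c \<noteq> 0" by (auto simp: inj)
    then show "\<exists>b\<in>carrier (ring_on (range \<kappa>)). a \<otimes>\<^bsub>ring_on (range \<kappa>)\<^esub> b = \<one>\<^bsub>ring_on (range \<kappa>)\<^esub>"
      using scalar_mult[of c "inverse c"] by (auto intro!: bexI[of _ "\<kappa> (inverse c)"])
  qed (use inj[of 1] in simp)
  then show ?thesis
    by (intro r.subfield_iff(1)) (auto simp: ring_on_def scalar_mem)
qed

text \<open>\<open>ring.dimension\<close> is built by adjoining one line at a time, so the basis is
  adjoined element by element; independence keeps each new class outside the span of the earlier
  ones.\<close>

lemma quotient_dim:
  assumes I: "ideal_in R I" "I \<noteq> R" and U: "U \<subseteq> R" "lin_subspace U" and B: "basis_mod I U B"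
  shows "ring.dim (ring_on R Quot I) ((\<lambda>f. I +>\<^bsub>ring_on R\<^esub> f) ` range \<kappa>)
    ((\<lambda>f. I +>\<^bsub>ring_on R\<^esub> f) ` U) = card B"
proof -
  interpret ideal_in R I by fact
  interpret r: cring "ring_on R" by (rule cring_ring_on)
  interpret i: ideal I "ring_on R" using I by (simp add: ideal_ring_on_iff)
  let ?Q = "ring_on R Quot I"
  let ?p = "\<lambda>f. I +>\<^bsub>ring_on R\<^esub> f"
  interpret h: ring_hom_ring "ring_on R" ?Q ?p by (rule i.rcos_ring_hom_ring)
  note Qr = i.quotient_is_ring
  have p_eq: "?p x = ?p y \<longleftrightarrow> x - y \<in> I" if "x \<in> R" "y \<in> R" for x y
    using r.quotient_eq_iff_same_a_r_cos[OF i.is_ideal, of x y] that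
    by (simp add: a_minus_def a_inv_ring_on)
  have zero: "\<zero>\<^bsub>?Q\<^esub> = ?p 0" using h.hom_zero by simp
  have one: "\<one>\<^bsub>?Q\<^esub> = ?p 1" using h.hom_one by simp
  have hom_simps: "?p (x * y) = ?p x \<otimes>\<^bsub>?Q\<^esub> ?p y" "?p (x + y) = ?p x \<oplus>\<^bsub>?Q\<^esub> ?p y"
    if "x \<in> R" "y \<in> R" for x y
    using h.hom_mult[of x y] h.hom_add[of x y] that by simp_all
  have K: "subfield (?p ` range \<kappa>) ?Q"
    by (rule h.img_is_subfield(2)[OF subfield_scalars]) (use I eq_carrier_iff in \<open>simp add: zero one p_eq\<close>)
  have BR: "B \<subseteq> R" and fB: "finite B" using B U by (auto simp: basis_mod_def)
  have lcR: "lin_comb B' f \<in> R" if "B' \<subseteq> R" for B' f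
    by (rule lin_comb_subspace[OF lin_subspace_carrier that])
  have "ring.dimension ?Q (card B') (?p ` range \<kappa>) {?p (lin_comb B' f) | f. True}"
    if "finite B'" "B' \<subseteq> B" for B' using that
  proof (induction B')
    case empty
    then show ?case using ring.dimension.zero_dim[OF Qr, of "?p ` range \<kappa>"] by (simp add: lin_comb_def zero)
  next
    case (insert b B')
    have bR: "b \<in> R" and B'R: "B' \<subseteq> R" using insert BR by auto
    let ?E = "{?p (lin_comb B' f) | f. True}"
    have "?p b \<notin> ?E"
    proof
      assume "?p b \<in> ?E"
      then obtain f where "?p b = ?p (lin_comb B' f)" by auto
      then have *: "b - lin_comb B' f \<in> I" using p_eq bR lcR[OF B'R] by simp
      define g where "g x = (if x = b then 1 else if x \<in> B' then - f x else 0)" for x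
      have "lin_comb B g = lin_comb (insert b B') g"
        unfolding lin_comb_def
        by (rule sum.mono_neutral_right) (use insert fB in \<open>auto simp: g_def\<close>)
      also have "\<dots> = b + lin_comb B' g" using insert by (simp add: lin_comb_insert g_def)
      also have "lin_comb B' g = - lin_comb B' f"
        unfolding lin_comb_def sum_negf[symmetric]
        by (rule sum.cong) (use insert in \<open>auto simp: g_def scalar_uminus\<close>)
      finally have "\<forall>x\<in>B. g x = 0" using * B by (simp add: basis_mod_def)
      then show False using insert by (auto simp: g_def)
    qed
    moreover have "ring.line_extension ?Q (?p ` range \<kappa>) (?p b) ?E = {?p (lin_comb (insert b B') f) | f. True}"
    proof (intro equalityI subsetI)
      fix x assume "x \<in> ring.line_extension ?Q (?p ` range \<kappa>) (?p b) ?E"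
      then obtain c f where "x = ?p (\<kappa> c) \<otimes>\<^bsub>?Q\<^esub> ?p b \<oplus>\<^bsub>?Q\<^esub> ?p (lin_comb B' f)"
        unfolding ring.line_extension_mem_iff[OF Qr] by auto
      also have "\<dots> = ?p (\<kappa> c * b + lin_comb B' f)"
        using bR lcR[OF B'R, of f] scalar_mem[of c]
        by (simp add: hom_simps mult_mem)
      also have "\<kappa> c * b + lin_comb B' f = lin_comb (insert b B') (f(b := c))"
        using insert lin_comb_cong[of B' f "f(b := c)"] by (fastforce simp: lin_comb_insert)
      finally show "x \<in> {?p (lin_comb (insert b B') f) | f. True}" by blast
    next
      fix x assume "x \<in> {?p (lin_comb (insert b B') f) | f. True}"
      then obtain f where "x = ?p (\<kappa> (f b) * b + lin_comb B' f)"
        using insert by (auto simp: lin_comb_insert)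
      also have "\<dots> = ?p (\<kappa> (f b)) \<otimes>\<^bsub>?Q\<^esub> ?p b \<oplus>\<^bsub>?Q\<^esub> ?p (lin_comb B' f)"
        using bR lcR[OF B'R, of f] scalar_mem[of "f b"]
        by (simp add: hom_simps mult_mem)
      finally show "x \<in> ring.line_extension ?Q (?p ` range \<kappa>) (?p b) ?E"
        unfolding ring.line_extension_mem_iff[OF Qr] by blast
    qed
    moreover have "?p b \<in> carrier ?Q" using h.hom_closed bR by simp
    ultimately show ?case using ring.dimension.Suc_dim[OF Qr, of "?p b" ?E "card B'" "?p ` range \<kappa>"] insert by simp
  qed
  from this[OF fB order.refl]
  have "ring.dimension ?Q (card B) (?p ` range \<kappa>) {?p (lin_comb B f) | f. True}" .
  also have "{?p (lin_comb B f) | f. True} = ?p ` U"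
  proof (intro equalityI subsetI)
    fix x assume "x \<in> {?p (lin_comb B f) | f. True}"
    then obtain f where "x = ?p (lin_comb B f)" by blast
    moreover have "lin_comb B f \<in> U" using lin_comb_subspace[OF U(2), of B] B by (simp add: basis_mod_def)
    ultimately show "x \<in> ?p ` U" by blast
  next
    fix x assume "x \<in> ?p ` U"
    then obtain u where u: "u \<in> U" "x = ?p u" by auto
    then obtain f where "u - lin_comb B f \<in> I" using B by (auto simp: basis_mod_def)
    then have "?p u = ?p (lin_comb B f)" using p_eq u U lcR[OF BR] by blast
    then show "x \<in> {?p (lin_comb B f) | f. True}" using u(2) by blast
  qed
  finally show ?thesis using ring.dimI[OF Qr K] by (simp add: over_def)
qed

end

section \<open>Rings of Krull dimension zero\<close>

context comm_subring
begin

definition prime_in :: "'a set \<Rightarrow> bool" where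
  "prime_in P \<longleftrightarrow> ideal_in R P \<and> 1 \<notin> P \<and> (\<forall>x\<in>R. \<forall>y\<in>R. x * y \<in> P \<longrightarrow> x \<in> P \<or> y \<in> P)"

lemma adj_single: "adj I [x] = {i + r * x | i r. i \<in> I \<and> r \<in> R}"
  by simp

text \<open>An ideal maximal among those that contain \<open>I\<close> and miss the multiplicative
  set \<open>S\<close> is prime; Zorn's lemma provides one.\<close>

lemma exists_prime_avoiding:
  assumes I: "ideal_in R I" and S: "S \<subseteq> R" "1 \<in> S" "S \<inter> I = {}"
    and S_mult: "\<And>s t. s \<in> S \<Longrightarrow> t \<in> S \<Longrightarrow> s * t \<in> S"
  shows "\<exists>P. prime_in P \<and> I \<subseteq> P \<and> S \<inter> P = {}"
proof -
  define A where "A = {J. ideal_in R J \<and> I \<subseteq> J \<and> S \<inter> J = {}}"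
  have "\<exists>M\<in>A. \<forall>X\<in>A. M \<subseteq> X \<longrightarrow> X = M"
  proof (rule subset_Zorn_nonempty)
    show "A \<noteq> {}" using I S by (auto simp: A_def)
  next
    fix C assume C: "C \<noteq> {}" "subset.chain A C"
    have CA: "ideal_in R J \<and> I \<subseteq> J \<and> S \<inter> J = {}" if "J \<in> C" for J
      using C(2) that by (auto simp: A_def subset.chain_def)
    have ch: "J \<subseteq> J' \<or> J' \<subseteq> J" if "J \<in> C" "J' \<in> C" for J J'
      using C(2) that unfolding subset.chain_def by blast
    have "ideal_in R (\<Union>C)"
    proof
      show "\<Union>C \<subseteq> R" using CA ideal_in.I_sub by blast
      show "0 \<in> \<Union>C" using C CA ideal_in.I_zero by blast
    next
      fix x y assume "x \<in> \<Union>C" "y \<in> \<Union>C"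
      then obtain J J' where J: "J \<in> C" "x \<in> J" "J' \<in> C" "y \<in> J'" by blast
      then consider "x \<in> J'" | "y \<in> J" using ch by blast
      then show "x + y \<in> \<Union>C" using J CA ideal_in.I_add[of R] by cases blast+
    next
      fix r x assume "r \<in> R" "x \<in> \<Union>C"
      then show "r * x \<in> \<Union>C" using CA ideal_in.I_mult[of R] by blast
    qed
    then show "\<Union>C \<in> A" using C CA by (auto simp: A_def)
  qed
  then obtain M where M: "ideal_in R M" "I \<subseteq> M" "S \<inter> M = {}"
    and max: "\<And>X. ideal_in R X \<Longrightarrow> S \<inter> X = {} \<Longrightarrow> M \<subseteq> X \<Longrightarrow> X = M"
    by (auto simp: A_def)
  interpret M: ideal_in R M by (rule M)
  have meets: "\<exists>s m r. s \<in> S \<and> m \<in> M \<and> r \<in> R \<and> s = m + r * x" if x: "x \<in> R" "x \<notin> M" for x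
  proof (rule ccontr)
    assume "\<not> ?thesis"
    then have "S \<inter> adj M [x] = {}" by (auto simp: adj_single)
    moreover have "ideal_in R (adj M [x])" by (rule adj_ideal) (use M x in auto)
    moreover have "M \<union> {x} \<subseteq> adj M [x]" using adj_superset[OF M(1), of "[x]"] x by simp
    ultimately show False using max[of "adj M [x]"] x by blast
  qed
  have "x \<in> M \<or> y \<in> M" if xy: "x \<in> R" "y \<in> R" "x * y \<in> M" for x y
  proof (rule ccontr)
    assume "\<not> (x \<in> M \<or> y \<in> M)"
    then obtain s m r t m' r' where
      s: "s \<in> S" "m \<in> M" "r \<in> R" "s = m + r * x" and t: "t \<in> S" "m' \<in> M" "r' \<in> R" "t = m' + r' * y"
      using meets xy by meson
    have "s * t = m * t + m' * (r * x) + (r * r') * (x * y)" unfolding s t by (simp add: algebra_simps)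
    also have "\<dots> \<in> M"
      by (rule M.I_add[OF M.I_add[OF M.I_mult2[OF _ s(2)] M.I_mult2[OF _ t(2)]] M.I_mult[OF _ xy(3)]])
        (use s(3) t(1,3) xy S(1) in \<open>auto intro: mult_mem\<close>)
    finally show False using S_mult[OF s(1) t(1)] M(3) by auto
  qed
  then have "prime_in M" using M S by (auto simp: prime_in_def)
  then show ?thesis using M by auto
qed

lemma primeideal_quotient:
  assumes I: "ideal_in R I" and P: "prime_in P" "I \<subseteq> P"
  shows "primeideal ((\<lambda>f. I +>\<^bsub>ring_on R\<^esub> f) ` P) (ring_on R Quot I)"
    and "\<And>x. x \<in> R \<Longrightarrow> I +>\<^bsub>ring_on R\<^esub> x \<in> (\<lambda>f. I +>\<^bsub>ring_on R\<^esub> f) ` P \<longleftrightarrow> x \<in> P"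
proof -
  interpret P: ideal_in R P using P by (simp add: prime_in_def)
  interpret r: cring "ring_on R" by (rule cring_ring_on)
  interpret i: ideal I "ring_on R" using I by (simp add: ideal_ring_on_iff)
  let ?p = "\<lambda>f. I +>\<^bsub>ring_on R\<^esub> f"
  have p_eq: "?p x = ?p y \<longleftrightarrow> x - y \<in> I" if "x \<in> R" "y \<in> R" for x y
    using r.quotient_eq_iff_same_a_r_cos[OF i.is_ideal, of x y] that
    by (simp add: a_minus_def a_inv_ring_on)
  show mem: "?p x \<in> ?p ` P \<longleftrightarrow> x \<in> P" if "x \<in> R" for x
  proof
    assume "?p x \<in> ?p ` P"
    then obtain y where y: "y \<in> P" "?p x = ?p y" by auto
    then have "x - y \<in> P" using p_eq[of x y] that P(2) P.I_memR by auto
    then show "x \<in> P" using P.cong_mem y by blast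
  qed auto
  have car: "carrier (ring_on R Quot I) = ?p ` R"
    by (auto simp: FactRing_def A_RCOSETS_def')
  show "primeideal (?p ` P) (ring_on R Quot I)"
  proof (rule primeidealI)
    show "ideal (?p ` P) (ring_on R Quot I)"
      using r.ring_ideal_imp_quot_ideal[OF i.is_ideal, of P] P by (simp add: ideal_ring_on_iff prime_in_def)
    show "cring (ring_on R Quot I)" by (rule i.quotient_is_cring) (rule r.is_cring)
    have "?p 1 \<notin> ?p ` P" using mem[of 1] P by (simp add: prime_in_def)
    then show "carrier (ring_on R Quot I) \<noteq> ?p ` P" unfolding car using one_mem by blast
  next
    fix a b assume "a \<in> carrier (ring_on R Quot I)" "b \<in> carrier (ring_on R Quot I)"
      and ab: "a \<otimes>\<^bsub>ring_on R Quot I\<^esub> b \<in> ?p ` P"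
    then obtain x y where x: "x \<in> R" "a = ?p x" "y \<in> R" "b = ?p y" unfolding car by auto
    then have "?p (x * y) \<in> ?p ` P" using ab i.rcoset_mult_add[of x y] by (simp add: FactRing_def)
    then have "x \<in> P \<or> y \<in> P" using mem x P mult_mem by (simp add: prime_in_def)
    then show "a \<in> ?p ` P \<or> b \<in> ?p ` P" using x by auto
  qed
qed

text \<open>A strict inclusion would survive in the quotient and give a chain of two primes
  there.\<close>

lemma krull_dim_0_maximal:
  assumes I: "ideal_in R I" and dim: "krull_dim (ring_on R Quot I) = 0"
    and P: "prime_in P" "I \<subseteq> P" and Q: "prime_in Q" "P \<subseteq> Q"
  shows "P = Q"
proof (rule ccontr)
  assume "P \<noteq> Q"
  let ?p = "\<lambda>f. I +>\<^bsub>ring_on R\<^esub> f"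
  have PR: "P \<subseteq> R" "Q \<subseteq> R" using P Q by (auto simp: prime_in_def ideal_in.I_sub)
  obtain x where x: "x \<in> Q" "x \<notin> P" using \<open>P \<noteq> Q\<close> Q by auto
  then have "?p x \<in> ?p ` Q" "?p x \<notin> ?p ` P"
    using primeideal_quotient(2)[OF I P, of x] PR by auto
  then have sub: "?p ` P \<subset> ?p ` Q" using Q(2) by blast
  have "I \<subseteq> Q" using P Q by auto
  then have "enat 1 \<in> {enat (length Ps - 1) | Ps. Ps \<noteq> [] \<and>
      (\<forall>P\<in>set Ps. primeideal P (ring_on R Quot I)) \<and> sorted_wrt (\<subset>) Ps}"
    using primeideal_quotient(1)[OF I P] primeideal_quotient(1)[OF I Q(1)] sub
    by (intro CollectI exI[of _ "[?p ` P, ?p ` Q]"]) simp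
  then have "enat 1 \<le> krull_dim (ring_on R Quot I)" unfolding krull_dim_def by (rule Sup_upper)
  then show False using dim by (simp add: zero_enat_def)
qed

text \<open>The elements \<open>b ^ k * (1 - b * c)\<close> form a multiplicative set. If it missed
  \<open>I\<close>, a prime \<open>P\<close> over \<open>I\<close> would miss it too; then
  \<open>b\<close> is neither in \<open>P\<close> nor a unit modulo \<open>P\<close>, and a prime
  over \<open>P + (b)\<close> is strictly larger, against dimension zero.\<close>

lemma krull_dim_0_pi_regular:
  assumes I: "ideal_in R I" and dim: "krull_dim (ring_on R Quot I) = 0" and b: "b \<in> R"
  obtains k c where "c \<in> R" "b ^ k * (1 - b * c) \<in> I"
proof -
  have "\<exists>k. \<exists>c\<in>R. b ^ k * (1 - b * c) \<in> I"
  proof (rule ccontr)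
    assume no: "\<not> ?thesis"
    define S where "S = {b ^ k * (1 - b * c) | k c. c \<in> R}"
    have "1 \<in> S" unfolding S_def by (intro CollectI exI[of _ 0]) simp
    have bS: "b \<in> S" unfolding S_def by (intro CollectI exI[of _ 1] exI[of _ 0]) simp
    have bcS: "1 - b * c \<in> S" if "c \<in> R" for c
      unfolding S_def by (intro CollectI exI[of _ 0] exI[of _ c]) (simp add: that)
    have SR: "S \<subseteq> R" using b by (auto simp: S_def intro!: mult_mem power_mem diff_mem)
    have SI: "S \<inter> I = {}" using no by (auto simp: S_def)
    have "s * t \<in> S" if "s \<in> S" "t \<in> S" for s t
    proof -
      from that obtain k c l d where s: "s = b ^ k * (1 - b * c)" "c \<in> R" "t = b ^ l * (1 - b * d)" "d \<in> R"
        by (auto simp: S_def)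
      have "s * t = b ^ (k + l) * (1 - b * (c + d - b * c * d))"
        unfolding s by (simp add: power_add algebra_simps)
      moreover have "c + d - b * c * d \<in> R" using s b by (intro diff_mem add_mem mult_mem)
      ultimately show ?thesis by (auto simp: S_def)
    qed
    from exists_prime_avoiding[OF I SR \<open>1 \<in> S\<close> SI this]
    obtain P where P: "prime_in P" "I \<subseteq> P" "S \<inter> P = {}" by auto
    interpret P: ideal_in R P using P by (simp add: prime_in_def)
    have PI: "ideal_in R P" by (rule P.ideal_in_axioms)
    have A: "ideal_in R (adj P [b])" by (rule adj_ideal) (use PI b in auto)
    have "{1} \<inter> adj P [b] = {}"
    proof (rule ccontr)
      assume "{1} \<inter> adj P [b] \<noteq> {}"
      then obtain i r where i: "i \<in> P" "r \<in> R" "1 = i + r * b" by (auto simp: adj_single)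
      then have "1 - b * r = i" by (simp add: algebra_simps)
      then show False using bcS[OF i(2)] i(1) P(3) by auto
    qed
    from exists_prime_avoiding[OF A _ _ this]
    obtain Q where Q: "prime_in Q" "adj P [b] \<subseteq> Q" by auto
    have "P \<union> {b} \<subseteq> Q" using adj_superset[OF PI, of "[b]"] b Q by auto
    then show False using krull_dim_0_maximal[OF I dim P(1,2) Q(1)] bS P(3) by blast
  qed
  then show thesis using that by blast
qed

end

subsection \<open>Finite generation of modules over subrings\<close>

inductive_set module_span :: "'a::comm_ring_1 set \<Rightarrow> 'a set \<Rightarrow> 'a set" for B W where
  zero: "0 \<in> module_span B W"
| add: "x \<in> module_span B W \<Longrightarrow> b \<in> B \<Longrightarrow> w \<in> W \<Longrightarrow> x + b * w \<in> module_span B W"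

lemma (in comm_subring) module_span_add:
  "y \<in> module_span R W \<Longrightarrow> x \<in> module_span R W \<Longrightarrow> x + y \<in> module_span R W"
  by (induction y rule: module_span.induct) (auto simp: add.assoc[symmetric] intro: module_span.add)

lemma (in comm_subring) module_span_mult:
  "x \<in> module_span R W \<Longrightarrow> r \<in> R \<Longrightarrow> r * x \<in> module_span R W"
proof (induction x rule: module_span.induct)
  case (add x b w)
  then have "r * x + (r * b) * w \<in> module_span R W" by (intro module_span.add mult_mem)
  then show ?case by (simp add: algebra_simps)
qed (simp add: module_span.zero)

lemma (in comm_subring) module_span_base:
  "r \<in> R \<Longrightarrow> w \<in> W \<Longrightarrow> r * w \<in> module_span R W"
  using module_span.add[OF module_span.zero, of r R w W] by simp

lemma module_span_mono:
  assumes "x \<in> module_span B W" "B \<subseteq> B'" "W \<subseteq> W'"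
  shows "x \<in> module_span B' W'"
  using assms(1) by induction (use assms(2,3) in \<open>auto intro: module_span.zero module_span.add\<close>)

lemma (in comm_subring) module_span_subset:
  "B \<subseteq> R \<Longrightarrow> W \<subseteq> R \<Longrightarrow> module_span B W \<subseteq> R"
proof
  fix x assume "B \<subseteq> R" "W \<subseteq> R" "x \<in> module_span B W"
  from this(3,1,2) show "x \<in> R" by induction (auto intro: add_mem mult_mem)
qed

lemma (in comm_subring) module_span_finite:
  assumes "finite W" "x \<in> module_span R W"
  shows "\<exists>b. (\<forall>w. b w \<in> R) \<and> x = (\<Sum>w\<in>W. b w * w)"
  using assms(2)
proof induction
  case zero
  show ?case by (intro exI[of _ "\<lambda>_. 0"]) simp
next
  case (add x c v)
  then obtain b where b: "\<forall>w. b w \<in> R" "x = (\<Sum>w\<in>W. b w * w)" by auto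
  have "(\<Sum>w\<in>W. (b w + (if w = v then c else 0)) * w)
      = (\<Sum>w\<in>W. b w * w) + (\<Sum>w\<in>W. if w = v then c * v else 0)"
    unfolding sum.distrib[symmetric] by (rule sum.cong) (auto simp: algebra_simps)
  also have "\<dots> = x + c * v" using b(2) add assms(1) by simp
  finally have "x + c * v = (\<Sum>w\<in>W. (b w + (if w = v then c else 0)) * w)" ..
  moreover have "\<forall>w. b w + (if w = v then c else 0) \<in> R" using b(1) add by (auto intro: add_mem)
  ultimately show ?case by (intro exI[of _ "\<lambda>w. b w + (if w = v then c else 0)"]) simp
qed

text \<open>
  Gaussian elimination for a homogeneous system whose matrix is congruent to the identity modulo
  \<open>z\<close>; it replaces the determinant in Nakayama's lemma.
\<close>

lemma (in comm_subring) eliminate: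
  assumes I: "ideal_in R I" and B: "comm_subring B" "B \<subseteq> R" and z: "z \<in> B"
    and "finite J" "\<And>j. j \<in> J \<Longrightarrow> v j \<in> R"
    and "\<And>j i. j \<in> J \<Longrightarrow> i \<in> J \<Longrightarrow> \<exists>b\<in>B. T j i = (if i = j then 1 else 0) + z * b"
    and "\<And>j. j \<in> J \<Longrightarrow> (\<Sum>i\<in>J. T j i * v i) \<in> I"
  shows "\<exists>b\<in>B. \<forall>j\<in>J. (1 + z * b) * v j \<in> I"
  using assms(5-)
proof (induction J arbitrary: T rule: finite_induct)
  case empty
  then show ?case using comm_subring.zero_mem[OF B(1)] by auto
next
  case (insert N J)
  interpret ideal_in R I by (rule I)
  interpret B: comm_subring B by (rule B)
  have T: "\<exists>b\<in>B. T j i = (if i = j then 1 else 0) + z * b" if "j \<in> insert N J" "i \<in> insert N J" for j i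
    using insert.prems(2) that by blast
  have TB: "T j i \<in> B" if "j \<in> insert N J" "i \<in> insert N J" for j i
    using T[OF that] z by (auto intro!: B.add_mem B.mult_mem)
  have TR: "T j i \<in> R" if "j \<in> insert N J" "i \<in> insert N J" for j i
    using TB[OF that] B by auto
  obtain a where a: "a \<in> B" "T N N = 1 + z * a" using T[of N N] by auto
  \<comment> \<open>One elimination step with the pivot \<open>T N N\<close>, which is 1 modulo
    \<open>z\<close>. Cross-multiplication avoids dividing by it, and the smaller matrix is
    congruent to the identity again.\<close>
  define T' where "T' j i = T N N * T j i - T j N * T N i" for j i
  have "\<exists>b\<in>B. \<forall>j\<in>J. (1 + z * b) * v j \<in> I"
  proof (rule insert.IH)
    fix j i assume ji: "j \<in> J" "i \<in> J"
    obtain b where b: "b \<in> B" "T j i = (if i = j then 1 else 0) + z * b" using T[of j i] ji by auto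
    have "N \<noteq> j" using ji insert.hyps by auto
    then obtain c where c: "c \<in> B" "T j N = z * c" using T[of j N] ji by auto
    have "T' j i = (if i = j then 1 else 0) + z * (b + a * T j i - c * T N i)"
      unfolding T'_def a(2) c(2) by (simp add: algebra_simps b(2))
    moreover have "b + a * T j i - c * T N i \<in> B"
    proof -
      have "T j i \<in> B" "T N i \<in> B" using TB ji by blast+
      then show ?thesis by (intro B.diff_mem B.add_mem B.mult_mem a(1) b(1) c(1))
    qed
    ultimately show "\<exists>b\<in>B. T' j i = (if i = j then 1 else 0) + z * b" by blast
  next
    fix j assume j: "j \<in> J"
    have "(\<Sum>i\<in>J. T' j i * v i) =
        T N N * (\<Sum>i\<in>insert N J. T j i * v i) - T j N * (\<Sum>i\<in>insert N J. T N i * v i)"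
      using insert.hyps
      by (simp add: T'_def sum_distrib_left sum_subtractf algebra_simps)
    also have "\<dots> \<in> I"
      by (intro I_diff I_mult TR insert.prems(3)) (use j in auto)
    finally show "(\<Sum>i\<in>J. T' j i * v i) \<in> I" .
  qed (use insert.prems in auto)
  then obtain b where b: "b \<in> B" "\<And>j. j \<in> J \<Longrightarrow> (1 + z * b) * v j \<in> I" by auto
  \<comment> \<open>The product of the pivot and the multiplier found for \<open>J\<close>, expanded
    into the shape that the claim asks for.\<close>
  let ?u = "1 + z * (a + b + z * a * b)"
  have u: "?u = (1 + z * a) * (1 + z * b)" by (simp add: algebra_simps)
  have R: "z \<in> R" "a \<in> R" "b \<in> R" using a b z B by auto
  have "?u * v j \<in> I" if "j \<in> J" for j
    unfolding u by (subst mult.assoc, rule I_mult[OF _ b(2)[OF that]]) (use R in \<open>auto intro: add_mem mult_mem\<close>)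
  moreover have "?u * v N \<in> I"
  proof -
    have "(\<Sum>i\<in>J. T N i * ((1 + z * b) * v i)) \<in> I"
      by (rule I_sum, rule I_mult[OF _ b(2)]) (use TR in auto)
    moreover have "(1 + z * b) * (\<Sum>i\<in>insert N J. T N i * v i) \<in> I"
      by (rule I_mult[OF _ insert.prems(3)]) (use R in \<open>auto intro: add_mem mult_mem\<close>)
    ultimately have "(1 + z * b) * (\<Sum>i\<in>insert N J. T N i * v i) - (\<Sum>i\<in>J. T N i * ((1 + z * b) * v i)) \<in> I"
      by (rule I_diff[rotated])
    also have "(1 + z * b) * (\<Sum>i\<in>insert N J. T N i * v i) - (\<Sum>i\<in>J. T N i * ((1 + z * b) * v i))
        = ?u * v N"
      using insert.hyps by (simp add: a(2) u sum_distrib_left ring_distribs mult.left_commute mult.assoc)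
    finally show ?thesis .
  qed
  moreover have "a + b + z * a * b \<in> B" using a b z by (intro B.add_mem B.mult_mem)
  ultimately show ?case by blast
qed

subsection \<open>Noether normalization\<close>

context scalars
begin

inductive_set alg_span :: "'a set \<Rightarrow> 'a set" for Y where
  scalar: "\<kappa> c \<in> alg_span Y"
| gen: "y \<in> Y \<Longrightarrow> y \<in> alg_span Y"
| add: "x \<in> alg_span Y \<Longrightarrow> y \<in> alg_span Y \<Longrightarrow> x + y \<in> alg_span Y"
| mult: "x \<in> alg_span Y \<Longrightarrow> y \<in> alg_span Y \<Longrightarrow> x * y \<in> alg_span Y"

lemma comm_subring_alg_span: "comm_subring (alg_span Y)"
proof
  show "0 \<in> alg_span Y" "1 \<in> alg_span Y"
    using alg_span.scalar[of 0 Y] alg_span.scalar[of 1 Y] by simp_all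
  show "- x \<in> alg_span Y" if "x \<in> alg_span Y" for x
    using alg_span.mult[OF alg_span.scalar[of "-1"] that] by (simp add: scalar_uminus)
qed (auto intro: alg_span.add alg_span.mult)

lemma alg_span_subset:
  assumes "comm_subring B" "\<And>c. \<kappa> c \<in> B" "Y \<subseteq> B"
  shows "alg_span Y \<subseteq> B"
proof
  interpret B: comm_subring B by fact
  fix x assume "x \<in> alg_span Y"
  then show "x \<in> B" by induction (use assms in \<open>auto intro: B.add_mem B.mult_mem\<close>)
qed

primrec monom_list :: "'a list \<Rightarrow> nat list \<Rightarrow> 'a" where
  "monom_list [] \<alpha> = 1"
| "monom_list (z # zs) \<alpha> = z ^ hd \<alpha> * monom_list zs (tl \<alpha>)"

lemma monom_list_mult:
  "length \<alpha> = length zs \<Longrightarrow> length \<beta> = length zs \<Longrightarrow>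
    monom_list zs \<alpha> * monom_list zs \<beta> = monom_list zs (map2 (+) \<alpha> \<beta>)"
proof (induction zs arbitrary: \<alpha> \<beta>)
  case (Cons z zs)
  then obtain a \<alpha>' b \<beta>' where "\<alpha> = a # \<alpha>'" "\<beta> = b # \<beta>'" by (cases \<alpha>; cases \<beta>) auto
  moreover have "z ^ a * monom_list zs \<alpha>' * (z ^ b * monom_list zs \<beta>')
      = z ^ (a + b) * (monom_list zs \<alpha>' * monom_list zs \<beta>')"
    by (simp add: power_add ac_simps)
  ultimately show ?case using Cons.IH[of \<alpha>' \<beta>'] Cons.prems by simp
qed simp

lemma monom_list_zero: "monom_list zs (replicate (length zs) 0) = 1"
  by (induction zs) auto

definition lin_span :: "'a set \<Rightarrow> 'a set" where
  "lin_span M = module_span (range \<kappa>) M"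

lemma comm_subring_range: "comm_subring (range \<kappa>)"
proof
  show "0 \<in> range \<kappa>" by (rule range_eqI[of _ _ 0]) simp
  show "1 \<in> range \<kappa>" by (rule range_eqI[of _ _ 1]) simp
qed (auto simp: scalar_add[symmetric] scalar_mult[symmetric] scalar_uminus[symmetric])

definition monoms :: "'a list \<Rightarrow> 'a set" where
  "monoms zs = monom_list zs ` {\<alpha>. length \<alpha> = length zs}"

lemma lin_span_add: "x \<in> lin_span M \<Longrightarrow> y \<in> lin_span M \<Longrightarrow> x + y \<in> lin_span M"
  unfolding lin_span_def by (rule comm_subring.module_span_add[OF comm_subring_range])

lemma lin_span_scale: "x \<in> lin_span M \<Longrightarrow> \<kappa> c * x \<in> lin_span M"
  unfolding lin_span_def by (rule comm_subring.module_span_mult[OF comm_subring_range]) auto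

lemma lin_span_base: "w \<in> M \<Longrightarrow> w \<in> lin_span M"
  unfolding lin_span_def using comm_subring.module_span_base[OF comm_subring_range, of 1 w M] range_eqI[of 1 \<kappa> 1] by simp

lemma lin_span_induct [consumes 1, case_names zero add]:
  assumes "x \<in> lin_span M" "P 0" "\<And>x c w. x \<in> lin_span M \<Longrightarrow> P x \<Longrightarrow> w \<in> M \<Longrightarrow> P (x + \<kappa> c * w)"
  shows "P x"
  using assms(1) unfolding lin_span_def
  by (induction rule: module_span.induct) (use assms(2,3) in \<open>auto simp: lin_span_def\<close>)

lemma lin_span_mult_closed:
  assumes M: "\<And>v w. v \<in> M \<Longrightarrow> w \<in> M \<Longrightarrow> v * w \<in> M" and x: "x \<in> lin_span M" and y: "y \<in> lin_span M"
  shows "x * y \<in> lin_span M"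
proof -
  have z: "0 \<in> lin_span M" by (simp add: lin_span_def module_span.zero)
  have 1: "x * w \<in> lin_span M" if w: "w \<in> M" for w
    using x
  proof (induction rule: lin_span_induct)
    case (add x c v)
    have "x * w + \<kappa> c * (v * w) \<in> lin_span M"
      by (rule lin_span_add, rule add, rule lin_span_scale, rule lin_span_base, rule M, rule add, rule w)
    then show ?case by (simp add: algebra_simps)
  qed (simp add: z)
  from y show ?thesis
  proof (induction rule: lin_span_induct)
    case (add y c w)
    have "x * y + \<kappa> c * (x * w) \<in> lin_span M"
      by (rule lin_span_add, rule add, rule lin_span_scale, rule 1, rule add)
    then show ?case by (simp add: algebra_simps)
  qed (simp add: z)
qed

lemma monoms_mult: "v \<in> monoms zs \<Longrightarrow> w \<in> monoms zs \<Longrightarrow> v * w \<in> monoms zs"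
  unfolding monoms_def by (auto simp: monom_list_mult)

lemma gen_in_monoms: "z \<in> set zs \<Longrightarrow> z \<in> monoms zs"
proof (induction zs)
  case (Cons y zs)
  show ?case
  proof (cases "z = y")
    case True
    then show ?thesis unfolding monoms_def
      by (intro image_eqI[of _ _ "1 # replicate (length zs) 0"]) (auto simp: monom_list_zero)
  next
    case False
    then obtain \<alpha> where "length \<alpha> = length zs" "z = monom_list zs \<alpha>"
      using Cons by (auto simp: monoms_def)
    then show ?thesis unfolding monoms_def by (intro image_eqI[of _ _ "0 # \<alpha>"]) auto
  qed
qed simp

lemma alg_span_monoms: "alg_span (set zs) \<subseteq> lin_span (monoms zs)"
proof
  have one: "1 \<in> monoms zs" unfolding monoms_def
    by (intro image_eqI[of _ _ "replicate (length zs) 0"]) (auto simp: monom_list_zero)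
  fix x assume "x \<in> alg_span (set zs)"
  then show "x \<in> lin_span (monoms zs)"
  proof induction
    case (scalar c)
    then show ?case using lin_span_scale[OF lin_span_base[OF one], of c] by simp
  qed (auto intro: lin_span_add lin_span_mult_closed monoms_mult lin_span_base gen_in_monoms)
qed

lemma alg_span_expand:
  assumes "x \<in> alg_span (set zs)"
  obtains F :: "nat list set" and f :: "nat list \<Rightarrow> 'k" where
    "finite F" "\<And>\<alpha>. \<alpha> \<in> F \<Longrightarrow> length \<alpha> = length zs" "x = (\<Sum>\<alpha>\<in>F. \<kappa> (f \<alpha>) * monom_list zs \<alpha>)"
proof -
  have "x \<in> lin_span (monoms zs)" using assms alg_span_monoms by blast
  then have "\<exists>F f. finite F \<and> (\<forall>\<alpha>\<in>F. length \<alpha> = length zs) \<and> x = (\<Sum>\<alpha>\<in>F. \<kappa> (f \<alpha>) * monom_list zs \<alpha>)"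
  proof (induction rule: lin_span_induct)
    case zero
    show ?case by (intro exI[of _ "{}"]) simp
  next
    case (add x c w)
    then obtain F f where F: "finite F" "\<forall>\<alpha>\<in>F. length \<alpha> = length zs"
      "x = (\<Sum>\<alpha>\<in>F. \<kappa> (f \<alpha>) * monom_list zs \<alpha>)" by (elim exE conjE)
    obtain \<beta> where \<beta>: "length \<beta> = length zs" "w = monom_list zs \<beta>" using add by (auto simp: monoms_def)
    define g where "g \<alpha> = (if \<alpha> \<in> F then f \<alpha> else 0) + (if \<alpha> = \<beta> then c else 0)" for \<alpha>
    have "(\<Sum>\<alpha>\<in>insert \<beta> F. \<kappa> (g \<alpha>) * monom_list zs \<alpha>)
        = (\<Sum>\<alpha>\<in>insert \<beta> F. if \<alpha> \<in> F then \<kappa> (f \<alpha>) * monom_list zs \<alpha> else 0)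
          + (\<Sum>\<alpha>\<in>insert \<beta> F. if \<alpha> = \<beta> then \<kappa> c * monom_list zs \<beta> else 0)"
      unfolding sum.distrib[symmetric] g_def by (rule sum.cong) (auto simp: scalar_add algebra_simps)
    also have "(\<Sum>\<alpha>\<in>insert \<beta> F. if \<alpha> \<in> F then \<kappa> (f \<alpha>) * monom_list zs \<alpha> else 0) = x"
      unfolding F(3) by (rule sum.mono_neutral_cong_right) (use F(1) in auto)
    also have "(\<Sum>\<alpha>\<in>insert \<beta> F. if \<alpha> = \<beta> then \<kappa> c * monom_list zs \<beta> else 0) = \<kappa> c * w"
      using F(1) \<beta> by simp
    finally show ?case using F \<beta> by (intro exI[of _ "insert \<beta> F"] exI[of _ g]) auto
  qed
  then show thesis by (elim exE conjE) (rule that, simp_all)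
qed

text \<open>
  The substitution \<open>y_i \<mapsto> y_i + z ^ (M * N ^ i)\<close> makes monomials with exponents below \<open>N\<close> monic in
  \<open>z\<close> of pairwise different degrees.
\<close>

fun nagata :: "'a \<Rightarrow> nat \<Rightarrow> nat \<Rightarrow> 'a list \<Rightarrow> 'a list" where
  "nagata z N M [] = []"
| "nagata z N M (y # ys) = (y - z ^ M) # nagata z N (M * N) ys"

text \<open>The exponents read as digits in base \<open>N\<close>, least significant first: the
  degree in \<open>z\<close> that a monomial acquires through the substitution.\<close>

fun weight :: "nat \<Rightarrow> nat list \<Rightarrow> nat" where
  "weight N [] = 0"
| "weight N (a # \<alpha>) = a + N * weight N \<alpha>"

lemma length_nagata [simp]: "length (nagata z N M ys) = length ys"
  by (induction ys arbitrary: M) auto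

lemma nagata_subset: "z \<in> R \<Longrightarrow> set ys \<subseteq> R \<Longrightarrow> set (nagata z N M ys) \<subseteq> R"
  by (induction ys arbitrary: M) (auto intro!: diff_mem power_mem)

lemma weight_inj:
  "length \<alpha> = length \<beta> \<Longrightarrow> (\<And>a. a \<in> set \<alpha> \<union> set \<beta> \<Longrightarrow> a < N) \<Longrightarrow> weight N \<alpha> = weight N \<beta> \<Longrightarrow> \<alpha> = \<beta>"
proof (induction \<alpha> \<beta> rule: list_induct2)
  case (Cons a \<alpha> b \<beta>)
  have ab: "a < N" "b < N" using Cons.prems(1) by auto
  have "(a + N * weight N \<alpha>) mod N = (b + N * weight N \<beta>) mod N"
    "(a + N * weight N \<alpha>) div N = (b + N * weight N \<beta>) div N" using Cons.prems(2) by simp_all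
  then show ?case using ab Cons by simp
qed simp

section \<open>Polynomial expressions in one element over a subring\<close>

context
  fixes B :: "'a set" and z :: 'a
  assumes B: "comm_subring B"
begin

interpretation B: comm_subring B by (rule B)

text \<open>Values of polynomials in \<open>z\<close> over \<open>B\<close> of degree below
  \<open>D\<close>. As \<open>z\<close> may satisfy relations, an element has no degree of its own,
  only bounds of this kind.\<close>

definition low :: "nat \<Rightarrow> 'a set" where
  "low D = module_span B ((^) z ` {..<D})"

lemma low_add: "x \<in> low D \<Longrightarrow> y \<in> low D \<Longrightarrow> x + y \<in> low D"
  unfolding low_def by (rule B.module_span_add)

lemma low_mult: "x \<in> low D \<Longrightarrow> b \<in> B \<Longrightarrow> b * x \<in> low D"
  unfolding low_def by (rule B.module_span_mult)

lemma low_base: "k < D \<Longrightarrow> b \<in> B \<Longrightarrow> b * z ^ k \<in> low D"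
  unfolding low_def by (rule B.module_span_base) auto

lemma low_mono: "x \<in> low D \<Longrightarrow> D \<le> D' \<Longrightarrow> x \<in> low D'"
  unfolding low_def by (erule module_span_mono) auto

lemma low_zero: "0 \<in> low D"
  unfolding low_def by (rule module_span.zero)

lemma low_induct [consumes 1, case_names zero add]:
  assumes "x \<in> low D" "P 0" "\<And>x b k. x \<in> low D \<Longrightarrow> P x \<Longrightarrow> b \<in> B \<Longrightarrow> k < D \<Longrightarrow> P (x + b * z ^ k)"
  shows "P x"
  using assms(1) unfolding low_def
  by (induction rule: module_span.induct) (use assms(2,3) in \<open>auto simp: low_def\<close>)

lemma low_power: "x \<in> low D \<Longrightarrow> x * z ^ e \<in> low (D + e)"
proof (induction rule: low_induct)
  case (add x b k)
  have "x * z ^ e + b * z ^ (k + e) \<in> low (D + e)"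
    by (rule low_add, rule add, rule low_base) (use add in simp_all)
  then show ?case by (simp add: algebra_simps power_add)
qed (simp add: low_zero)

lemma low_times:
  assumes "x \<in> low D" "y \<in> low E"
  shows "x * y \<in> low (D + E)"
  using assms(2)
proof (induction rule: low_induct)
  case (add y b k)
  have kE: "D + k \<le> D + E" using add.hyps by linarith
  have "x * y + b * (x * z ^ k) \<in> low (D + E)"
    by (rule low_add[OF add.IH low_mult[OF low_mono[OF low_power[OF assms(1)] kE]]]) (rule add.hyps)
  then show ?case by (simp add: algebra_simps)
qed (simp add: low_zero)

definition monic :: "nat \<Rightarrow> 'a set" where
  "monic D = {x. x - z ^ D \<in> low D}"

lemma monic_mult: "x \<in> monic D \<Longrightarrow> y \<in> monic E \<Longrightarrow> x * y \<in> monic (D + E)"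
proof -
  assume "x \<in> monic D" "y \<in> monic E"
  then have xy: "x - z ^ D \<in> low D" "y - z ^ E \<in> low E" by (auto simp: monic_def)
  have "(x - z ^ D) * (y - z ^ E) + ((x - z ^ D) * z ^ E + (y - z ^ E) * z ^ D) \<in> low (D + E)"
    by (rule low_add[OF low_times[OF xy] low_add[OF low_power[OF xy(1)]]])
      (subst add.commute, rule low_power[OF xy(2)])
  then show ?thesis by (simp add: monic_def algebra_simps power_add)
qed

lemma monic_one: "1 \<in> monic 0"
  by (simp add: monic_def low_zero)

lemma monic_power: "x \<in> monic D \<Longrightarrow> x ^ k \<in> monic (D * k)"
proof (induction k)
  case (Suc k)
  show ?case using monic_mult[OF Suc.prems Suc.IH[OF Suc.prems]] by simp
qed (simp add: monic_one)

lemma monic_monom_list: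
  "set (nagata z N M ys) \<subseteq> B \<Longrightarrow> length \<alpha> = length ys \<Longrightarrow> M > 0 \<Longrightarrow> N > 0 \<Longrightarrow>
    monom_list ys \<alpha> \<in> monic (M * weight N \<alpha>)"
proof (induction ys arbitrary: M \<alpha>)
  case (Cons y ys)
  then obtain a \<beta> where \<alpha>: "\<alpha> = a # \<beta>" "length \<beta> = length ys" by (cases \<alpha>) auto
  \<comment> \<open>The new generator \<open>y - z ^ M\<close> is a coefficient from
    \<open>B\<close>, and \<open>M > 0\<close> puts constants below the leading term, so
    \<open>y\<close> is monic of degree \<open>M\<close>.\<close>
  have "(y - z ^ M) * z ^ 0 \<in> low M" using Cons.prems by (intro low_base) auto
  then have "y \<in> monic M" by (simp add: monic_def)
  then have "y ^ a * monom_list ys \<beta> \<in> monic (M * a + M * N * weight N \<beta>)"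
    by (rule monic_mult[OF monic_power Cons.IH]) (use Cons.prems \<alpha> in auto)
  then show ?case by (simp add: \<alpha> algebra_simps)
qed (simp add: monic_one)

end

definition finite_over :: "'a set \<Rightarrow> 'a set \<Rightarrow> 'a set \<Rightarrow> bool" where
  "finite_over I B W \<longleftrightarrow> finite W \<and> W \<subseteq> R \<and> (\<forall>r\<in>R. \<exists>x\<in>module_span B W. r - x \<in> I)"

end

section \<open>Removing one algebra generator\<close>

context scalars
begin

lemma alg_span_mono: "Y \<subseteq> alg_span Z \<Longrightarrow> alg_span Y \<subseteq> alg_span Z"
  by (rule alg_span_subset[OF comm_subring_alg_span alg_span.scalar])

lemma alg_span_carrier: "Y \<subseteq> R \<Longrightarrow> alg_span Y \<subseteq> R"
  by (rule alg_span_subset[OF comm_subring_axioms scalar_mem])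

lemma nagata_recover:
  "y \<in> set ys \<Longrightarrow> y \<in> alg_span (insert z (set (nagata z N M ys)))"
proof (induction ys arbitrary: M)
  case (Cons x ys)
  interpret A: comm_subring "alg_span (insert z (set (nagata z N M (x # ys))))"
    by (rule comm_subring_alg_span)
  show ?case
  proof (cases "y = x")
    case True
    have "(x - z ^ M) + z ^ M \<in> alg_span (insert z (set (nagata z N M (x # ys))))"
      by (intro A.add_mem A.power_mem alg_span.gen) auto
    then show ?thesis using True by simp
  next
    case False
    have "alg_span (insert z (set (nagata z N (M * N) ys))) \<subseteq> alg_span (insert z (set (nagata z N M (x # ys))))"
      by (rule alg_span_mono) (auto intro: alg_span.gen)
    then show ?thesis using Cons.IH[of "M * N"] Cons.prems False by auto
  qed
qed simp

text \<open>Expanded in \<open>z # ys\<close>, the relation has the term \<open>z ^ k\<close> with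
  coefficient 1, and all other terms carry at least \<open>z ^ (k + 1)\<close>, so this term cannot
  cancel. A substitution with \<open>N\<close> beyond all exponents gives the monomials that occur
  distinct weights, and the heaviest one supplies the leading term of a monic equation for
  \<open>z\<close>.\<close>

lemma monic_relation:
  assumes I: "ideal_in R I" and z: "z \<in> R" and ys: "set ys \<subseteq> R"
    and b: "b \<in> alg_span (set (z # ys))" and rel: "z ^ k * (1 + z * b) \<in> I"
  obtains N M D l where "l \<in> low (alg_span (set (nagata z N M ys))) z D" "z ^ D - l \<in> I"
proof -
  interpret ideal_in R I by (rule I)
  let ?zs = "z # ys"
  obtain F f where F: "finite F" "\<And>\<alpha>. \<alpha> \<in> F \<Longrightarrow> length \<alpha> = length ?zs"
    "b = (\<Sum>\<alpha>\<in>F. \<kappa> (f \<alpha>) * monom_list ?zs \<alpha>)" using alg_span_expand[OF b] by metis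
  \<comment> \<open>Multiplication by \<open>z ^ Suc k\<close> on exponent lists, followed by its
    inverse.\<close>
  define shift where "shift \<alpha> = (hd \<alpha> + Suc k) # tl \<alpha>" for \<alpha>
  define unshift where "unshift \<alpha> = (hd \<alpha> - Suc k) # tl \<alpha>" for \<alpha>
  have unshift: "unshift (shift \<alpha>) = \<alpha>" if "\<alpha> \<in> F" for \<alpha>
    using F(2)[OF that] by (cases \<alpha>) (auto simp: shift_def unshift_def)
  have inj: "inj_on shift F" by (rule inj_on_inverseI[of _ unshift]) (rule unshift)
  define \<beta>0 where "\<beta>0 = k # replicate (length ys) 0"
  have \<beta>0: "\<beta>0 \<notin> shift ` F" by (auto simp: \<beta>0_def shift_def)
  define G where "G = insert \<beta>0 (shift ` F)"
  define g where "g \<beta> = (if \<beta> = \<beta>0 then 1 else f (unshift \<beta>))" for \<beta>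
  have len: "length \<beta> = length ?zs" if "\<beta> \<in> G" for \<beta>
    using that F(2) by (auto simp: G_def \<beta>0_def shift_def)
  have "(\<Sum>\<beta>\<in>G. \<kappa> (g \<beta>) * monom_list ?zs \<beta>)
      = z ^ k + (\<Sum>\<beta>\<in>shift ` F. \<kappa> (g \<beta>) * monom_list ?zs \<beta>)"
    unfolding G_def using \<beta>0 F(1)
    by (simp add: g_def) (simp add: \<beta>0_def monom_list_zero)
  also have "(\<Sum>\<beta>\<in>shift ` F. \<kappa> (g \<beta>) * monom_list ?zs \<beta>)
      = (\<Sum>\<alpha>\<in>F. \<kappa> (f \<alpha>) * (z ^ Suc k * monom_list ?zs \<alpha>))"
    unfolding sum.reindex[OF inj] o_def
  proof (rule sum.cong)
    fix \<alpha> assume \<alpha>: "\<alpha> \<in> F"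
    then have "g (shift \<alpha>) = f \<alpha>" using \<beta>0 unshift by (auto simp: g_def)
    moreover have "monom_list ?zs (shift \<alpha>) = z ^ Suc k * monom_list ?zs \<alpha>"
      by (simp add: shift_def power_add ac_simps)
    ultimately show "\<kappa> (g (shift \<alpha>)) * monom_list ?zs (shift \<alpha>) = \<kappa> (f \<alpha>) * (z ^ Suc k * monom_list ?zs \<alpha>)"
      by simp
  qed simp
  also have "\<dots> = z ^ Suc k * b" unfolding F(3) sum_distrib_left
    by (rule sum.cong) (auto simp: ac_simps)
  also have "z ^ k + z ^ Suc k * b = z ^ k * (1 + z * b)" by (simp add: algebra_simps)
  finally have G_I: "(\<Sum>\<beta>\<in>G. \<kappa> (g \<beta>) * monom_list ?zs \<beta>) \<in> I" using rel by simp
  \<comment> \<open>Zero coefficients are dropped so that the leading coefficient is invertible;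
    \<beta>0 survives, so \<open>S\<close> is nonempty.\<close>
  define S where "S = {\<beta> \<in> G. g \<beta> \<noteq> 0}"
  have S: "finite S" "\<beta>0 \<in> S" using F(1) by (auto simp: S_def G_def g_def)
  have "(\<Sum>\<beta>\<in>G. \<kappa> (g \<beta>) * monom_list ?zs \<beta>) = (\<Sum>\<beta>\<in>S. \<kappa> (g \<beta>) * monom_list ?zs \<beta>)"
    by (rule sum.mono_neutral_right) (use F(1) in \<open>auto simp: S_def G_def\<close>)
  with G_I have S_I: "(\<Sum>\<beta>\<in>S. \<kappa> (g \<beta>) * monom_list ?zs \<beta>) \<in> I" by simp
  \<comment> \<open>The sum of all exponents that occur is a crude bound for each of them.\<close>
  define N where "N = Suc (\<Sum>\<beta>\<in>S. sum_list \<beta>)"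
  have N: "a < N" if "\<beta> \<in> S" "a \<in> set \<beta>" for a \<beta>
  proof -
    have "a \<le> sum_list \<beta>" by (rule member_le_sum_list) (use that(2) in auto)
    also have "\<dots> \<le> (\<Sum>\<beta>\<in>S. sum_list \<beta>)" by (rule member_le_sum) (use that S in auto)
    finally show ?thesis by (simp add: N_def)
  qed
  define B where "B = alg_span (set (nagata z N N ys))"
  have Bs: "comm_subring B" unfolding B_def by (rule comm_subring_alg_span)
  interpret B: comm_subring B by (rule Bs)
  have \<kappa>B: "\<kappa> c \<in> B" for c unfolding B_def by (rule alg_span.scalar)
  have monic: "monom_list ?zs \<beta> \<in> monic B z (weight N \<beta>)" if \<beta>S: "\<beta> \<in> S" for \<beta>
  proof -
    obtain a \<alpha> where \<beta>: "\<beta> = a # \<alpha>" "length \<alpha> = length ys"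
      using len[of \<beta>] \<beta>S by (cases \<beta>) (auto simp: S_def)
    have "z ^ a \<in> monic B z a" by (simp add: monic_def[OF Bs] low_zero[OF Bs])
    moreover have "monom_list ys \<alpha> \<in> monic B z (N * weight N \<alpha>)"
      by (rule monic_monom_list[OF Bs]) (auto simp: B_def N_def \<beta> intro: alg_span.gen)
    ultimately show ?thesis using monic_mult[OF Bs] by (simp add: \<beta>)
  qed
  define D where "D = Max (weight N ` S)"
  have "D \<in> weight N ` S" unfolding D_def using S by (intro Max_in) auto
  then obtain \<beta>m where \<beta>m: "\<beta>m \<in> S" "D = weight N \<beta>m" by auto
  have less: "weight N \<beta> < D" if "\<beta> \<in> S" "\<beta> \<noteq> \<beta>m" for \<beta>
  proof -
    have "weight N \<beta> \<le> D" unfolding D_def using S that by (intro Max_ge) auto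
    moreover have "weight N \<beta> \<noteq> weight N \<beta>m"
      using weight_inj[of \<beta> \<beta>m N] that \<beta>m N len[of \<beta>] len[of \<beta>m] by (auto simp: S_def)
    ultimately show ?thesis using \<beta>m by simp
  qed
  have sum_low: "(\<Sum>\<beta>\<in>X. h \<beta>) \<in> low B z D" if "\<And>\<beta>. \<beta> \<in> X \<Longrightarrow> h \<beta> \<in> low B z D" for X h
    using that by (induction X rule: infinite_finite_induct) (auto intro: low_zero[OF Bs] low_add[OF Bs])
  have others: "\<kappa> (g \<beta>) * monom_list ?zs \<beta> \<in> low B z D" if \<beta>: "\<beta> \<in> S - {\<beta>m}" for \<beta>
  proof -
    have w: "weight N \<beta> < D" using less \<beta> by auto
    have "monom_list ?zs \<beta> - z ^ weight N \<beta> \<in> low B z (weight N \<beta>)"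
      using monic[of \<beta>] \<beta> by (auto simp: monic_def[OF Bs])
    then have 1: "monom_list ?zs \<beta> - z ^ weight N \<beta> \<in> low B z D"
      by (rule low_mono[OF Bs]) (use w in simp)
    have 2: "1 * z ^ weight N \<beta> \<in> low B z D" by (rule low_base[OF Bs w]) simp
    have "monom_list ?zs \<beta> \<in> low B z D" using low_add[OF Bs 1 2] by simp
    then show ?thesis by (rule low_mult[OF Bs]) (rule \<kappa>B)
  qed
  have top: "\<kappa> (g \<beta>m) * (monom_list ?zs \<beta>m - z ^ D) \<in> low B z D"
    using monic[OF \<beta>m(1)] \<beta>m(2) by (intro low_mult[OF Bs] \<kappa>B) (simp add: monic_def[OF Bs])
  define l0 where "l0 = (\<Sum>\<beta>\<in>S - {\<beta>m}. \<kappa> (g \<beta>) * monom_list ?zs \<beta>) + \<kappa> (g \<beta>m) * (monom_list ?zs \<beta>m - z ^ D)"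
  have l0: "l0 \<in> low B z D" unfolding l0_def by (rule low_add[OF Bs sum_low[OF others] top])
  have S_eq: "(\<Sum>\<beta>\<in>S. \<kappa> (g \<beta>) * monom_list ?zs \<beta>) = l0 + \<kappa> (g \<beta>m) * z ^ D"
    unfolding l0_def using sum.remove[OF S(1) \<beta>m(1), of "\<lambda>\<beta>. \<kappa> (g \<beta>) * monom_list ?zs \<beta>"]
    by (simp add: algebra_simps)
  define c where "c = inverse (g \<beta>m)"
  have c: "\<kappa> c * \<kappa> (g \<beta>m) = 1" using \<beta>m(1) by (simp add: c_def S_def scalar_mult[symmetric])
  have "\<kappa> c * (l0 + \<kappa> (g \<beta>m) * z ^ D) \<in> I" using S_I S_eq scalar_mem by (auto intro: I_mult)
  also have "\<kappa> c * (l0 + \<kappa> (g \<beta>m) * z ^ D) = z ^ D - \<kappa> (- c) * l0"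
    using c by (simp add: distrib_left mult.assoc[symmetric] scalar_uminus)
  finally have "z ^ D - \<kappa> (- c) * l0 \<in> I" .
  moreover have "\<kappa> (- c) * l0 \<in> low B z D" by (rule low_mult[OF Bs l0 \<kappa>B])
  ultimately show thesis unfolding B_def by (rule that[rotated])
qed

text \<open>Modulo a monic equation of degree \<open>D\<close> for \<open>z\<close>, the
  \<open>B\<close>-span of the powers below \<open>z ^ D\<close> is stable under multiplication by
  \<open>z\<close>, hence under the whole subalgebra, and it represents 1.\<close>

lemma low_cover:
  assumes I: "ideal_in R I" and z: "z \<in> R" and ys': "set ys' \<subseteq> R"
    and l: "l \<in> low (alg_span (set ys')) z D" "z ^ D - l \<in> I"
    and x: "x \<in> alg_span (insert z (set ys'))"
  shows "\<exists>y\<in>low (alg_span (set ys')) z D. x - y \<in> I"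
proof -
  interpret ideal_in R I by (rule I)
  define B where "B = alg_span (set ys')"
  have Bs: "comm_subring B" unfolding B_def by (rule comm_subring_alg_span)
  interpret B: comm_subring B by (rule Bs)
  have BR: "B \<subseteq> R" unfolding B_def by (rule alg_span_carrier[OF ys'])
  have AR: "alg_span (insert z (set ys')) \<subseteq> R" by (rule alg_span_carrier) (use z ys' in auto)
  let ?L = "low B z D"
  have l': "l \<in> ?L" using l by (simp add: B_def)
  have LR: "y \<in> R" if "y \<in> ?L" for y
    using module_span_subset[of B "(^) z ` {..<D}"] that BR z
    by (auto simp: low_def[OF Bs] intro: power_mem)
  have zL: "\<exists>y'\<in>?L. z * y - y' \<in> I" if "y \<in> ?L" for y
  proof (rule low_induct[OF Bs that])
    show "\<exists>y'\<in>?L. z * 0 - y' \<in> I" by (rule bexI[of _ 0]) (simp_all add: low_zero[OF Bs])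
  next
    fix y b k assume "\<exists>y'\<in>?L. z * y - y' \<in> I" "b \<in> B" "k < D"
    then obtain y' where y': "y' \<in> ?L" "z * y - y' \<in> I" by blast
    have "\<exists>y''\<in>?L. b * z ^ Suc k - y'' \<in> I"
    proof (cases "Suc k < D")
      case True
      have "b * z ^ Suc k \<in> ?L" by (rule low_base[OF Bs True \<open>b \<in> B\<close>])
      then show ?thesis by (intro bexI[of _ "b * z ^ Suc k"]) auto
    next
      case False
      then have "Suc k = D" using \<open>k < D\<close> by simp
      have "b * (z ^ D - l) \<in> I" by (rule I_mult) (use \<open>b \<in> B\<close> BR l in auto)
      moreover have "b * l \<in> ?L" by (rule low_mult[OF Bs l' \<open>b \<in> B\<close>])
      ultimately show ?thesis using \<open>Suc k = D\<close> by (intro bexI[of _ "b * l"]) (simp_all add: algebra_simps)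
    qed
    then obtain y'' where y'': "y'' \<in> ?L" "b * z ^ Suc k - y'' \<in> I" by blast
    have "z * (y + b * z ^ k) - (y' + y'') = (z * y + b * z ^ Suc k) - (y' + y'')"
      by (simp add: algebra_simps)
    also have "\<dots> \<in> I" by (rule cong_add[OF y'(2) y''(2)])
    finally show "\<exists>y'\<in>?L. z * (y + b * z ^ k) - y' \<in> I"
      using low_add[OF Bs y'(1) y''(1)] by blast
  qed
  have AL: "\<forall>y\<in>?L. \<exists>y'\<in>?L. x * y - y' \<in> I" using x
  proof induction
    case (scalar c)
    show ?case
    proof
      fix y assume "y \<in> ?L"
      then have "\<kappa> c * y \<in> ?L" by (rule low_mult[OF Bs]) (simp add: B_def alg_span.scalar)
      then show "\<exists>y'\<in>?L. \<kappa> c * y - y' \<in> I" by (intro bexI[of _ "\<kappa> c * y"]) auto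
    qed
  next
    case (gen x)
    show ?case
    proof
      fix y assume y: "y \<in> ?L"
      show "\<exists>y'\<in>?L. x * y - y' \<in> I"
      proof (cases "x = z")
        case True
        then show ?thesis using zL[OF y] by simp
      next
        case False
        then have "x \<in> B" using gen by (auto simp: B_def intro: alg_span.gen)
        then have "x * y \<in> ?L" by (rule low_mult[OF Bs y])
        then show ?thesis by (intro bexI[of _ "x * y"]) auto
      qed
    qed
  next
    case (add x x')
    show ?case
    proof
      fix y assume y: "y \<in> ?L"
      obtain u where u: "u \<in> ?L" "x * y - u \<in> I" using add y by blast
      obtain v where v: "v \<in> ?L" "x' * y - v \<in> I" using add y by blast
      have "(x + x') * y - (u + v) \<in> I" using cong_add[OF u(2) v(2)] by (simp add: algebra_simps)
      then show "\<exists>y'\<in>?L. (x + x') * y - y' \<in> I" using low_add[OF Bs u(1) v(1)] by blast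
    qed
  next
    case (mult x x')
    show ?case
    proof
      fix y assume y: "y \<in> ?L"
      obtain u where u: "u \<in> ?L" "x' * y - u \<in> I" using mult y by blast
      obtain v where v: "v \<in> ?L" "x * u - v \<in> I" using mult u by blast
      have "x * (x' * y - u) + (x * u - v) \<in> I"
        by (rule I_add[OF I_mult[OF _ u(2)] v(2)]) (use mult AR in auto)
      then have "(x * x') * y - v \<in> I" by (simp add: algebra_simps)
      then show "\<exists>y'\<in>?L. (x * x') * y - y' \<in> I" using v by blast
    qed
  qed
  \<comment> \<open>For \<open>D = 0\<close> the span is zero and the equation reads
    \<open>1 - l \<in> I\<close>, so \<open>l\<close> itself represents 1.\<close>
  have "\<exists>e\<in>?L. 1 - e \<in> I"
  proof (cases D)
    case 0
    then show ?thesis using l l' by auto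
  next
    case (Suc D')
    then have "1 * z ^ 0 \<in> ?L" by (intro low_base[OF Bs]) auto
    then show ?thesis by (intro bexI[of _ 1]) auto
  qed
  then obtain e where e: "e \<in> ?L" "1 - e \<in> I" by blast
  then obtain y where y: "y \<in> ?L" "x * e - y \<in> I" using AL by blast
  have "x * (1 - e) + (x * e - y) \<in> I" by (rule I_add[OF I_mult[OF _ e(2)] y(2)]) (use x AR in auto)
  then have "x - y \<in> I" by (simp add: algebra_simps)
  then show ?thesis using y(1) by (auto simp: B_def)
qed

text \<open>One step of Noether normalization: the monic equation makes the old subalgebra finite
  over the one generated by \<open>ys'\<close>. The module generators get multiplied by the powers
  of \<open>z\<close> below \<open>D\<close>.\<close>

lemma finite_over_reduce:
  assumes I: "ideal_in R I" and z: "z \<in> R" and ys: "set ys \<subseteq> R"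
    and fo: "finite_over I (alg_span (set (z # ys))) W"
    and b: "b \<in> alg_span (set (z # ys))" and rel: "z ^ k * (1 + z * b) \<in> I"
  obtains ys' W' where "length ys' = length ys" "set ys' \<subseteq> R" "finite_over I (alg_span (set ys')) W'"
proof -
  interpret ideal_in R I by (rule I)
  obtain N M D l where l: "l \<in> low (alg_span (set (nagata z N M ys))) z D" "z ^ D - l \<in> I"
    by (rule monic_relation[OF I z ys b rel])
  define ys' where "ys' = nagata z N M ys"
  have ys': "set ys' \<subseteq> R" unfolding ys'_def by (rule nagata_subset[OF z ys])
  define B where "B = alg_span (set ys')"
  have Bs: "comm_subring B" unfolding B_def by (rule comm_subring_alg_span)
  define W' where "W' = (\<lambda>(w, k). w * z ^ k) ` (W \<times> {..<D})"
  have sub: "alg_span (set (z # ys)) \<subseteq> alg_span (insert z (set ys'))"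
    by (rule alg_span_mono) (auto simp: ys'_def intro: alg_span.gen nagata_recover)
  have WR: "finite W" "W \<subseteq> R" using fo by (auto simp: finite_over_def)
  have lowW: "y * w \<in> module_span B W'" if "w \<in> W" "y \<in> low B z D" for y w
  proof (rule low_induct[OF Bs that(2)])
    show "0 * w \<in> module_span B W'" by (simp add: module_span.zero)
  next
    fix x b k assume x: "x * w \<in> module_span B W'" "b \<in> B" "k < D"
    have "w * z ^ k \<in> W'" using that(1) x(3) by (auto simp: W'_def)
    then have "x * w + b * (w * z ^ k) \<in> module_span B W'" using x by (intro module_span.add)
    then show "(x + b * z ^ k) * w \<in> module_span B W'" by (simp add: algebra_simps)
  qed
  have cover: "\<exists>y\<in>module_span B W'. x - y \<in> I" if "x \<in> module_span (alg_span (set (z # ys))) W" for x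
    using that
  proof induction
    case zero
    show ?case by (rule bexI[of _ 0]) (simp_all add: module_span.zero)
  next
    case (add x b w)
    then obtain y where y: "y \<in> module_span B W'" "x - y \<in> I" by blast
    have "b \<in> alg_span (insert z (set ys'))" using add sub by blast
    then obtain c where c: "c \<in> low B z D" "b - c \<in> I"
      using low_cover[OF I z ys' l[folded ys'_def]] unfolding B_def by blast
    have "(b - c) * w \<in> I" by (rule I_mult2[OF _ c(2)]) (use add WR in auto)
    then have "b * w - c * w \<in> I" by (simp add: algebra_simps)
    from cong_add[OF y(2) this] have "x + b * w - (y + c * w) \<in> I" .
    moreover have "y + c * w \<in> module_span B W'"
      by (rule comm_subring.module_span_add[OF Bs lowW y(1)]) (use add c in auto)
    ultimately show ?case by blast
  qed
  have "finite_over I B W'"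
    unfolding finite_over_def
  proof (intro conjI ballI)
    show "finite W'" using WR by (simp add: W'_def)
    show "W' \<subseteq> R" using WR z by (auto simp: W'_def intro!: mult_mem power_mem)
    fix r assume "r \<in> R"
    then obtain x where x: "x \<in> module_span (alg_span (set (z # ys))) W" "r - x \<in> I"
      using fo by (auto simp: finite_over_def)
    then obtain y where y: "y \<in> module_span B W'" "x - y \<in> I" using cover by blast
    have "r - y \<in> I" by (rule cong_trans[OF x(2) y(2)])
    then show "\<exists>y\<in>module_span B W'. r - y \<in> I" using y(1) by blast
  qed
  then show thesis by (intro that[of ys']) (use ys' in \<open>simp_all add: B_def ys'_def\<close>)
qed

text \<open>The element \<open>c\<close> lies only in \<open>R\<close>. Expanding its action on the
  module generators over \<open>B\<close> turns the relation into a linear system whose matrix is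
  the identity modulo \<open>z\<close>; elimination then replaces \<open>c\<close> by an element of
  \<open>B\<close>.\<close>

lemma finite_over_relation:
  assumes I: "ideal_in R I" and B: "comm_subring B" "B \<subseteq> R" and z: "z \<in> B"
    and fo: "finite_over I B W" and c: "c \<in> R" "z ^ k * (1 - z * c) \<in> I"
  obtains b where "b \<in> B" "z ^ k * (1 + z * b) \<in> I"
proof -
  interpret ideal_in R I by (rule I)
  interpret B: comm_subring B by (rule B)
  have W: "finite W" "W \<subseteq> R" using fo by (auto simp: finite_over_def)
  have coeffs: "\<exists>t. (\<forall>i. t i \<in> B) \<and> r - (\<Sum>i\<in>W. t i * i) \<in> I" if r: "r \<in> R" for r
  proof -
    obtain x where x: "x \<in> module_span B W" "r - x \<in> I"
      using fo r unfolding finite_over_def by blast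
    show ?thesis using B.module_span_finite[OF W(1) x(1)] x(2) by metis
  qed
  have "\<forall>w\<in>W. \<exists>t. (\<forall>i. t i \<in> B) \<and> c * w - (\<Sum>i\<in>W. t i * i) \<in> I"
    using coeffs W c(1) by (blast intro: mult_mem)
  from bchoice[OF this] obtain t where
    t: "\<And>w i. w \<in> W \<Longrightarrow> t w i \<in> B" "\<And>w. w \<in> W \<Longrightarrow> c * w - (\<Sum>i\<in>W. t w i * i) \<in> I" by blast
  define T where "T w i = (if i = w then 1 else 0) + z * (- t w i)" for w i
  have zR: "z \<in> R" using z B by auto
  have "\<exists>b\<in>B. \<forall>w\<in>W. (1 + z * b) * (z ^ k * w) \<in> I"
  proof (rule eliminate[OF I B z W(1), where T = T])
    fix w assume "w \<in> W"
    then show "z ^ k * w \<in> R" using W zR by (auto intro!: mult_mem power_mem)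
  next
    fix w i assume "w \<in> W" "i \<in> W"
    then show "\<exists>b\<in>B. T w i = (if i = w then 1 else 0) + z * b"
      unfolding T_def using t(1) B.uminus_mem by blast
  next
    fix w assume w: "w \<in> W"
    have "(\<Sum>i\<in>W. T w i * (z ^ k * i))
        = (\<Sum>i\<in>W. if i = w then z ^ k * w else 0) - z ^ Suc k * (\<Sum>i\<in>W. t w i * i)"
      unfolding sum_distrib_left sum_subtractf[symmetric]
      by (rule sum.cong) (auto simp: T_def algebra_simps)
    also have "\<dots> = (z ^ k * (1 - z * c)) * w + z ^ Suc k * (c * w - (\<Sum>i\<in>W. t w i * i))"
      using w W by (simp add: algebra_simps)
    also have "\<dots> \<in> I"
      by (rule I_add[OF I_mult2[OF _ c(2)] I_mult[OF _ t(2)[OF w]]])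
        (use w W zR power_mem[of z "Suc k"] in auto)
    finally show "(\<Sum>i\<in>W. T w i * (z ^ k * i)) \<in> I" .
  qed
  then obtain b where b: "b \<in> B" "\<And>w. w \<in> W \<Longrightarrow> (1 + z * b) * (z ^ k * w) \<in> I" by blast
  \<comment> \<open>The generators are now annihilated as required; writing 1 in terms of them
    transfers this to 1.\<close>
  obtain s where s: "\<forall>i. s i \<in> B" "1 - (\<Sum>i\<in>W. s i * i) \<in> I" using coeffs[OF one_mem] by blast
  have bR: "b \<in> R" using b B by auto
  have "(\<Sum>i\<in>W. s i * ((1 + z * b) * (z ^ k * i))) \<in> I"
    by (rule I_sum, rule I_mult[OF _ b(2)]) (use s B in auto)
  moreover have "z ^ k * (1 + z * b) * (1 - (\<Sum>i\<in>W. s i * i)) \<in> I"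
    by (rule I_mult[OF _ s(2)]) (use zR bR in \<open>intro mult_mem power_mem add_mem one_mem\<close>)
  ultimately have "z ^ k * (1 + z * b) * (1 - (\<Sum>i\<in>W. s i * i))
      + (\<Sum>i\<in>W. s i * ((1 + z * b) * (z ^ k * i))) \<in> I" by (rule I_add[rotated])
  also have "(\<Sum>i\<in>W. s i * ((1 + z * b) * (z ^ k * i))) = z ^ k * (1 + z * b) * (\<Sum>i\<in>W. s i * i)"
    unfolding sum_distrib_left by (rule sum.cong) (auto simp: ac_simps)
  finally have "z ^ k * (1 + z * b) \<in> I" by (simp add: right_diff_distrib)
  with b(1) show thesis by (rule that)
qed

definition finite_codim :: "'a set \<Rightarrow> bool" where
  "finite_codim I \<longleftrightarrow> (\<exists>W. finite W \<and> W \<subseteq> R \<and> (\<forall>r\<in>R. \<exists>f. r - lin_comb W f \<in> I))"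

text \<open>Dimension zero yields a relation of the required kind for any element, so the generators
  of a subalgebra over which the quotient is finite can be removed one after another until only the
  scalars are left.\<close>

theorem krull_dim_0_finite_codim:
  assumes I: "ideal_in R I" and dim: "krull_dim (ring_on R Quot I) = 0"
    and Y: "finite Y" "R = alg_span Y"
  shows "finite_codim I"
proof -
  interpret ideal_in R I by (rule I)
  define P where "P n \<longleftrightarrow> (\<exists>zs W. length zs = n \<and> set zs \<subseteq> R \<and> finite_over I (alg_span (set zs)) W)" for n
  obtain zs where zs: "set zs = Y" using finite_list[OF Y(1)] by blast
  have "finite_over I (alg_span (set zs)) {1}"
    unfolding finite_over_def
  proof (intro conjI ballI)
    fix r assume "r \<in> R"
    then have "r * 1 \<in> module_span (alg_span (set zs)) {1}"
      by (intro comm_subring.module_span_base[OF comm_subring_alg_span]) (use Y zs in auto)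
    then show "\<exists>x\<in>module_span (alg_span (set zs)) {1}. r - x \<in> I" by (intro bexI[of _ r]) auto
  qed auto
  moreover have "set zs \<subseteq> R" using Y zs alg_span.gen by blast
  ultimately have "P (length zs)" unfolding P_def by blast
  moreover have "P n" if Pn: "P (Suc n)" for n
  proof -
    obtain xs W where xs: "length xs = Suc n" "set xs \<subseteq> R" "finite_over I (alg_span (set xs)) W"
      using Pn unfolding P_def by (elim exE conjE)
    then obtain z ys where zys: "xs = z # ys" by (cases xs) auto
    have z: "z \<in> R" "set ys \<subseteq> R" using xs zys by auto
    obtain k c where c: "c \<in> R" "z ^ k * (1 - z * c) \<in> I"
      by (rule krull_dim_0_pi_regular[OF I dim z(1)])
    obtain b where b: "b \<in> alg_span (set xs)" "z ^ k * (1 + z * b) \<in> I"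
      by (rule finite_over_relation[OF I comm_subring_alg_span alg_span_carrier[OF xs(2)] _ xs(3) c])
        (auto simp: zys intro: alg_span.gen)
    obtain ys' W' where "length ys' = length ys" "set ys' \<subseteq> R" "finite_over I (alg_span (set ys')) W'"
      by (rule finite_over_reduce[OF I z xs(3)[unfolded zys] b(1)[unfolded zys] b(2)])
    then show ?thesis unfolding P_def using xs(1) zys by auto
  qed
  ultimately have "P 0" using inc_induct[of 0 "length zs" P] by blast
  then obtain W where W: "finite_over I (alg_span {}) W" unfolding P_def by auto
  have fin: "finite W" "W \<subseteq> R" using W by (auto simp: finite_over_def)
  have sub: "alg_span {} \<subseteq> range \<kappa>"
    by (rule alg_span_subset[OF comm_subring_range]) auto
  have "\<exists>f. r - lin_comb W f \<in> I" if r: "r \<in> R" for r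
  proof -
    obtain x where x: "x \<in> module_span (alg_span {}) W" "r - x \<in> I"
      using W r unfolding finite_over_def by blast
    have "\<exists>b. (\<forall>w. b w \<in> range \<kappa>) \<and> x = (\<Sum>w\<in>W. b w * w)"
      by (rule comm_subring.module_span_finite[OF comm_subring_range fin(1)
        module_span_mono[OF x(1) sub order.refl]])
    then obtain b where b: "\<forall>w. b w \<in> range \<kappa>" "x = (\<Sum>w\<in>W. b w * w)"
      by (elim exE conjE)
    from b(1) have "\<forall>w. \<exists>c. b w = \<kappa> c" by blast
    then obtain f where "\<And>w. b w = \<kappa> (f w)" by metis
    then show ?thesis using x(2) b(2) by (intro exI[of _ f]) (simp add: lin_comb_def)
  qed
  then show ?thesis using fin unfolding finite_codim_def by blast
qed

end

subsection \<open>Ideals of finite codimension\<close>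

context scalars
begin

lemma lin_span_mod_closed:
  assumes U: "lin_subspace U" and W: "\<And>w. w \<in> W \<Longrightarrow> \<exists>g. w - lin_comb B g \<in> U"
  shows "\<exists>g. lin_comb W f - lin_comb B g \<in> U"
proof -
  have "\<exists>g. (\<Sum>w\<in>W. \<kappa> (f w) * w) - lin_comb B g \<in> U"
    using W
  proof (induction W rule: infinite_finite_induct)
    case (insert w W)
    obtain g where g: "(\<Sum>w\<in>W. \<kappa> (f w) * w) - lin_comb B g \<in> U"
      using insert.IH insert.prems by (meson insertI2)
    obtain h where h: "w - lin_comb B h \<in> U" using insert.prems[of w] by auto
    have "\<kappa> (f w) * (w - lin_comb B h) + ((\<Sum>w\<in>W. \<kappa> (f w) * w) - lin_comb B g) \<in> U"
      using U g h by (simp add: lin_subspace_def)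
    also have "\<kappa> (f w) * (w - lin_comb B h) + ((\<Sum>w\<in>W. \<kappa> (f w) * w) - lin_comb B g)
        = (\<Sum>w\<in>insert w W. \<kappa> (f w) * w) - lin_comb B (\<lambda>b. f w * h b + g b)"
      unfolding lin_comb_add lin_comb_scale using insert.hyps by (simp add: algebra_simps)
    finally show ?case by blast
  qed (use U in \<open>auto simp: lin_subspace_def lin_comb_def intro!: exI[of _ "\<lambda>_. 0"]\<close>)
  then show ?thesis by (simp add: lin_comb_def)
qed

definition indep_mod :: "'a set \<Rightarrow> 'a set \<Rightarrow> bool" where
  "indep_mod U B \<longleftrightarrow> (\<forall>f. lin_comb B f \<in> U \<longrightarrow> (\<forall>b\<in>B. f b = 0))"

lemma indep_mod_maximal:
  assumes U: "lin_subspace U" and B: "finite B" "indep_mod U B" and w: "\<not> indep_mod U (insert w B)"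
  shows "\<exists>g. w - lin_comb B g \<in> U"
proof (cases "w \<in> B")
  case True
  then show ?thesis using B w by (simp add: insert_absorb)
next
  case False
  obtain f b where f: "lin_comb (insert w B) f \<in> U" "b \<in> insert w B" "f b \<noteq> 0"
    using w unfolding indep_mod_def by blast
  have fs: "\<kappa> (f w) * w + lin_comb B f \<in> U" using f(1) by (simp add: lin_comb_insert[OF B(1) False])
  have "f w \<noteq> 0"
  proof
    assume "f w = 0"
    then have "\<forall>b\<in>B. f b = 0" using B(2) fs by (simp add: indep_mod_def)
    then show False using f \<open>f w = 0\<close> by auto
  qed
  have "\<kappa> (inverse (f w)) * (\<kappa> (f w) * w + lin_comb B f) \<in> U"
    using U fs by (simp add: lin_subspace_def)
  also have "\<kappa> (inverse (f w)) * (\<kappa> (f w) * w + lin_comb B f) = w - lin_comb B (\<lambda>b. - inverse (f w) * f b)"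
    unfolding lin_comb_scale using \<open>f w \<noteq> 0\<close>
    by (simp add: distrib_left mult.assoc[symmetric] scalar_mult[symmetric] scalar_uminus)
  finally show ?thesis by blast
qed

text \<open>Among the subsets of a finite spanning set that are independent modulo some member of
  the chain, one of maximal size spans modulo all later members, which leaves no room for a strict
  inclusion.\<close>

lemma finite_codim_chain:
  assumes fc: "finite_codim I" and U: "\<And>k. lin_subspace (U k)" "\<And>k. I \<subseteq> U k" "\<And>k. U (Suc k) \<subseteq> U k"
    and UR: "\<And>k. U k \<subseteq> R"
  shows "\<exists>N. \<forall>k\<ge>N. U k = U N"
proof -
  obtain W where W: "finite W" "W \<subseteq> R" "\<And>r. r \<in> R \<Longrightarrow> \<exists>f. r - lin_comb W f \<in> I"
    using fc unfolding finite_codim_def by blast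
  define C where "C = {card B | B k. B \<subseteq> W \<and> indep_mod (U k) B}"
  have "C \<subseteq> {..card W}" using W(1) by (auto simp: C_def intro: card_mono)
  then have fin: "finite C" by (rule finite_subset) simp
  have "indep_mod (U 0) {}" by (simp add: indep_mod_def)
  then have "0 \<in> C" unfolding C_def by (intro CollectI exI[of _ "{}"]) auto
  then have "Max C \<in> C" using fin by (intro Max_in) auto
  then obtain B N where B: "B \<subseteq> W" "indep_mod (U N) B" "card B = Max C" unfolding C_def by auto
  have fB: "finite B" using B W finite_subset by blast
  have "U k = U N" if k: "k \<ge> N" for k
  proof
    show sub: "U k \<subseteq> U N" using k lift_Suc_antimono_le[of U N k] U(3) by blast
    have ind: "indep_mod (U k) B" using B(2) sub unfolding indep_mod_def by blast
    have Ws: "\<exists>g. w - lin_comb B g \<in> U k" if w: "w \<in> W" for w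
    proof (cases "w \<in> B")
      case True
      then have "lin_comb B (\<lambda>x. if x = w then 1 else 0) = (\<Sum>x\<in>B. if x = w then w else 0)"
        unfolding lin_comb_def by (intro sum.cong) auto
      also have "\<dots> = w" using True fB by simp
      finally show ?thesis using U(1)[of k] by (intro exI[of _ "\<lambda>x. if x = w then 1 else 0"]) (simp add: lin_subspace_def)
    next
      case False
      have "\<not> indep_mod (U k) (insert w B)"
      proof
        assume "indep_mod (U k) (insert w B)"
        then have "card (insert w B) \<in> C" unfolding C_def using B(1) w by blast
        then show False using Max_ge[OF fin] False fB B(3) by fastforce
      qed
      then show ?thesis by (rule indep_mod_maximal[OF U(1) fB ind])
    qed
    show "U N \<subseteq> U k"
    proof
      fix x assume x: "x \<in> U N"
      obtain f where f: "x - lin_comb W f \<in> I" using W(3)[of x] x UR by blast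
      obtain g where g: "lin_comb W f - lin_comb B g \<in> U k"
        using lin_span_mod_closed[OF U(1) Ws] by blast
      have xg: "x - lin_comb B g \<in> U k"
      proof -
        have "(x - lin_comb W f) + (lin_comb W f - lin_comb B g) \<in> U k"
          using f g U(1)[of k] U(2)[of k] unfolding lin_subspace_def by blast
        then show ?thesis by simp
      qed
      \<comment> \<open>This element is the combination of \<open>B\<close> that represents
        \<open>x\<close>; since it lies in \<open>U N\<close>, independence makes its coefficients
        vanish.\<close>
      then have "x - (x - lin_comb B g) \<in> U N" using lin_subspace_diff[OF U(1) x] sub by blast
      then have "\<forall>b\<in>B. g b = 0" using B(2) by (simp add: indep_mod_def)
      then have "lin_comb B g = 0" by (simp add: lin_comb_def)
      then show "x \<in> U k" using xg by simp
    qed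
  qed
  then show ?thesis by blast
qed

text \<open>The spaces spanned modulo \<open>I\<close> by the powers \<open>y ^ j\<close> with
  \<open>j \<ge> k\<close> become stationary in \<open>k\<close>, which writes some
  \<open>y ^ N\<close> through higher powers. Solving for the highest one gives the monic
  equation.\<close>

lemma finite_codim_monic:
  assumes I: "ideal_in R I" and fc: "finite_codim I" and y: "y \<in> R"
  shows "\<exists>D c. y ^ D - (\<Sum>j<D. \<kappa> (c j) * y ^ j) \<in> I"
proof -
  interpret ideal_in R I by (rule I)
  define U where "U k = {i + (\<Sum>j\<in>J. \<kappa> (c j) * y ^ j) | i J c. i \<in> I \<and> finite J \<and> J \<subseteq> {k..}}" for k :: nat
  have sub: "lin_subspace (U k)" for k
    unfolding lin_subspace_def
  proof (intro conjI ballI allI)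
    show "0 \<in> U k" unfolding U_def by (intro CollectI exI[of _ 0] exI[of _ "{}"]) auto
  next
    fix u v assume "u \<in> U k" "v \<in> U k"
    then obtain i J c i' J' c' where u: "u = i + (\<Sum>j\<in>J. \<kappa> (c j) * y ^ j)" "i \<in> I" "finite J" "J \<subseteq> {k..}"
      and v: "v = i' + (\<Sum>j\<in>J'. \<kappa> (c' j) * y ^ j)" "i' \<in> I" "finite J'" "J' \<subseteq> {k..}"
      unfolding U_def by (elim CollectE exE conjE)
    define d where "d j = (if j \<in> J then c j else 0) + (if j \<in> J' then c' j else 0)" for j
    have "(\<Sum>j\<in>J \<union> J'. \<kappa> (d j) * y ^ j) = (\<Sum>j\<in>J \<union> J'. if j \<in> J then \<kappa> (c j) * y ^ j else 0)
        + (\<Sum>j\<in>J \<union> J'. if j \<in> J' then \<kappa> (c' j) * y ^ j else 0)"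
      unfolding sum.distrib[symmetric] by (rule sum.cong) (auto simp: d_def scalar_add algebra_simps)
    also have "(\<Sum>j\<in>J \<union> J'. if j \<in> J then \<kappa> (c j) * y ^ j else 0) = (\<Sum>j\<in>J. \<kappa> (c j) * y ^ j)"
      by (rule sum.mono_neutral_cong_right) (use u v in auto)
    also have "(\<Sum>j\<in>J \<union> J'. if j \<in> J' then \<kappa> (c' j) * y ^ j else 0) = (\<Sum>j\<in>J'. \<kappa> (c' j) * y ^ j)"
      by (rule sum.mono_neutral_cong_right) (use u v in auto)
    finally have "u + v = (i + i') + (\<Sum>j\<in>J \<union> J'. \<kappa> (d j) * y ^ j)" unfolding u(1) v(1) by simp
    then show "u + v \<in> U k" unfolding U_def using u v I_add
      by (intro CollectI exI[of _ "i + i'"] exI[of _ "J \<union> J'"] exI[of _ d]) auto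
  next
    fix a u assume "u \<in> U k"
    then obtain i J c where u: "u = i + (\<Sum>j\<in>J. \<kappa> (c j) * y ^ j)" "i \<in> I" "finite J" "J \<subseteq> {k..}"
      unfolding U_def by (elim CollectE exE conjE)
    have "\<kappa> a * u = \<kappa> a * i + (\<Sum>j\<in>J. \<kappa> (a * c j) * y ^ j)"
      unfolding u(1) by (simp add: distrib_left sum_distrib_left scalar_mult mult.assoc)
    then show "\<kappa> a * u \<in> U k" unfolding U_def using u I_mult[OF scalar_mem]
      by (intro CollectI exI[of _ "\<kappa> a * i"] exI[of _ J] exI[of _ "\<lambda>j. a * c j"]) auto
  qed
  have "\<exists>N. \<forall>k\<ge>N. U k = U N"
  proof (rule finite_codim_chain[OF fc sub])
    show "I \<subseteq> U k" for k
    proof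
      fix i assume "i \<in> I"
      then show "i \<in> U k" unfolding U_def by (intro CollectI exI[of _ i] exI[of _ "{}"]) auto
    qed
    show "U (Suc k) \<subseteq> U k" for k
    proof
      fix u assume "u \<in> U (Suc k)"
      then obtain i J c where u: "u = i + (\<Sum>j\<in>J. \<kappa> (c j) * y ^ j)" "i \<in> I" "finite J" "J \<subseteq> {Suc k..}"
        unfolding U_def by (elim CollectE exE conjE)
      have "J \<subseteq> {k..}" using u(4) Suc_leD by fastforce
      then show "u \<in> U k" unfolding U_def using u
        by (intro CollectI exI[of _ i] exI[of _ J] exI[of _ c]) auto
    qed
    show "U k \<subseteq> R" for k
    proof
      fix u assume "u \<in> U k"
      then obtain i J c where u: "u = i + (\<Sum>j\<in>J. \<kappa> (c j) * y ^ j)" "i \<in> I"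
        unfolding U_def by (elim CollectE exE conjE)
      show "u \<in> R" unfolding u(1)
        by (intro add_mem sum_mem mult_mem scalar_mem power_mem y I_memR u(2))
    qed
  qed
  then obtain N where N: "U (Suc N) = U N" using le_Suc_eq by blast
  have "y ^ N \<in> U N" unfolding U_def
    by (intro CollectI exI[of _ 0] exI[of _ "{N}"] exI[of _ "\<lambda>_. 1"]) auto
  then have "y ^ N \<in> U (Suc N)" using N by simp
  then obtain i J c where u: "y ^ N = i + (\<Sum>j\<in>J. \<kappa> (c j) * y ^ j)" "i \<in> I" "finite J" "J \<subseteq> {Suc N..}"
    unfolding U_def by (elim CollectE exE conjE)
  define J' where "J' = {j \<in> J. c j \<noteq> 0}"
  have J': "finite J'" "J' \<subseteq> {Suc N..}" using u by (auto simp: J'_def)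
  have sum_J': "(\<Sum>j\<in>J. \<kappa> (c j) * y ^ j) = (\<Sum>j\<in>J'. \<kappa> (c j) * y ^ j)"
    by (rule sum.mono_neutral_right) (use u in \<open>auto simp: J'_def\<close>)
  show ?thesis
  proof (cases "J' = {}")
    case True
    then have "y ^ N \<in> I" using u sum_J' by simp
    then show ?thesis by (intro exI[of _ N] exI[of _ "\<lambda>_. 0"]) simp
  next
    case False
    \<comment> \<open>The top exponent with nonzero coefficient. It exceeds \<open>N\<close>, so
      dividing by its coefficient leaves all other terms below it.\<close>
    define D where "D = Max J'"
    have D: "D \<in> J'" unfolding D_def using J' False by (intro Max_in)
    then have ND: "N < D" "c D \<noteq> 0" using J' by (auto simp: J'_def)
    define a where "a = inverse (c D)"
    define d where "d j = a * ((if j = N then 1 else 0) - (if j \<in> J' then c j else 0))" for j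
    have "(\<Sum>j<D. \<kappa> (d j) * y ^ j)
        = \<kappa> a * ((\<Sum>j<D. if j = N then y ^ N else 0) - (\<Sum>j<D. if j \<in> J' then \<kappa> (c j) * y ^ j else 0))"
      unfolding sum_subtractf[symmetric] sum_distrib_left
      by (rule sum.cong) (auto simp: d_def scalar_mult scalar_diff scalar_uminus algebra_simps)
    also have "(\<Sum>j<D. if j = N then y ^ N else 0) = y ^ N" using ND by simp
    also have "(\<Sum>j<D. if j \<in> J' then \<kappa> (c j) * y ^ j else 0) = (\<Sum>j\<in>J' - {D}. \<kappa> (c j) * y ^ j)"
    proof (rule sum.mono_neutral_cong_right)
      show "J' - {D} \<subseteq> {..<D}"
      proof
        fix j assume "j \<in> J' - {D}"
        then have "j \<le> D" "j \<noteq> D" unfolding D_def using J' by (auto intro: Max_ge)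
        then show "j \<in> {..<D}" by simp
      qed
    qed auto
    also have "\<dots> = (y ^ N - i) - \<kappa> (c D) * y ^ D"
      using u(1) sum_J' sum.remove[OF J'(1) D, of "\<lambda>j. \<kappa> (c j) * y ^ j"] by (simp add: algebra_simps)
    also have "\<kappa> a * (y ^ N - (y ^ N - i - \<kappa> (c D) * y ^ D)) = \<kappa> a * i + y ^ D"
      using ND(2) by (simp add: distrib_left mult.assoc[symmetric] scalar_mult[symmetric] a_def)
    finally have "y ^ D - (\<Sum>j<D. \<kappa> (d j) * y ^ j) = - (\<kappa> a * i)" by simp
    moreover have "- (\<kappa> a * i) \<in> I" by (intro I_uminus I_mult scalar_mem u(2))
    ultimately have "y ^ D - (\<Sum>j<D. \<kappa> (d j) * y ^ j) \<in> I" by simp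
    then show ?thesis by (intro exI)
  qed
qed

section \<open>Units modulo an ideal of finite codimension\<close>

definition unit_mod :: "'a set \<Rightarrow> 'a \<Rightarrow> bool" where
  "unit_mod I u \<longleftrightarrow> (\<exists>w\<in>R. u * w - 1 \<in> I)"

text \<open>Divided differences replace the Vandermonde determinant: dividing the difference of two
  members by \<open>s - s0\<close> lowers the degree in \<open>s\<close> and preserves the top
  coefficient, which lies in \<open>I\<close> by induction.\<close>

lemma vandermonde_mod:
  assumes I: "lin_subspace I" and S: "infinite S"
    and g: "\<And>s. s \<in> S \<Longrightarrow> (\<Sum>j\<le>n. \<kappa> (s ^ j) * y j) \<in> I" and "j \<le> n"
  shows "y j \<in> I"
  using S g \<open>j \<le> n\<close>
proof (induction n arbitrary: y j S)
  case 0
  obtain s where "s \<in> S" using 0(1) by fastforce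
  then show ?case using 0(2)[of s] 0(3) by simp
next
  case (Suc n)
  note g = Suc.prems(2)
  have sm: "\<kappa> c * u \<in> I" if "u \<in> I" for c u using I that by (simp add: lin_subspace_def)
  have top: "y (Suc n) \<in> I"
  proof -
    obtain s0 where s0: "s0 \<in> S" using Suc.prems(1) by fastforce
    have inf: "infinite (S - {s0})" using Suc.prems(1) by simp
    \<comment> \<open>\<open>z i\<close> is the coefficient of \<open>s ^ i\<close> in the quotient
      of that difference by \<open>s - s0\<close>.\<close>
    define z where "z i = (\<Sum>j\<le>Suc n. if i < j then \<kappa> (s0 ^ (j - Suc i)) * y j else 0)" for i
    have zI: "(\<Sum>i\<le>n. \<kappa> (s ^ i) * z i) \<in> I" if s: "s \<in> S - {s0}" for s
    proof -
      have "(\<Sum>j\<le>Suc n. \<kappa> (s ^ j) * y j) - (\<Sum>j\<le>Suc n. \<kappa> (s0 ^ j) * y j)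
          = (\<Sum>j\<le>Suc n. \<kappa> (s ^ j - s0 ^ j) * y j)"
        by (simp add: sum_subtractf[symmetric] scalar_diff left_diff_distrib del: sum.atMost_Suc)
      also have "\<dots> = (\<Sum>j\<le>Suc n. \<Sum>i\<le>n. if i < j then \<kappa> (s - s0) * (\<kappa> (s ^ i) * (\<kappa> (s0 ^ (j - Suc i)) * y j)) else 0)"
      proof (rule sum.cong[OF refl])
        fix j assume "j \<in> {..Suc n}"
        have "\<kappa> (sum h A) = (\<Sum>i\<in>A. \<kappa> (h i))" for h :: "nat \<Rightarrow> 'k" and A
          by (induction A rule: infinite_finite_induct) (auto simp: scalar_add)
        then have "\<kappa> (s ^ j - s0 ^ j) * y j
            = (\<Sum>i<j. \<kappa> (s - s0) * (\<kappa> (s ^ i) * (\<kappa> (s0 ^ (j - Suc i)) * y j)))"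
          unfolding power_diff_sumr2
          by (simp add: scalar_mult sum_distrib_left sum_distrib_right ac_simps)
        also have "\<dots> = (\<Sum>i\<le>n. if i < j then \<kappa> (s - s0) * (\<kappa> (s ^ i) * (\<kappa> (s0 ^ (j - Suc i)) * y j)) else 0)"
          by (rule sum.mono_neutral_cong_left) (use \<open>j \<in> {..Suc n}\<close> in auto)
        finally show "\<kappa> (s ^ j - s0 ^ j) * y j = \<dots>" .
      qed
      also have "\<dots> = (\<Sum>i\<le>n. \<Sum>j\<le>Suc n. if i < j then \<kappa> (s - s0) * (\<kappa> (s ^ i) * (\<kappa> (s0 ^ (j - Suc i)) * y j)) else 0)"
        by (rule sum.swap)
      also have "\<dots> = \<kappa> (s - s0) * (\<Sum>i\<le>n. \<kappa> (s ^ i) * z i)"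
        unfolding z_def sum_distrib_left by (intro sum.cong refl) auto
      finally have eq: "(\<Sum>j\<le>Suc n. \<kappa> (s ^ j) * y j) - (\<Sum>j\<le>Suc n. \<kappa> (s0 ^ j) * y j)
        = \<kappa> (s - s0) * (\<Sum>i\<le>n. \<kappa> (s ^ i) * z i)" .
      have "(\<Sum>j\<le>Suc n. \<kappa> (s ^ j) * y j) - (\<Sum>j\<le>Suc n. \<kappa> (s0 ^ j) * y j) \<in> I"
        by (rule lin_subspace_diff[OF I g g]) (use s s0 in auto)
      then have "\<kappa> (inverse (s - s0)) * (\<kappa> (s - s0) * (\<Sum>i\<le>n. \<kappa> (s ^ i) * z i)) \<in> I"
        unfolding eq by (rule sm)
      then show ?thesis using s by (simp add: mult.assoc[symmetric] scalar_mult[symmetric])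
    qed
    have "z n \<in> I" by (rule Suc.IH[OF inf zI]) auto
    moreover have "z n = y (Suc n)" by (simp add: z_def)
    ultimately show ?thesis by simp
  qed
  have "(\<Sum>j\<le>n. \<kappa> (s ^ j) * y j) \<in> I" if "s \<in> S" for s
    using lin_subspace_diff[OF I g[OF that] sm[OF top, of "s ^ Suc n"]] by simp
  from Suc.IH[OF Suc.prems(1) this] show ?case using top Suc.prems(3) by (cases "j = Suc n") auto
qed

text \<open>If \<open>v\<close> and \<open>w\<close> invert \<open>u\<close> modulo the two ideals,
  the product of the two errors lies in \<open>I\<close>, because \<open>a * b\<close> does.\<close>

lemma unit_mod_combine:
  assumes I: "ideal_in R I" and ab: "a \<in> R" "b \<in> R" "a * b \<in> I" and u: "u \<in> R"
    and ua: "unit_mod (adj I [a]) u" and ub: "unit_mod (adj I [b]) u"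
  shows "unit_mod I u"
proof -
  interpret ideal_in R I by (rule I)
  obtain v i r where v: "v \<in> R" "u * v - 1 = i + r * a" "i \<in> I" "r \<in> R"
    using ua by (auto simp: unit_mod_def)
  obtain w j s where w: "w \<in> R" "u * w - 1 = j + s * b" "j \<in> I" "s \<in> R"
    using ub by (auto simp: unit_mod_def)
  have R: "s * b \<in> R" "r * a \<in> R" "r * s \<in> R" "j \<in> R" using v w ab I_memR by (auto intro: mult_mem)
  have "(i + r * a) * (j + s * b) = i * (j + s * b) + (r * a) * j + (r * s) * (a * b)"
    by (simp add: algebra_simps)
  also have "\<dots> \<in> I"
    by (rule I_add[OF I_add[OF I_mult2[OF _ v(3)] I_mult[OF _ w(3)]] I_mult[OF _ ab(3)]])
      (use R in \<open>auto intro: add_mem\<close>)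
  finally have "(u * v - 1) * (u * w - 1) \<in> I" unfolding v(2) w(2) .
  then have "u * (v + w - u * v * w) - 1 \<in> I"
    using I_uminus[of "(u * v - 1) * (u * w - 1)"] by (simp add: algebra_simps)
  moreover have "v + w - u * v * w \<in> R" using u v w by (intro diff_mem add_mem mult_mem)
  ultimately show ?thesis unfolding unit_mod_def by blast
qed

text \<open>The ideals \<open>P + (x ^ k)\<close> become stationary, so
  \<open>x ^ N * (x * r - 1) \<in> P\<close> for some \<open>r\<close>, and primality cancels the
  power.\<close>

lemma prime_finite_codim_unit:
  assumes P: "prime_in P" and fc: "finite_codim P" and x: "x \<in> R" "x \<notin> P"
  shows "unit_mod P x"
proof -
  interpret ideal_in R P using P by (simp add: prime_in_def)
  have PI: "ideal_in R P" by (rule ideal_in_axioms)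
  define U where "U k = adj P [x ^ k]" for k
  have U: "ideal_in R (U k)" for k
    unfolding U_def by (rule adj_ideal[OF PI]) (use x in \<open>auto intro: power_mem\<close>)
  have "\<exists>N. \<forall>k\<ge>N. U k = U N"
  proof (rule finite_codim_chain[OF fc])
    show "lin_subspace (U k)" for k by (rule ideal_lin_subspace[OF U])
    show "P \<subseteq> U k" for k
      unfolding U_def using adj_superset[OF PI, of "[x ^ k]"] x by (auto intro: power_mem)
    show "U k \<subseteq> R" for k using U ideal_in.I_sub by blast
    show "U (Suc k) \<subseteq> U k" for k
    proof
      fix u assume "u \<in> U (Suc k)"
      then obtain i r where u: "u = i + r * x ^ Suc k" "i \<in> P" "r \<in> R" by (auto simp: U_def)
      have "i + (r * x) * x ^ k \<in> U k"
        unfolding U_def by (rule adj_ConsI) (use u x in \<open>auto intro: mult_mem\<close>)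
      then show "u \<in> U k" by (simp add: u(1) ac_simps)
    qed
  qed
  then obtain N where N: "U (Suc N) = U N" using le_Suc_eq by blast
  have "0 + 1 * x ^ N \<in> U N" unfolding U_def by (rule adj_ConsI) auto
  then have "x ^ N \<in> U (Suc N)" using N by simp
  then obtain i r where r: "x ^ N = i + r * x ^ Suc N" "i \<in> P" "r \<in> R"
    by (auto simp: U_def)
  have "x ^ N * (x * r - 1) = - i" using r(1) by (simp add: algebra_simps)
  then have mem: "x ^ N * (x * r - 1) \<in> P" using I_uminus[OF r(2)] by simp
  have "x ^ k \<notin> P" for k
  proof (induction k)
    case (Suc k)
    then show ?case using P x power_mem[OF x(1), of k] by (auto simp: prime_in_def)
  qed (use P in \<open>simp add: prime_in_def\<close>)
  moreover have "x ^ N \<in> R" "x * r - 1 \<in> R" using x r by (auto intro!: diff_mem mult_mem power_mem)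
  ultimately have "x * r - 1 \<in> P" using P mem by (auto simp: prime_in_def)
  then show ?thesis using r(3) unfolding unit_mod_def by blast
qed

text \<open>The decreasing measure for the next induction: an element of \<open>J\<close> outside
  \<open>I\<close> provides a nontrivial relation among \<open>W\<close> modulo
  \<open>J\<close>.\<close>

lemma spanning_shrink:
  assumes I: "ideal_in R I" and W: "finite W" "W \<subseteq> R" "\<forall>r\<in>R. \<exists>f. r - lin_comb W f \<in> I"
    and J: "ideal_in R J" "I \<subseteq> J" "x \<in> J" "x \<notin> I"
  shows "\<exists>V\<subset>W. \<forall>r\<in>R. \<exists>f. r - lin_comb V f \<in> J"
proof -
  have sJ: "\<forall>r\<in>R. \<exists>f. r - lin_comb W f \<in> J" using W(3) J(2) by blast
  obtain B where B: "B \<subseteq> W" "basis_mod J R B"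
    using basis_mod_exists[OF ideal_lin_subspace[OF J(1)] W(1,2) sJ] by blast
  have "B \<noteq> W"
  proof
    assume BW: "B = W"
    have "x \<in> R" using J ideal_in.I_sub by blast
    then obtain f where f: "x - lin_comb W f \<in> I" using W(3) by blast
    have "x - (x - lin_comb W f) \<in> J"
      using ideal_in.I_diff[OF J(1) J(3)] f J(2) by blast
    then have "\<forall>b\<in>W. f b = 0" using B(2) BW by (simp add: basis_mod_def)
    then have "lin_comb W f = 0" by (simp add: lin_comb_def)
    then show False using f J(4) by simp
  qed
  then have "B \<subset> W" using B(1) by blast
  moreover have "\<forall>r\<in>R. \<exists>f. r - lin_comb B f \<in> J" using B(2) by (simp add: basis_mod_def)
  ultimately show ?thesis by (intro exI conjI)
qed

text \<open>
  Induction on the codimension: a non-prime ideal \<open>I\<close> with \<open>a * b \<in> I\<close> is replaced by the larger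
  ideals \<open>I + (a)\<close> and \<open>I + (b)\<close>; modulo a prime ideal of finite codimension all nonzero elements
  are units.
\<close>

theorem finite_nonunits:
  assumes "ideal_in R I" "finite_codim I" and y: "\<And>j. y j \<in> R" "m \<le> n" "y m = 1"
  shows "finite {s. \<not> unit_mod I (\<Sum>j\<le>n. \<kappa> (s ^ j) * y j)}"
proof -
  define g where "g s = (\<Sum>j\<le>n. \<kappa> (s ^ j) * y j)" for s
  have gR: "g s \<in> R" for s unfolding g_def by (intro sum_mem mult_mem scalar_mem y(1))
  obtain W where "finite W" "W \<subseteq> R" "\<forall>r\<in>R. \<exists>f. r - lin_comb W f \<in> I"
    using assms(2) unfolding finite_codim_def by blast
  then have "finite {s. \<not> unit_mod I (g s)}" using assms(1)
  proof (induction W arbitrary: I rule: finite_psubset_induct)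
    case (psubset W)
    interpret ideal_in R I by (rule psubset.prems)
    have fc: "finite_codim I"
      unfolding finite_codim_def by (intro exI conjI) (rule psubset.hyps, rule psubset.prems, rule psubset.prems)
    consider "1 \<in> I" | "prime_in I"
      | "\<exists>a b. 1 \<notin> I \<and> a \<in> R \<and> b \<in> R \<and> a * b \<in> I \<and> a \<notin> I \<and> b \<notin> I"
      using psubset.prems(3) unfolding prime_in_def by blast
    then show ?case
    proof cases
      case 1
      have "unit_mod I (g s)" for s
        unfolding unit_mod_def using I_uminus[OF 1] by (intro bexI[of _ 0]) simp_all
      then show ?thesis by simp
    next
      case 2
      \<comment> \<open>Members lying in \<open>I\<close> for infinitely many \<open>s\<close> would
        force \<open>y m = 1\<close> into \<open>I\<close>; every other member is a unit modulo the
        prime \<open>I\<close>.\<close>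
      have "finite {s. g s \<in> I}"
      proof (rule ccontr)
        assume inf: "infinite {s. g s \<in> I}"
        have "y m \<in> I"
          by (rule vandermonde_mod[OF ideal_lin_subspace[OF psubset.prems(3)] inf _ y(2)]) (simp add: g_def)
        then show False using 2 y(3) by (simp add: prime_in_def)
      qed
      then show ?thesis
        by (rule rev_finite_subset) (use prime_finite_codim_unit[OF 2 fc gR] in auto)
    next
      case 3
      then obtain a b where ab: "a \<in> R" "b \<in> R" "a * b \<in> I" "a \<notin> I" "b \<notin> I" by blast
      have IJ: "ideal_in R (adj I [x])" "I \<union> {x} \<subseteq> adj I [x]" if "x \<in> R" for x
        using adj_ideal[OF psubset.prems(3), of "[x]"] adj_superset[OF psubset.prems(3), of "[x]"] that
        by simp_all
      have fin: "finite {s. \<not> unit_mod (adj I [x]) (g s)}" if x: "x \<in> R" "x \<notin> I" for x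
      proof -
        have "\<exists>V\<subset>W. \<forall>r\<in>R. \<exists>f. r - lin_comb V f \<in> adj I [x]"
          by (rule spanning_shrink[OF psubset.prems(3) psubset.hyps psubset.prems(1,2) IJ(1)[OF x(1)] _ _ x(2)])
            (use IJ(2)[OF x(1)] in auto)
        then obtain V where V: "V \<subset> W" "\<forall>r\<in>R. \<exists>f. r - lin_comb V f \<in> adj I [x]"
          by (elim exE conjE)
        show ?thesis
          by (rule psubset.IH[OF V(1) _ V(2) IJ(1)[OF x(1)]]) (use V(1) psubset.prems(1) in auto)
      qed
      have "{s. \<not> unit_mod I (g s)} \<subseteq> {s. \<not> unit_mod (adj I [a]) (g s)} \<union> {s. \<not> unit_mod (adj I [b]) (g s)}"
        using unit_mod_combine[OF psubset.prems(3) ab(1-3) gR] by blast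
      then show ?thesis by (rule finite_subset) (rule finite_UnI fin ab)+
    qed
  qed
  then show ?thesis by (simp add: g_def)
qed

end

section \<open>Multigraded polynomial rings\<close>

abbreviation single :: "'a \<Rightarrow> 'b \<Rightarrow> 'a \<Rightarrow>\<^sub>0 'b::zero" where "single \<equiv> Poly_Mapping.single"

abbreviation lookup :: "('a \<Rightarrow>\<^sub>0 'b) \<Rightarrow> 'a \<Rightarrow> 'b::zero" where "lookup \<equiv> Poly_Mapping.lookup"

abbreviation keys :: "('a \<Rightarrow>\<^sub>0 'b::zero) \<Rightarrow> 'a set" where "keys \<equiv> Poly_Mapping.keys"

lemma poly_mapping_expand:
  assumes "finite A" "keys p \<subseteq> A"
  shows "p = (\<Sum>m\<in>A. single m (lookup p m))"
proof (rule poly_mapping_eqI)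
  fix k
  have "lookup (\<Sum>m\<in>A. single m (lookup p m)) k
      = (\<Sum>m\<in>A. if m = k then lookup p k else 0)"
    unfolding lookup_sum by (rule sum.cong) (auto simp: lookup_single)
  then show "lookup p k =
      lookup (\<Sum>m\<in>A. single m (lookup p m)) k"
    using assms by (auto simp: in_keys_iff)
qed

lemma single_lookup_mult:
  "single m (c :: 'k::comm_ring_1) = single 0 c * single m 1"
  by (simp add: mult_single)

lemma lookup_map_int [simp]: "lookup (Poly_Mapping.map int m) v = int (lookup m v)"
  by (simp add: Poly_Mapping.map.rep_eq "when_def")

lemma keys_map_int [simp]: "keys (Poly_Mapping.map int m) = keys m"
  by (auto simp: in_keys_iff)

lemma map_int_add: "Poly_Mapping.map int (m + m') = Poly_Mapping.map int m + Poly_Mapping.map int m'"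
  by (rule poly_mapping_eqI) (simp add: lookup_add)

lemma map_int_inject: "Poly_Mapping.map int m = Poly_Mapping.map int m' \<longleftrightarrow> m = m'"
  by (metis lookup_map_int of_nat_eq_iff poly_mapping_eqI)

lemma axis_add: "axis i (a + b) = axis i a + (axis i b :: int ^ 'q)"
  by (simp add: axis_def vec_eq_iff)

lemma multidegree_superset:
  "finite A \<Longrightarrow> keys m \<subseteq> A \<Longrightarrow>
    multidegree m = (\<Sum>v\<in>A. axis (fst v) (lookup m v))"
  unfolding multidegree_def
  by (rule sum.mono_neutral_left) (auto simp: in_keys_iff axis_def vec_eq_iff)

lemma multidegree_add: "multidegree (m + m') = multidegree m + multidegree m'"
proof -
  let ?A = "keys m \<union> keys m'"
  have "multidegree (m + m') = (\<Sum>v\<in>?A. axis (fst v) (lookup (m + m') v))"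
    by (rule multidegree_superset) (use Poly_Mapping.keys_add[of m m'] in auto)
  then show ?thesis
    by (simp add: multidegree_superset[of ?A m] multidegree_superset[of ?A m'] lookup_add axis_add sum.distrib)
qed

lemma multidegree_zero [simp]: "multidegree 0 = 0"
  by (simp add: multidegree_def)

lemma multidegree_uminus: "multidegree (- m) = - multidegree m"
  using multidegree_add[of m "- m"] by (simp add: eq_neg_iff_add_eq_0 add.commute)

lemma multidegree_diff: "multidegree (m - m') = multidegree m - multidegree m'"
  using multidegree_add[of m "- m'"] by (simp add: multidegree_uminus)

lemma multidegree_single [simp]: "multidegree (single v a) = axis (fst v) a"
  using multidegree_superset[of "{v}" "single v a"] by simp

lemma multidegree_sum: "multidegree (\<Sum>i\<in>A. m i) = (\<Sum>i\<in>A. multidegree (m i))"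
  by (induction A rule: infinite_finite_induct) (auto simp: multidegree_add)

lemma multidegree_nth:
  "multidegree m $ i = (\<Sum>v\<in>keys m. if fst v = i then lookup m v else 0)"
  by (auto simp: multidegree_def axis_def intro: sum.cong)

definition mdeg :: "('q::finite \<times> nat \<Rightarrow>\<^sub>0 nat) \<Rightarrow> int ^ 'q" where
  "mdeg m = multidegree (Poly_Mapping.map int m)"

lemma mdeg_add: "mdeg (m + m') = mdeg m + mdeg m'"
  by (simp add: mdeg_def map_int_add multidegree_add)

lemma mdeg_zero [simp]: "mdeg 0 = 0"
  using mdeg_add[of 0 0] by simp

lemma map_int_single: "Poly_Mapping.map int (single v a) = single v (int a)"
  by (rule poly_mapping_eqI) (simp add: lookup_single "when_def")

lemma mdeg_single [simp]: "mdeg (single v a) = axis (fst v) (int a)"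
  by (simp add: mdeg_def map_int_single)

lemma mdeg_nth: "mdeg m $ i = (\<Sum>v\<in>keys m. if fst v = i then int (lookup m v) else 0)"
  by (auto simp: mdeg_def multidegree_nth intro: sum.cong)

lemma lookup_le_mdeg: "int (lookup m v) \<le> mdeg m $ fst v"
proof (cases "v \<in> keys m")
  case True
  have "(if fst v = fst v then int (lookup m v) else 0)
      \<le> (\<Sum>w\<in>keys m. if fst w = fst v then int (lookup m w) else 0)"
    by (rule member_le_sum[where f = "\<lambda>w. if fst w = fst v then int (lookup m w) else 0"])
      (use True in auto)
  then show ?thesis by (simp add: mdeg_nth)
next
  case False
  then show ?thesis by (auto simp: mdeg_nth in_keys_iff intro: sum_nonneg)
qed

definition pol :: "('q \<times> nat) set \<Rightarrow> ('q, 'k::field) polynomial set" where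
  "pol V = {p. \<forall>m\<in>keys p. keys m \<subseteq> V}"

lemma poly_ring_eq: "poly_ring V = ring_on (pol V)"
  by (simp add: poly_ring_def pol_def)

lemma scalars_poly_mapping:
  assumes "comm_subring R" "\<And>c. single 0 c \<in> R"
  shows "scalars R (single 0 :: 'k::field \<Rightarrow> ('m::comm_monoid_add \<Rightarrow>\<^sub>0 'k))"
proof -
  interpret comm_subring R by fact
  show ?thesis by unfold_locales (use assms in \<open>auto simp: single_add mult_single\<close>)
qed

lemma comm_subring_pol: "comm_subring (pol V :: ('q, 'k::field) polynomial set)"
proof
  show "0 \<in> pol V" "1 \<in> pol V" by (auto simp: pol_def)
next
  fix p q :: "('q, 'k) polynomial" assume pq: "p \<in> pol V" "q \<in> pol V"
  show "p + q \<in> pol V"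
    using pq Poly_Mapping.keys_add[of p q] unfolding pol_def by blast
  show "- p \<in> pol V" using pq by (simp add: pol_def keys_def)
  show "p * q \<in> pol V"
    unfolding pol_def
  proof (intro CollectI ballI)
    fix m assume "m \<in> keys (p * q)"
    then obtain a b where "m = a + b" "a \<in> keys p" "b \<in> keys q"
      using keys_mult[of p q] by blast
    then show "keys m \<subseteq> V" using pq Poly_Mapping.keys_add[of a b] unfolding pol_def by blast
  qed
qed

lemma single_in_pol: "keys m \<subseteq> V \<Longrightarrow> single m c \<in> pol V"
  by (auto simp: pol_def split: if_splits)

interpretation pol: scalars "pol V :: ('q, 'k::field) polynomial set" "single 0" for V
  by (rule scalars_poly_mapping[OF comm_subring_pol single_in_pol]) simp

lemma pol_induct [consumes 1, case_names zero add]: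
  assumes "p \<in> pol V" "P 0"
    and "\<And>p m c. p \<in> pol V \<Longrightarrow> P p \<Longrightarrow> keys m \<subseteq> V \<Longrightarrow> P (p + single m c)"
  shows "P p"
proof -
  have "(\<Sum>m\<in>A. single m (lookup p m)) \<in> pol V
      \<and> P (\<Sum>m\<in>A. single m (lookup p m))" if "A \<subseteq> keys p" "finite A" for A
    using that(2,1)
  proof (induction A)
    case (insert m A)
    then have m: "keys m \<subseteq> V" using assms(1) by (auto simp: pol_def)
    let ?s = "\<Sum>m\<in>A. single m (lookup p m)"
    have s: "?s \<in> pol V" "P ?s" using insert by auto
    have "?s + single m (lookup p m) \<in> pol V"
      by (rule pol.add_mem[OF s(1) single_in_pol[OF m]])
    moreover have "P (?s + single m (lookup p m))" by (rule assms(3)[OF s m])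
    ultimately show ?case using insert.hyps by (simp add: add.commute)
  qed (use assms in simp)
  from this[OF order.refl finite_keys] poly_mapping_expand[of "keys p" p]
  show ?thesis by simp
qed

section \<open>Homogeneous components\<close>

definition hcomp :: "int ^ 'q::finite \<Rightarrow> ('q, 'k::field) polynomial \<Rightarrow> ('q, 'k) polynomial" where
  "hcomp a p = (\<Sum>m | m \<in> keys p \<and> mdeg m = a. single m (lookup p m))"

lemma lookup_hcomp: "lookup (hcomp a p) m = (if mdeg m = a then lookup p m else 0)"
proof -
  let ?A = "{m \<in> keys p. mdeg m = a}"
  have "lookup (hcomp a p) m = (\<Sum>k\<in>?A. if k = m then lookup p m else 0)"
    unfolding hcomp_def lookup_sum by (rule sum.cong) (auto simp: lookup_single)
  then show ?thesis by (auto simp: in_keys_iff)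
qed

lemma hcomp_zero [simp]: "hcomp a 0 = 0"
  by (rule poly_mapping_eqI) (simp add: lookup_hcomp)

lemma hcomp_add: "hcomp a (p + q) = hcomp a p + hcomp a q"
  by (rule poly_mapping_eqI) (simp add: lookup_hcomp lookup_add)

lemma hcomp_single: "hcomp a (single m c) = (if mdeg m = a then single m c else 0)"
  by (rule poly_mapping_eqI) (auto simp: lookup_hcomp lookup_single "when_def")

lemma keys_hcomp: "keys (hcomp a p) = {m \<in> keys p. mdeg m = a}"
  by (auto simp: in_keys_iff lookup_hcomp split: if_splits)

lemma hcomp_mem: "p \<in> pol V \<Longrightarrow> hcomp a p \<in> pol V"
  by (auto simp: pol_def keys_hcomp)

lemma component_eq: "component V a = {p \<in> pol V. \<forall>m\<in>keys p. mdeg m = a}"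
  by (simp add: component_def poly_ring_eq mdeg_def)

lemma hcomp_component: "p \<in> pol V \<Longrightarrow> hcomp a p \<in> component V a"
  by (auto simp: component_eq hcomp_mem keys_hcomp)

lemma hcomp_id: "p \<in> component V a \<Longrightarrow> hcomp a p = p"
  by (rule poly_mapping_eqI) (auto simp: lookup_hcomp component_eq in_keys_iff)

lemma hcomp_other: "p \<in> component V a \<Longrightarrow> b \<noteq> a \<Longrightarrow> hcomp b p = 0"
  by (rule poly_mapping_eqI) (auto simp: lookup_hcomp component_eq in_keys_iff)

lemma hcomp_decomp:
  "p = (\<Sum>a\<in>mdeg ` keys p. hcomp a p)"
  by (rule poly_mapping_eqI) (auto simp: lookup_sum lookup_hcomp in_keys_iff)

lemma lin_subspace_component: "pol.lin_subspace (component V a)"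
  unfolding pol.lin_subspace_def
proof (intro conjI ballI allI)
  show "0 \<in> component V a" by (auto simp: component_eq)
  show "u + v \<in> component V a" if "u \<in> component V a" "v \<in> component V a" for u v
    using that Poly_Mapping.keys_add[of u v] pol.add_mem unfolding component_eq by blast
  show "single 0 c * u \<in> component V a" if "u \<in> component V a" for c u
    using that keys_mult[of "single 0 c" u] pol.mult_mem[OF pol.scalar_mem]
    by (fastforce simp: component_eq split: if_splits)
qed

lemma component_mult:
  assumes "p \<in> component V a" "q \<in> component V b"
  shows "p * q \<in> component V (a + b)"
proof -
  have "mdeg m = a + b" if m: "m \<in> keys (p * q)" for m
  proof -
    obtain u v where "m = u + v" "u \<in> keys p" "v \<in> keys q"
      using m keys_mult[of p q] by blast
    then show ?thesis using assms by (auto simp: component_eq mdeg_add)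
  qed
  then show ?thesis using assms pol.mult_mem by (auto simp: component_eq)
qed

lemma single_component: "keys m \<subseteq> V \<Longrightarrow> single m c \<in> component V (mdeg m)"
  by (auto simp: component_eq single_in_pol split: if_splits)

lemma hcomp_mult:
  assumes f: "f \<in> component V d" and p: "p \<in> pol V"
  shows "hcomp a (f * p) = f * hcomp (a - d) p"
  using p
proof (induction rule: pol_induct)
  case (add p m c)
  have "f * single m c \<in> component V (d + mdeg m)"
    using component_mult[OF f single_component[OF add(2)]] .
  then have "hcomp a (f * single m c) = f * hcomp (a - d) (single m c)"
    using hcomp_id[of "f * single m c" V a] hcomp_other[of "f * single m c" V "d + mdeg m" a]
    by (cases "a = d + mdeg m") (auto simp: hcomp_single)
  then show ?case using add by (simp add: distrib_left hcomp_add)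
qed simp

subsection \<open>Homogeneous ideals and their Hilbert functions\<close>

text \<open>From generators to components: the polynomials all of whose components lie in
  \<open>I\<close> form an ideal, by \<open>hcomp_mult\<close> for monomials, and this ideal
  contains the homogeneous generators.\<close>

lemma homogeneous_ideal_iff:
  fixes I :: "('q::finite, 'k::field) polynomial set"
  shows "homogeneous_ideal V I \<longleftrightarrow> ideal_in (pol V) I \<and> (\<forall>p\<in>I. \<forall>a. hcomp a p \<in> I)"
proof
  assume h: "homogeneous_ideal V I"
  then have I: "ideal_in (pol V) I" and gen: "I = Idl\<^bsub>ring_on (pol V)\<^esub> (I \<inter> (\<Union>a. component V a))"
    by (auto simp: homogeneous_ideal_def poly_ring_eq pol.ideal_ring_on_iff)
  interpret ideal_in "pol V" I by (rule I)
  define I' where "I' = {p \<in> pol V. \<forall>a. hcomp a p \<in> I}"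
  have I': "ideal_in (pol V) I'"
  proof
    fix r x :: "('q, 'k) polynomial" assume r: "r \<in> pol V" and x: "x \<in> I'"
    have "\<forall>a. hcomp a (r * x) \<in> I" using r
    proof (induction rule: pol_induct)
      case (add p m c)
      have "hcomp a (single m c * x) \<in> I" for a
        using hcomp_mult[OF single_component[OF add(2)], of x a c] x
          I_mult[OF single_in_pol[OF add(2)], of "hcomp (a - mdeg m) x" c] by (simp add: I'_def)
      then show ?case using add by (auto simp: distrib_right hcomp_add intro: I_add)
    qed simp
    then show "r * x \<in> I'" using r x by (auto simp: I'_def intro: pol.mult_mem)
  qed (auto simp: I'_def hcomp_add intro: I_add pol.add_mem)
  have "I \<inter> (\<Union>a. component V a) \<subseteq> I'"
  proof
    fix p assume "p \<in> I \<inter> (\<Union>a. component V a)"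
    then obtain a where p: "p \<in> I" "p \<in> component V a" by blast
    have "hcomp b p \<in> I" for b using p hcomp_id[OF p(2)] hcomp_other[OF p(2)] by (cases "b = a") auto
    then show "p \<in> I'" using p I_memR by (auto simp: I'_def)
  qed
  then have "I \<subseteq> I'" using pol.Idl_minimal[OF I'] gen by blast
  then show "ideal_in (pol V) I \<and> (\<forall>p\<in>I. \<forall>a. hcomp a p \<in> I)" using I by (auto simp: I'_def)
next
  assume h: "ideal_in (pol V) I \<and> (\<forall>p\<in>I. \<forall>a. hcomp a p \<in> I)"
  then interpret ideal_in "pol V" I by simp
  let ?G = "I \<inter> (\<Union>a. component V a)"
  have "I = Idl\<^bsub>ring_on (pol V)\<^esub> ?G"
  proof (rule pol.Idl_eqI[symmetric])
    fix I' assume I': "ideal_in (pol V) I'" "?G \<subseteq> I'"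
    show "I \<subseteq> I'"
    proof
      fix p assume p: "p \<in> I"
      have "hcomp a p \<in> I'" for a using h p I'(2) hcomp_component[OF I_memR[OF p]] by blast
      then show "p \<in> I'" using ideal_in.I_sum[OF I'(1)] hcomp_decomp[of p] by metis
    qed
  qed (use h in auto)
  then show "homogeneous_ideal V I"
    using h by (simp add: homogeneous_ideal_def poly_ring_eq pol.ideal_ring_on_iff)
qed

lemma finite_monomials:
  assumes "finite V"
  shows "finite {m. keys m \<subseteq> V \<and> mdeg m = (a :: int ^ 'q::finite)}"
proof -
  define N where "N = Max (insert 0 (range (\<lambda>i. nat (a $ i))))"
  have fin: "finite {f. \<forall>x. (x \<in> V \<longrightarrow> f x \<in> {..N}) \<and> (x \<notin> V \<longrightarrow> f x = 0)}"
    by (rule finite_set_of_finite_funs) (use assms in auto)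
  have "lookup ` {m. keys m \<subseteq> V \<and> mdeg m = a}
      \<subseteq> {f. \<forall>x. (x \<in> V \<longrightarrow> f x \<in> {..N}) \<and> (x \<notin> V \<longrightarrow> f x = 0)}"
  proof (intro image_subsetI CollectI allI conjI impI)
    fix m :: "'q \<times> nat \<Rightarrow>\<^sub>0 nat" and x
    assume m: "m \<in> {m. keys m \<subseteq> V \<and> mdeg m = a}"
    show "lookup m x = 0" if "x \<notin> V" using m that by (auto simp: in_keys_iff)
    have "int (lookup m x) \<le> a $ fst x" using lookup_le_mdeg[of m x] m by simp
    moreover have "nat (a $ fst x) \<le> N" unfolding N_def by (intro Max_ge) auto
    ultimately show "lookup m x \<in> {..N}" by simp
  qed
  then have "finite (lookup ` {m. keys m \<subseteq> V \<and> mdeg m = a})"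
    using fin by (rule finite_subset)
  then show ?thesis by (rule finite_imageD) (simp add: inj_on_def poly_mapping_eqI)
qed

lemma component_basis:
  assumes V: "finite V" and I: "ideal_in (pol V) (I :: ('q::finite, 'k::field) polynomial set)"
  shows "\<exists>B. pol.basis_mod I (component V a) B"
proof -
  interpret ideal_in "pol V" I by (rule I)
  let ?M = "{m. keys m \<subseteq> V \<and> mdeg m = a}"
  define W :: "('q, 'k) polynomial set" where "W = (\<lambda>m. single m 1) ` ?M"
  have inj: "inj_on (\<lambda>m. single m (1::'k)) ?M"
    by (rule inj_onI) (metis lookup_single_eq lookup_single_not_eq zero_neq_one)
  have "\<exists>f. u - pol.lin_comb W f \<in> I"
    if u: "u \<in> component V a" for u :: "('q, 'k) polynomial"
  proof -
    define f :: "('q, 'k) polynomial \<Rightarrow> 'k" where "f w = lookup u (inv_into ?M (\<lambda>m. single m 1) w)" for w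
    have "pol.lin_comb W f = (\<Sum>m\<in>?M. single 0 (f (single m 1)) * single m 1)"
      unfolding pol.lin_comb_def W_def by (simp add: sum.reindex[OF inj])
    also have "\<dots> = (\<Sum>m\<in>?M. single m (lookup u m))"
      unfolding f_def by (rule sum.cong[OF refl]) (simp add: inv_into_f_f[OF inj] single_lookup_mult[symmetric])
    also have "\<dots> = u"
      by (rule poly_mapping_expand[symmetric]) (use u finite_monomials[OF V] in \<open>auto simp: component_eq pol_def\<close>)
    finally show ?thesis by (intro exI[of _ f]) simp
  qed
  moreover have "finite W" unfolding W_def using finite_monomials[OF V] by simp
  moreover have "W \<subseteq> component V a"
  proof
    fix w assume "w \<in> W"
    then obtain m where "w = single m 1" "keys m \<subseteq> V" "mdeg m = a"
      by (auto simp: W_def)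
    then show "w \<in> component V a" using single_component[of m V 1] by simp
  qed
  ultimately have "\<exists>B\<subseteq>W. pol.basis_mod I (component V a) B"
    by (intro pol.basis_mod_exists[OF pol.ideal_lin_subspace[OF I]]) simp_all
  then show ?thesis by blast
qed

lemma hilbert_eq_card:
  assumes "ideal_in (pol V) I" "I \<noteq> pol V" "pol.basis_mod I (component V a) B"
  shows "hilbert V I a = int (card B)"
proof -
  have "component V a \<subseteq> pol V" by (auto simp: component_eq)
  from pol.quotient_dim[OF assms(1,2) this lin_subspace_component assms(3)]
  show ?thesis by (simp add: hilbert_def constants_def poly_ring_eq Let_def)
qed

text \<open>This is \<open>basis_mod_nzd\<close> in degree \<open>a\<close>, where multiplication by
  \<open>l\<close> starts from degree \<open>a - axis i 1\<close>.\<close>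

lemma hilbert_nzd:
  assumes V: "finite V" and I: "homogeneous_ideal V I"
    and l: "l \<in> component V (axis i 1)"
    and nzd: "\<And>g. g \<in> pol V \<Longrightarrow> l * g \<in> I \<Longrightarrow> g \<in> I"
    and proper: "pol.adj V I [l] \<noteq> pol V"
  shows "hilbert V (pol.adj V I [l]) a = hilbert V I a - hilbert V I (a - axis i 1)"
proof -
  have I': "ideal_in (pol V) I" and hI: "\<And>p b. p \<in> I \<Longrightarrow> hcomp b p \<in> I"
    using I by (auto simp: homogeneous_ideal_iff)
  have lV: "l \<in> pol V" using l by (simp add: component_eq)
  have A: "ideal_in (pol V) (pol.adj V I [l])" by (rule pol.adj_ideal[OF I']) (use lV in simp)
  have "I \<subseteq> pol.adj V I [l]" using pol.adj_superset[OF I', of "[l]"] lV by simp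
  then have pI: "I \<noteq> pol V" using proper ideal_in.I_sub[OF A] by auto
  obtain B where B: "pol.basis_mod (pol.adj V I [l]) (component V a) B"
    using component_basis[OF V A] by blast
  obtain C where C: "pol.basis_mod I (component V (a - axis i 1)) C"
    using component_basis[OF V I'] by blast
  have "\<exists>D. pol.basis_mod I (component V a) D \<and> card D = card B + card C"
  proof (rule pol.basis_mod_nzd[OF I' lV nzd lin_subspace_component _ lin_subspace_component _ _ _ B C])
    show "component V a \<subseteq> pol V" "component V (a - axis i 1) \<subseteq> pol V" by (auto simp: component_eq)
    show "l * u \<in> component V a" if "u \<in> component V (a - axis i 1)" for u
      using component_mult[OF l that] by simp
  next
    fix u assume u: "u \<in> component V a" "u \<in> pol.adj V I [l]"
    then obtain j r where r: "u = j + r * l" "j \<in> I" "r \<in> pol V" by (auto simp: pol.adj_single)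
    \<comment> \<open>Taking the component of degree \<open>a\<close> turns the multiplier
      \<open>r\<close> into a form of the right degree.\<close>
    have "u = hcomp a (j + l * r)" using hcomp_id[OF u(1)] r by (simp add: mult.commute)
    also have "\<dots> = hcomp a j + l * hcomp (a - axis i 1) r"
      by (simp add: hcomp_add hcomp_mult[OF l r(3)])
    finally have "u - l * hcomp (a - axis i 1) r \<in> I" using hI[OF r(2)] by simp
    then show "\<exists>r\<in>component V (a - axis i 1). u - l * r \<in> I" using hcomp_component[OF r(3)] by blast
  qed
  then obtain D where D: "pol.basis_mod I (component V a) D" "card D = card B + card C" by blast
  show ?thesis
    using hilbert_eq_card[OF I' pI D(1)] hilbert_eq_card[OF I' pI C] hilbert_eq_card[OF A proper B] D(2)
    by simp
qed

lemma homogeneous_adj: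
  assumes I: "homogeneous_ideal V I" and l: "\<And>l. l \<in> set ls \<Longrightarrow> \<exists>d. l \<in> component V d"
  shows "homogeneous_ideal V (pol.adj V I ls)"
proof -
  have I': "ideal_in (pol V) I" using I by (simp add: homogeneous_ideal_iff)
  have lV: "set ls \<subseteq> pol V" using l by (fastforce simp: component_eq)
  have A: "ideal_in (pol V) (pol.adj V I ls)" by (rule pol.adj_ideal[OF I' lV])
  moreover have "\<forall>p\<in>pol.adj V I ls. \<forall>a. hcomp a p \<in> pol.adj V I ls"
    using l
  proof (induction ls)
    case Nil
    then show ?case using I by (simp add: homogeneous_ideal_iff)
  next
    case (Cons l ls)
    obtain d where d: "l \<in> component V d" using Cons.prems by auto
    show ?case
    proof (intro ballI allI)
      fix p a assume "p \<in> pol.adj V I (l # ls)"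
      then obtain j r where r: "p = j + r * l" "j \<in> pol.adj V I ls" "r \<in> pol V" by auto
      have "hcomp a p = hcomp a j + hcomp (a - d) r * l"
        unfolding r(1) by (simp add: hcomp_add mult.commute[of r] hcomp_mult[OF d r(3)] mult.commute)
      moreover have "hcomp a j \<in> pol.adj V I ls" using Cons r(2) by simp
      ultimately show "hcomp a p \<in> pol.adj V I (l # ls)"
        using pol.adj_ConsI hcomp_mem[OF r(3)] by metis
    qed
  qed
  ultimately show ?thesis by (simp add: homogeneous_ideal_iff)
qed

lemma (in ideal_in) radical_ideal:
  "ideal_in R {x \<in> R. \<exists>t. x ^ t \<in> I}"
proof
  show "0 \<in> {x \<in> R. \<exists>t. x ^ t \<in> I}" by (auto intro!: exI[of _ 1])
next
  fix x y assume "x \<in> {x \<in> R. \<exists>t. x ^ t \<in> I}" "y \<in> {x \<in> R. \<exists>t. x ^ t \<in> I}"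
  then obtain s t where xy: "x \<in> R" "y \<in> R" "x ^ s \<in> I" "y ^ t \<in> I" by auto
  have nat_mem: "of_nat k \<in> R" for k by (induction k) (auto intro: add_mem)
  have "of_nat (n choose k) * x ^ k * y ^ (n - k) \<in> I" if n: "n = s + t" for n k
  proof (cases "k \<ge> s")
    case True
    then have xk: "x ^ k = x ^ (k - s) * x ^ s" by (simp add: power_add[symmetric])
    have "of_nat (n choose k) * x ^ k * y ^ (n - k) = (of_nat (n choose k) * x ^ (k - s) * y ^ (n - k)) * x ^ s"
      by (subst xk) (simp add: ac_simps)
    then show ?thesis using I_mult[OF _ xy(3)] nat_mem xy by (simp add: mult_mem power_mem)
  next
    case False
    then have "n - k = (n - k - t) + t" using n by simp
    then have "of_nat (n choose k) * x ^ k * y ^ (n - k) = (of_nat (n choose k) * x ^ k * y ^ (n - k - t)) * y ^ t"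
      by (metis mult.assoc power_add)
    then show ?thesis using I_mult[OF _ xy(4)] nat_mem xy by (simp add: mult_mem power_mem)
  qed
  then have "(x + y) ^ (s + t) \<in> I" unfolding binomial_ring by (intro I_sum) auto
  then show "x + y \<in> {x \<in> R. \<exists>t. x ^ t \<in> I}" using xy add_mem by auto
next
  fix r x assume "r \<in> R" "x \<in> {x \<in> R. \<exists>t. x ^ t \<in> I}"
  then show "r * x \<in> {x \<in> R. \<exists>t. x ^ t \<in> I}"
    by (auto intro!: mult_mem simp: power_mult_distrib intro: I_mult power_mem)
qed auto

subsection \<open>The difference operator\<close>

text \<open>Iterated differences in single directions. The head acts last, just as it is adjoined
  last in \<open>adj\<close>, so both recursions unfold together in
  \<open>hilbert_diff_list\<close>.\<close>

primrec diff_list :: "'q::finite list \<Rightarrow> (int ^ 'q \<Rightarrow> int) \<Rightarrow> int ^ 'q \<Rightarrow> int" where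
  "diff_list [] F a = F a"
| "diff_list (i # is) F a = diff_list is F a - diff_list is F (a - axis i 1)"

lemma diff_list_eq:
  "distinct is \<Longrightarrow>
    diff_list is F a = (\<Sum>T\<in>Pow (set is). (- 1) ^ card T * F (a - (\<Sum>i\<in>T. axis i 1)))"
proof (induction "is" arbitrary: a)
  case (Cons i "is")
  let ?h = "\<lambda>T. (- 1) ^ card T * F (a - (\<Sum>i\<in>T. axis i 1))"
  have inj: "inj_on (insert i) (Pow (set is))" using Cons.prems by (auto simp: inj_on_def)
  have disj: "Pow (set is) \<inter> insert i ` Pow (set is) = {}" using Cons.prems by auto
  have "sum ?h (Pow (set (i # is))) = sum ?h (Pow (set is)) + sum ?h (insert i ` Pow (set is))"
    unfolding list.set Pow_insert using disj by (intro sum.union_disjoint) auto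
  also have "sum ?h (insert i ` Pow (set is)) = (\<Sum>T\<in>Pow (set is). ?h (insert i T))"
    by (simp add: sum.reindex[OF inj])
  also have "\<dots> = (\<Sum>T\<in>Pow (set is). - ((- 1) ^ card T * F (a - axis i 1 - (\<Sum>i\<in>T. axis i 1))))"
  proof (rule sum.cong[OF refl])
    fix T assume "T \<in> Pow (set is)"
    then have T: "finite T" "i \<notin> T" using Cons.prems finite_subset by auto
    then show "?h (insert i T) = - ((- 1) ^ card T * F (a - axis i 1 - (\<Sum>i\<in>T. axis i 1)))"
      by (simp add: algebra_simps)
  qed
  finally show ?case using Cons by (simp add: sum_negf)
qed simp

lemma difference_eq_diff_list:
  assumes "distinct is" "set is = (UNIV :: 'q::finite set)"
  shows "difference F a = diff_list is F a"
proof -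
  let ?h = "\<lambda>T :: 'q set. (- 1) ^ card T * F (a - (\<Sum>i\<in>T. axis i 1))"
  have cle: "card T \<le> CARD('q)" for T :: "'q set" by (rule card_mono) simp_all
  have "diff_list is F a = sum ?h UNIV"
    using diff_list_eq[OF assms(1)] assms(2) by simp
  \<comment> \<open>Subsets are grouped by cardinality; the empty one gives the separate term
    \<open>F a\<close> of \<open>difference\<close>.\<close>
  also have "\<dots> = (\<Sum>p\<in>{0..CARD('q)}. \<Sum>T | T \<in> UNIV \<and> card T = p. ?h T)"
    by (rule sum.group[symmetric]) (auto simp: cle)
  also have "\<dots> = (\<Sum>T | T \<in> UNIV \<and> card T = 0. ?h T) + (\<Sum>p = 1..CARD('q). \<Sum>T | T \<in> UNIV \<and> card T = p. ?h T)"
    by (subst sum.atLeast_Suc_atMost) auto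
  also have "(\<Sum>T | T \<in> UNIV \<and> card T = 0. ?h T) = F a"
  proof -
    have "{T :: 'q set. T \<in> UNIV \<and> card T = 0} = {{}}" by auto
    then show ?thesis by simp
  qed
  also have "(\<Sum>p = 1..CARD('q). \<Sum>T | T \<in> UNIV \<and> card T = p. ?h T)
      = (\<Sum>p = 1..CARD('q). (- 1) ^ p * (\<Sum>T | T \<subseteq> UNIV \<and> card T = p. F (a - (\<Sum>i\<in>T. axis i 1))))"
    by (rule sum.cong[OF refl]) (simp add: sum_distrib_left)
  finally show ?thesis by (simp add: difference_def)
qed

text \<open>Each form is regular modulo those adjoined before it, which stand to its right in the
  list. Properness is assumed for the largest ideal and passes to the intermediate ones.\<close>

theorem hilbert_diff_list:
  assumes V: "finite V" and I: "homogeneous_ideal V I" and l: "\<And>i. l i \<in> component V (axis i 1)"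
    and nzd: "\<And>xs i ys u. is = xs @ i # ys \<Longrightarrow> u \<in> pol V \<Longrightarrow>
      l i * u \<in> pol.adj V I (map l ys) \<Longrightarrow> u \<in> pol.adj V I (map l ys)"
    and proper: "1 \<notin> pol.adj V I (map l is)"
  shows "hilbert V (pol.adj V I (map l is)) a = diff_list is (hilbert V I) a"
  using nzd proper
proof (induction "is" arbitrary: a)
  case (Cons i "is")
  have lV: "l i \<in> pol V" for i using l[of i] by (simp add: component_eq)
  have I': "ideal_in (pol V) I" using I by (simp add: homogeneous_ideal_iff)
  have eq: "pol.adj V I (map l (i # is)) = pol.adj V (pol.adj V I (map l is)) [l i]" by simp
  have hom: "homogeneous_ideal V (pol.adj V I (map l is))"
    by (rule homogeneous_adj[OF I]) (use l in auto)
  have A: "ideal_in (pol V) (pol.adj V I (map l (i # is)))"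
    by (rule pol.adj_ideal[OF I']) (use lV in auto)
  have sub: "pol.adj V I (map l is) \<subseteq> pol.adj V I (map l (i # is))"
    using pol.adj_superset[of V "pol.adj V I (map l is)" "[l i]"] hom lV
    unfolding eq homogeneous_ideal_iff by auto
  have IH: "hilbert V (pol.adj V I (map l is)) a = diff_list is (hilbert V I) a" for a
  proof (rule Cons.IH)
    fix xs j ys u assume "is = xs @ j # ys" "u \<in> pol V" "l j * u \<in> pol.adj V I (map l ys)"
    then show "u \<in> pol.adj V I (map l ys)" using Cons.prems(1)[of "i # xs" j ys u] by simp
  next
    show "1 \<notin> pol.adj V I (map l is)" using Cons.prems(2) sub by blast
  qed
  have "hilbert V (pol.adj V (pol.adj V I (map l is)) [l i]) a
      = hilbert V (pol.adj V I (map l is)) a - hilbert V (pol.adj V I (map l is)) (a - axis i 1)"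
  proof (rule hilbert_nzd[OF V hom l])
    show "u \<in> pol.adj V I (map l is)" if "u \<in> pol V" "l i * u \<in> pol.adj V I (map l is)" for u
      using Cons.prems(1)[of "[]" i "is" u] that by simp
    show "pol.adj V (pol.adj V I (map l is)) [l i] \<noteq> pol V"
      using Cons.prems(2) unfolding eq by (metis pol.one_mem)
  qed
  then show ?case unfolding eq by (simp add: IH del: pol.adj.simps)
qed simp

subsection \<open>The total degree\<close>

definition tsize :: "int ^ 'q::finite \<Rightarrow> nat" where
  "tsize a = nat (\<Sum>i\<in>UNIV. a $ i)"

text \<open>The multigrading is coarsened to the total degree because the Nakayama argument is an
  induction on one natural number.\<close>

definition tcomp :: "nat \<Rightarrow> ('q::finite, 'k::field) polynomial \<Rightarrow> ('q, 'k) polynomial" where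
  "tcomp t p = (\<Sum>a | a \<in> mdeg ` keys p \<and> tsize a = t. hcomp a p)"

lemma lookup_tcomp: "lookup (tcomp t p) m = (if tsize (mdeg m) = t then lookup p m else 0)"
proof (cases "m \<in> keys p")
  case True
  then show ?thesis by (simp add: tcomp_def lookup_sum lookup_hcomp)
next
  case False
  then show ?thesis by (auto simp: tcomp_def lookup_sum lookup_hcomp in_keys_iff)
qed

lemma mdeg_nonneg: "0 \<le> mdeg m $ i"
  by (auto simp: mdeg_nth intro: sum_nonneg)

lemma tsize_axis_add: "(\<And>j. 0 \<le> a $ j) \<Longrightarrow> tsize (axis i 1 + a) = Suc (tsize a)"
proof -
  assume a: "\<And>j. 0 \<le> a $ j"
  have "(\<Sum>j\<in>UNIV. (axis i 1 + a) $ j) = (\<Sum>j\<in>UNIV. if j = i then 1 else 0) + (\<Sum>j\<in>UNIV. a $ j)"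
    unfolding sum.distrib[symmetric] by (rule sum.cong) (auto simp: axis_def)
  moreover have "0 \<le> (\<Sum>j\<in>UNIV. a $ j)" by (rule sum_nonneg) (use a in auto)
  ultimately show ?thesis by (simp add: tsize_def nat_add_distrib)
qed

lemma tcomp_add: "tcomp t (p + q) = tcomp t p + tcomp t q"
  by (rule poly_mapping_eqI) (simp add: lookup_tcomp lookup_add)

lemma tcomp_zero [simp]: "tcomp t 0 = 0"
  by (rule poly_mapping_eqI) (simp add: lookup_tcomp)

lemma tcomp_mem: "p \<in> pol V \<Longrightarrow> tcomp t p \<in> pol V"
  unfolding tcomp_def by (intro pol.sum_mem hcomp_mem)

lemma tcomp_component: "p \<in> component V a \<Longrightarrow> tcomp t p = (if tsize a = t then p else 0)"
  by (rule poly_mapping_eqI) (auto simp: lookup_tcomp component_eq in_keys_iff)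

lemma tcomp_mult_linear:
  assumes f: "f \<in> component V (axis i 1)" and p: "p \<in> pol V"
  shows "tcomp 0 (f * p) = 0 \<and> tcomp (Suc t) (f * p) = f * tcomp t p"
  using p
proof (induction rule: pol_induct)
  case (add p m c)
  have "f * single m c \<in> component V (axis i 1 + mdeg m)"
    using component_mult[OF f single_component[OF add(2)]] .
  from tcomp_component[OF this] tcomp_component[OF single_component[OF add(2), of c]]
  have "tcomp 0 (f * single m c) = 0 \<and>
      tcomp (Suc t) (f * single m c) = f * tcomp t (single m c)"
    by (simp add: tsize_axis_add mdeg_nonneg)
  then show ?case using add(3) by (simp add: distrib_left tcomp_add)
qed simp

lemma graded_subring_pol: "graded_subring (pol V :: ('q::finite, 'k::field) polynomial set) tcomp"
proof
  fix p :: "('q, 'k) polynomial"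
  define T0 where "T0 = Suc (Max (insert 0 ((\<lambda>m. tsize (mdeg m)) ` keys p)))"
  have "p = (\<Sum>t<T. tcomp t p)" if T: "T0 \<le> T" for T
  proof (rule poly_mapping_eqI)
    fix m
    show "lookup p m = lookup (\<Sum>t<T. tcomp t p) m"
    proof (cases "m \<in> keys p")
      case True
      then have "tsize (mdeg m) \<le> Max (insert 0 ((\<lambda>m. tsize (mdeg m)) ` keys p))"
        by (intro Max_ge) auto
      then have "tsize (mdeg m) < T" using T by (simp add: T0_def)
      then show ?thesis by (simp add: lookup_sum lookup_tcomp)
    qed (auto simp: lookup_sum lookup_tcomp in_keys_iff)
  qed
  then show "\<exists>T0. \<forall>T\<ge>T0. p = (\<Sum>t<T. tcomp t p)" by blast
qed (auto intro: tcomp_mem simp: tcomp_add)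

interpretation pol: graded_subring "pol V :: ('q::finite, 'k::field) polynomial set" tcomp for V
  by (rule graded_subring_pol)

lemma linear_form_component: "f \<in> component V (axis i 1) \<Longrightarrow> pol.linear_form V f"
  unfolding pol.linear_form_def using tcomp_mult_linear[of f V i] by (auto simp: component_eq)

lemma homogeneous_graded_ideal: "homogeneous_ideal V I \<Longrightarrow> pol.graded_ideal V I"
  unfolding pol.graded_ideal_def homogeneous_ideal_iff tcomp_def
  by (auto intro: ideal_in.I_sum)

text \<open>
  Depth sensitivity of the Koszul complex: every element of the irrelevant ideal has a power in the
  ideal generated by \<open>I\<close> and the \<open>l i\<close>, so a regular sequence \<open>fs\<close> makes their Koszul complex exact
  below degree \<open>length fs\<close>.
\<close>

theorem depth_linear_forms:
  fixes I :: "('q::finite, 'k::field) polynomial set"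
  assumes I: "homogeneous_ideal V I" and l: "\<And>i. l i \<in> component V (axis i 1)"
    and nil: "\<And>v. v \<in> V \<Longrightarrow> \<exists>t. var v ^ t \<in> pol.adj V I (map l is)"
    and fs: "regular_sequence (poly_ring V) I fs" "set fs \<subseteq> Idl\<^bsub>poly_ring V\<^esub> (var ` V)"
  shows "i < length fs \<Longrightarrow> pol.koszul_exact V I (map l is) i"
proof -
  have I': "ideal_in (pol V) I" using I by (simp add: homogeneous_ideal_iff)
  have lV: "set (map l is) \<subseteq> pol V" using l by (auto simp: component_eq)
  interpret A: ideal_in "pol V" "pol.adj V I (map l is)" by (rule pol.adj_ideal[OF I' lV])
  have varV: "var v \<in> pol V" if "v \<in> V" for v :: "'q \<times> nat"
    unfolding var_def using that by (intro single_in_pol) auto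
  have reg: "set fs \<subseteq> pol V" "pol.nzd_seq V I fs"
    using fs(1) pol.regular_sequence_iff[OF I'] by (auto simp: poly_ring_eq)
  have "Idl\<^bsub>poly_ring V\<^esub> (var ` V) \<subseteq> {x \<in> pol V. \<exists>t. x ^ t \<in> pol.adj V I (map l is)}"
    unfolding poly_ring_eq by (rule pol.Idl_minimal[OF A.radical_ideal]) (use nil varV in auto)
  then have "\<exists>t. g ^ t \<in> pol.adj V I (map l is)" if "g \<in> set fs" for g
    using that fs(2) by blast
  then show "i < length fs \<Longrightarrow> pol.koszul_exact V I (map l is) i"
    by (intro pol.koszul_exact_if_nzd_seq[OF I' lV reg])
qed

text \<open>A regular sequence longer than \<open>is\<close> would make the Koszul complex exact in
  top degree as well, against properness.\<close>

corollary depth_le: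
  fixes I :: "('q::finite, 'k::field) polynomial set"
  assumes I: "homogeneous_ideal V I" and l: "\<And>i. l i \<in> component V (axis i 1)"
    and nil: "\<And>v. v \<in> V \<Longrightarrow> \<exists>t. var v ^ t \<in> pol.adj V I (map l is)"
    and proper: "1 \<notin> pol.adj V I (map l is)"
  shows "depth V I \<le> enat (length is)"
  unfolding depth_def
proof (rule Sup_least)
  fix x assume "x \<in> {enat (length fs) | fs. regular_sequence (poly_ring V) I fs \<and>
      set fs \<subseteq> Idl\<^bsub>poly_ring V\<^esub> (var ` V)}"
  then obtain fs where fs: "x = enat (length fs)" "regular_sequence (poly_ring V) I fs"
    "set fs \<subseteq> Idl\<^bsub>poly_ring V\<^esub> (var ` V)" by auto
  have "\<not> length is < length fs"
  proof
    assume "length is < length fs"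
    then have "pol.koszul_exact V I (map l is) (length (map l is))"
      using depth_linear_forms[OF I l nil fs(2,3)] by simp
    then have "1 \<in> pol.adj V I (map l is)"
      by (rule pol.koszul_exact_top[rotated 2]) (use I l in \<open>auto simp: homogeneous_ideal_iff component_eq\<close>)
    then show False using proper by simp
  qed
  then show "x \<le> enat (length is)" by (simp add: fs(1))
qed

text \<open>The depth is a supremum, so a regular sequence of sufficient length is extracted first;
  depth sensitivity and \<open>nzd_suffix\<close> then make the linear forms regular.\<close>

corollary depth_ge_nzd:
  fixes I :: "('q::finite, 'k::field) polynomial set"
  assumes I: "homogeneous_ideal V I" and l: "\<And>i. l i \<in> component V (axis i 1)"
    and nil: "\<And>v. v \<in> V \<Longrightarrow> \<exists>t. var v ^ t \<in> pol.adj V I (map l is)"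
    and depth: "depth V I \<ge> enat (length is)"
    and split: "is = xs @ i # ys" and u: "u \<in> pol V" "l i * u \<in> pol.adj V I (map l ys)"
  shows "u \<in> pol.adj V I (map l ys)"
proof -
  let ?S = "{enat (length fs) | fs. regular_sequence (poly_ring V) I fs \<and>
      set fs \<subseteq> Idl\<^bsub>poly_ring V\<^esub> (var ` V)}"
  have "\<exists>fs. regular_sequence (poly_ring V) I fs \<and> set fs \<subseteq> Idl\<^bsub>poly_ring V\<^esub> (var ` V)
      \<and> length is \<le> length fs"
  proof (rule ccontr)
    assume no: "\<not> ?thesis"
    \<comment> \<open>If all sequences were shorter than \<open>is\<close>, so would be the
      supremum. By \<open>split\<close> the list \<open>is\<close> is nonempty, hence the
      subtraction is not truncated.\<close>
    have "Sup ?S \<le> enat (length is - 1)"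
    proof (rule Sup_least)
      fix x assume "x \<in> ?S"
      then obtain fs where "x = enat (length fs)" "regular_sequence (poly_ring V) I fs"
        "set fs \<subseteq> Idl\<^bsub>poly_ring V\<^esub> (var ` V)" by blast
      moreover from this have "\<not> length is \<le> length fs" using no by (simp add: not_le)
      ultimately show "x \<le> enat (length is - 1)" by simp
    qed
    then have "enat (length is) \<le> enat (length is - 1)" using depth unfolding depth_def by (rule order.trans[rotated])
    then show False using split by simp
  qed
  then obtain fs where fs: "regular_sequence (poly_ring V) I fs" "set fs \<subseteq> Idl\<^bsub>poly_ring V\<^esub> (var ` V)"
    "length is \<le> length fs" by auto
  show ?thesis
  proof (rule pol.nzd_suffix[OF homogeneous_graded_ideal[OF I], where xs = "map l xs"])
    show "pol.linear_form V g" if "g \<in> set (map l xs @ l i # map l ys)" for g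
      using that linear_form_component[OF l] by auto
    show "pol.koszul_exact V I (map l xs @ l i # map l ys) j"
      if "j < length (map l xs @ l i # map l ys)" for j
      using depth_linear_forms[OF I l nil fs(1,2), of j] fs(3) that split by simp
  qed (rule u)+
qed

section \<open>Artinian reductions\<close>

lemma (in comm_subring) ideal_quotient_vimage:
  assumes I: "ideal_in R I" and K: "ideal K (ring_on R Quot I)"
  shows "ideal_in R {r \<in> R. I +>\<^bsub>ring_on R\<^esub> r \<in> K}" "I \<subseteq> {r \<in> R. I +>\<^bsub>ring_on R\<^esub> r \<in> K}"
    "K = (\<lambda>r. I +>\<^bsub>ring_on R\<^esub> r) ` {r \<in> R. I +>\<^bsub>ring_on R\<^esub> r \<in> K}"
proof -
  interpret r: cring "ring_on R" by (rule cring_ring_on)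
  interpret i: ideal I "ring_on R" using I by (simp add: ideal_ring_on_iff)
  interpret h: ring_hom_ring "ring_on R" "ring_on R Quot I" "\<lambda>f. I +>\<^bsub>ring_on R\<^esub> f"
    by (rule i.rcos_ring_hom_ring)
  show "ideal_in R {r \<in> R. I +>\<^bsub>ring_on R\<^esub> r \<in> K}"
    using h.ideal_vimage[OF K] by (simp add: ideal_ring_on_iff)
  show "I \<subseteq> {r \<in> R. I +>\<^bsub>ring_on R\<^esub> r \<in> K}"
  proof
    fix x assume x: "x \<in> I"
    then have xR: "x \<in> R" using I ideal_in.I_memR by blast
    have "I +>\<^bsub>ring_on R\<^esub> x = I" using r.a_rcos_zero[OF i.is_ideal x] .
    moreover have "I \<in> K"
      using additive_subgroup.zero_closed[OF ideal.axioms(1)[OF K]] by (simp add: FactRing_def)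
    ultimately show "x \<in> {r \<in> R. I +>\<^bsub>ring_on R\<^esub> r \<in> K}" using xR by simp
  qed
  have "K \<subseteq> carrier (ring_on R Quot I)" using ideal.Icarr[OF K] by blast
  then have "K \<subseteq> (\<lambda>r. I +>\<^bsub>ring_on R\<^esub> r) ` R" by (auto simp: FactRing_def A_RCOSETS_def')
  then show "K = (\<lambda>r. I +>\<^bsub>ring_on R\<^esub> r) ` {r \<in> R. I +>\<^bsub>ring_on R\<^esub> r \<in> K}" by auto
qed

lemma (in scalars) artinian_finite_codim:
  assumes I: "ideal_in R I" and fc: "finite_codim I"
  shows "artinian_ring (ring_on R Quot I)"
  unfolding artinian_ring_def
proof (intro conjI allI impI)
  show "cring (ring_on R Quot I)"
    by (rule ideal.quotient_is_cring[OF _ cring_ring_on]) (use I in \<open>simp add: ideal_ring_on_iff\<close>)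
  fix K :: "nat \<Rightarrow> 'a set set"
  assume "\<forall>k. ideal (K k) (ring_on R Quot I) \<and> K (Suc k) \<subseteq> K k"
  then have K: "\<And>k. ideal (K k) (ring_on R Quot I)" "\<And>k. K (Suc k) \<subseteq> K k" by auto
  define U where "U k = {r \<in> R. I +>\<^bsub>ring_on R\<^esub> r \<in> K k}" for k
  note U = ideal_quotient_vimage[OF I K(1), folded U_def]
  have "\<exists>N. \<forall>k\<ge>N. U k = U N"
  proof (rule finite_codim_chain[OF fc ideal_lin_subspace[OF U(1)] U(2)])
    show "U (Suc k) \<subseteq> U k" for k using K(2) by (auto simp: U_def)
    show "U k \<subseteq> R" for k by (auto simp: U_def)
  qed
  then obtain N where "\<forall>k\<ge>N. U k = U N" by blast
  then show "\<exists>N. \<forall>k\<ge>N. K k = K N" using U(3) by metis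
qed

text \<open>Stationarity of the ideals \<open>I + (x ^ k)\<close>, read in the quotient
  ring.\<close>

lemma (in comm_subring) artinian_power_relation:
  assumes I: "ideal_in R I" and art: "artinian_ring (ring_on R Quot I)" and x: "x \<in> R"
  shows "\<exists>N. \<exists>r\<in>R. x ^ N - r * x ^ Suc N \<in> I"
proof -
  interpret r: cring "ring_on R" by (rule cring_ring_on)
  interpret ideal_in R I by (rule I)
  let ?p = "\<lambda>f. I +>\<^bsub>ring_on R\<^esub> f"
  have i: "ideal I (ring_on R)" using I by (simp add: ideal_ring_on_iff)
  have p_eq: "?p x = ?p y \<longleftrightarrow> x - y \<in> I" if "x \<in> R" "y \<in> R" for x y
    using r.quotient_eq_iff_same_a_r_cos[OF i, of x y] that by (simp add: a_minus_def a_inv_ring_on)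
  define K where "K k = ?p ` adj I [x ^ k]" for k
  have xk: "set [x ^ k] \<subseteq> R" for k using x by (simp add: power_mem)
  have "ideal (K k) (ring_on R Quot I)" for k
    unfolding K_def using adj_ideal[OF I xk] r.ring_ideal_imp_quot_ideal[OF i]
    by (simp add: ideal_ring_on_iff)
  moreover have "K (Suc k) \<subseteq> K k" for k
  proof -
    have "adj I [x ^ Suc k] \<subseteq> adj I [x ^ k]"
    proof
      fix u assume "u \<in> adj I [x ^ Suc k]"
      then obtain j r where u: "u = j + r * x ^ Suc k" "j \<in> I" "r \<in> R" by (auto simp: adj_single)
      have "j + (r * x) * x ^ k \<in> adj I [x ^ k]"
        by (rule adj_ConsI) (use u x in \<open>auto intro: mult_mem\<close>)
      then show "u \<in> adj I [x ^ k]" by (simp add: u(1) ac_simps)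
    qed
    then show ?thesis unfolding K_def by blast
  qed
  ultimately obtain N where N: "\<forall>k\<ge>N. K k = K N" using art unfolding artinian_ring_def by blast
  have "x ^ N \<in> adj I [x ^ N]" using adj_superset[OF I xk[of N]] by simp
  then have "?p (x ^ N) \<in> K N" unfolding K_def by (rule imageI)
  then have "?p (x ^ N) \<in> K (Suc N)" using N[rule_format, of "Suc N"] by simp
  then obtain y where y: "y \<in> adj I [x ^ Suc N]" "?p (x ^ N) = ?p y" unfolding K_def by auto
  then obtain j r where r: "y = j + r * x ^ Suc N" "j \<in> I" "r \<in> R" by (auto simp: adj_single)
  have "y \<in> R" using ideal_in.I_memR[OF adj_ideal[OF I xk] y(1)] .
  then have "x ^ N - y \<in> I" using p_eq[of "x ^ N" y] y(2) x power_mem by simp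
  then have "(x ^ N - y) + j \<in> I" using r(2) by (rule I_add)
  then have "x ^ N - r * x ^ Suc N \<in> I" by (simp add: r(1) algebra_simps)
  then show ?thesis using r(3) by blast
qed

lemma var_component: "v \<in> V \<Longrightarrow> (var v :: ('q::finite, 'k::field) polynomial) \<in> component V (axis (fst v) 1)"
  using single_component[of "single v 1" V "1::'k"] by (simp add: var_def)

lemma component_power:
  assumes "p \<in> component V (axis i 1)"
  shows "p ^ k \<in> component V (axis i (int k))"
proof (induction k)
  case 0
  then show ?case using single_component[of 0 V 1] by (simp add: axis_def zero_vec_def)
next
  case (Suc k)
  have "p * p ^ k \<in> component V (axis i 1 + axis i (int k))" by (rule component_mult[OF assms Suc])
  then show ?case by (simp add: axis_add[symmetric])
qed

text \<open>In the degree of \<open>x ^ N\<close> the relation \<open>x ^ N - r * x ^ Suc N\<close>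
  reduces to \<open>x ^ N\<close>, because \<open>r\<close> has no component of negative degree;
  homogeneity of \<open>J\<close> does the rest.\<close>

lemma artinian_nilpotent:
  fixes J :: "('q::finite, 'k::field) polynomial set"
  assumes J: "artinian_graded_quotient n J" and v: "v \<in> vars0 n"
  shows "\<exists>t. var v ^ t \<in> J"
proof -
  have hom: "homogeneous_ideal (vars0 n) J" and art: "artinian_ring (ring_on (pol (vars0 n)) Quot J)"
    using J by (auto simp: artinian_graded_quotient_def poly_ring_eq)
  have I: "ideal_in (pol (vars0 n)) J" and hc: "\<And>p a. p \<in> J \<Longrightarrow> hcomp a p \<in> J"
    using hom by (auto simp: homogeneous_ideal_iff)
  let ?x = "var v :: ('q, 'k) polynomial"
  have xc: "?x \<in> component (vars0 n) (axis (fst v) 1)" by (rule var_component[OF v])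
  then have x: "?x \<in> pol (vars0 n)" by (simp add: component_eq)
  obtain N r where r: "r \<in> pol (vars0 n)" "?x ^ N - r * ?x ^ Suc N \<in> J"
    using pol.artinian_power_relation[OF I art x] by blast
  let ?a = "axis (fst v) (int N)"
  have "hcomp ?a (?x ^ N - r * ?x ^ Suc N) = hcomp ?a (?x ^ N + ?x ^ Suc N * (- r))"
    by (simp add: algebra_simps)
  also have "\<dots> = hcomp ?a (?x ^ N) + ?x ^ Suc N * hcomp (?a - axis (fst v) (int (Suc N))) (- r)"
    unfolding hcomp_add by (subst hcomp_mult[OF component_power[OF xc] pol.uminus_mem[OF r(1)]]) (rule refl)
  also have "hcomp (?a - axis (fst v) (int (Suc N))) (- r) = 0"
  proof (rule poly_mapping_eqI)
    fix m :: "'q \<times> nat \<Rightarrow>\<^sub>0 nat"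
    have "mdeg m \<noteq> ?a - axis (fst v) (int (Suc N))"
    proof
      assume "mdeg m = ?a - axis (fst v) (int (Suc N))"
      then have "mdeg m $ fst v = -1" by (simp add: axis_def)
      then show False using mdeg_nonneg[of m "fst v"] by simp
    qed
    then show "lookup (hcomp (?a - axis (fst v) (int (Suc N))) (- r)) m = lookup 0 m"
      by (simp add: lookup_hcomp)
  qed
  finally have "hcomp ?a (?x ^ N - r * ?x ^ Suc N) = ?x ^ N"
    using hcomp_id[OF component_power[OF xc]] by simp
  then show ?thesis using hc[OF r(2), of ?a] by auto
qed

lemma monomial_induct [consumes 1, case_names zero add]:
  fixes m :: "'v \<Rightarrow>\<^sub>0 nat"
  assumes "keys m \<subseteq> V" "P 0"
    and step: "\<And>m v. keys m \<subseteq> V \<Longrightarrow> v \<in> V \<Longrightarrow> P m \<Longrightarrow> P (m + single v 1)"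
  shows "P m"
proof -
  have 1: "keys (m + single v k) \<subseteq> V \<and> P (m + single v k)"
    if "keys m \<subseteq> V" "v \<in> V" "P m" for m v k
  proof (induction k)
    case (Suc k)
    have eq: "m + single v (Suc k) = (m + single v k) + single v 1"
      by (simp add: add.assoc single_add[symmetric])
    have "keys ((m + single v k) + single v 1) \<subseteq> V"
      using Poly_Mapping.keys_add[of "m + single v k" "single v 1"] Suc that(2)
      by auto
    then show ?case unfolding eq using Suc that(2) step by blast
  qed (use that in simp)
  have "keys (\<Sum>v\<in>A. single v (lookup m v)) \<subseteq> V
      \<and> P (\<Sum>v\<in>A. single v (lookup m v))"
    if "finite A" "A \<subseteq> keys m" for A
    using that
  proof (induction A)
    case (insert v A)
    then have "v \<in> V" using assms(1) by auto
    then show ?case using insert 1[of "\<Sum>v\<in>A. single v (lookup m v)" v]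
      by (simp add: add.commute)
  qed (use assms(2) in simp)
  from this[OF finite_keys order.refl] poly_mapping_expand[of "keys m" m]
  show ?thesis by simp
qed

lemma single_var: "single (m + single v 1) (c :: 'k::field) = single m c * var v"
  by (simp add: var_def mult_single)

section \<open>From all variables to those with positive second index\<close>

lemma finite_vars: "finite (vars n :: ('q::finite \<times> nat) set)"
proof -
  have "vars n = Sigma UNIV (\<lambda>i. {..n i})" by (auto simp: vars_def)
  then show ?thesis by simp
qed

lemma vars0_subset: "vars0 n \<subseteq> vars n"
  by (auto simp: vars_def vars0_def)

lemma finite_vars0: "finite (vars0 n :: ('q::finite \<times> nat) set)"
  using finite_subset[OF vars0_subset finite_vars] .

text \<open>The quotient is spanned by the finitely many monomials in which each exponent stays
  below the nilpotency exponent of its variable.\<close>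

lemma nilpotent_finite_codim:
  fixes J :: "('q, 'k::field) polynomial set"
  assumes V: "finite V" and J: "ideal_in (pol V) J" and nil: "\<And>v. v \<in> V \<Longrightarrow> \<exists>t. var v ^ t \<in> J"
  shows "pol.finite_codim V J"
proof -
  interpret ideal_in "pol V" J by (rule J)
  have varV: "var v \<in> pol V" if "v \<in> V" for v :: "'q \<times> nat"
    unfolding var_def using that by (intro single_in_pol) auto
  obtain t where t: "\<And>v. v \<in> V \<Longrightarrow> var v ^ t v \<in> J" using nil by metis
  define M where "M = {m. keys m \<subseteq> V \<and> (\<forall>v\<in>V. lookup m v < t v)}"
  have "finite {f. \<forall>x. (x \<in> V \<longrightarrow> f x \<in> {..<Max (insert 0 (t ` V))}) \<and> (x \<notin> V \<longrightarrow> f x = 0)}"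
    by (rule finite_set_of_finite_funs) (use V in auto)
  moreover have "lookup ` M
      \<subseteq> {f. \<forall>x. (x \<in> V \<longrightarrow> f x \<in> {..<Max (insert 0 (t ` V))}) \<and> (x \<notin> V \<longrightarrow> f x = 0)}"
  proof (intro image_subsetI CollectI allI conjI impI)
    fix m x assume m: "m \<in> M"
    show "lookup m x = 0" if "x \<notin> V" using m that by (auto simp: M_def in_keys_iff)
    show "lookup m x \<in> {..<Max (insert 0 (t ` V))}" if x: "x \<in> V"
    proof -
      have "lookup m x < t x" using m x by (auto simp: M_def)
      also have "t x \<le> Max (insert 0 (t ` V))" using V x by (intro Max_ge) auto
      finally show ?thesis by simp
    qed
  qed
  ultimately have "finite (lookup ` M)" by (rule rev_finite_subset)
  then have finM: "finite M" by (rule finite_imageD) (simp add: inj_on_def poly_mapping_eqI)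
  define W :: "('q, 'k) polynomial set" where "W = (\<lambda>m. single m 1) ` M"
  have finW: "finite W" using finM by (simp add: W_def)
  have "\<exists>f. r - pol.lin_comb W f \<in> J" if "r \<in> pol V" for r
    using that
  proof (induction rule: pol_induct)
    case zero
    show ?case by (intro exI[of _ "\<lambda>_. 0"]) (simp add: pol.lin_comb_def)
  next
    case (add p m c)
    then obtain f where f: "p - pol.lin_comb W f \<in> J" by blast
    have "\<exists>g. single m c - pol.lin_comb W g \<in> J"
    proof (cases "m \<in> M")
      case True
      then have w: "single m 1 \<in> W" by (auto simp: W_def)
      have "pol.lin_comb W (\<lambda>w. if w = single m 1 then c else 0)
          = (\<Sum>w\<in>W. if w = single m 1 then single m c else 0)"
        unfolding pol.lin_comb_def by (rule sum.cong) (auto simp: mult_single)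
      also have "\<dots> = single m c" using finW w by simp
      finally show ?thesis
        by (intro exI[of _ "\<lambda>w. if w = single m 1 then c else 0"]) simp
    next
      case False
      then obtain v where v: "v \<in> V" "t v \<le> lookup m v"
        using add(2) by (auto simp: M_def not_less)
      define m' where "m' = m - single v (t v)"
      have m: "m = m' + single v (t v)"
        by (rule poly_mapping_eqI) (use v in \<open>auto simp: m'_def lookup_add lookup_minus lookup_single "when_def"\<close>)
      have "keys m' \<subseteq> V"
        using add(2) by (auto simp: m'_def in_keys_iff lookup_minus)
      then have "single m' c * var v ^ t v \<in> J" by (rule I_mult[OF single_in_pol t[OF v(1)]])
      moreover have "(var v :: ('q, 'k) polynomial) ^ k = single (single v k) 1" for k
        by (induction k) (auto simp: var_def mult_single single_add[symmetric])
      ultimately have "single m c \<in> J" by (simp add: mult_single m)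
      then show ?thesis by (intro exI[of _ "\<lambda>_. 0"]) (simp add: pol.lin_comb_def)
    qed
    then obtain g where g: "single m c - pol.lin_comb W g \<in> J" by blast
    have "p + single m c - pol.lin_comb W (\<lambda>w. f w + g w) \<in> J"
      unfolding pol.lin_comb_add by (rule cong_add[OF f g])
    then show ?case by (intro exI)
  qed
  moreover have "W \<subseteq> pol V" by (auto simp: W_def M_def single_in_pol)
  ultimately show ?thesis using finW unfolding pol.finite_codim_def by blast
qed

text \<open>The coefficient of \<open>x_i0\<close> is fixed at 1, so that the form can be solved for
  \<open>x_i0\<close>.\<close>

definition lin_form :: "('q \<Rightarrow> nat) \<Rightarrow> ('q \<Rightarrow> nat \<Rightarrow> 'k) \<Rightarrow> 'q \<Rightarrow> ('q::finite, 'k::field) polynomial" where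
  "lin_form n c i = var (i, 0) + (\<Sum>j = 1..n i. single 0 (c i j) * var (i, j))"

lemma const_component: "single 0 c \<in> component V 0"
  using single_component[of 0 V c] by simp

lemma component_sum: "(\<And>i. i \<in> A \<Longrightarrow> f i \<in> component V a) \<Longrightarrow> sum f A \<in> component V a"
  using lin_subspace_component[of V a]
  by (induction A rule: infinite_finite_induct) (auto simp: pol.lin_subspace_def)

lemma component_add: "p \<in> component V a \<Longrightarrow> q \<in> component V a \<Longrightarrow> p + q \<in> component V a"
  using lin_subspace_component[of V a] by (auto simp: pol.lin_subspace_def)

lemma lin_form_component: "lin_form n c i \<in> component (vars n) (axis i 1)"
proof -
  have "single 0 (c i j) * var (i, j) \<in> component (vars n) (axis i 1)" if "j \<le> n i" for j
    using component_mult[OF const_component var_component[of "(i, j)" "vars n"]] that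
    by (simp add: vars_def)
  moreover have "(var (i, 0) :: ('a, 'b) polynomial) \<in> component (vars n) (axis i 1)"
    using var_component[of "(i, 0)" "vars n"] by (simp add: vars_def)
  ultimately show ?thesis
    unfolding lin_form_def by (intro component_add component_sum) auto
qed

text \<open>Modulo \<open>L\<close> every \<open>x_i0\<close> is a linear form in the remaining
  variables, so the smaller ring maps onto the quotient by \<open>L\<close>, with kernel
  \<open>L \<inter> pol (vars0 n)\<close>. Both directions of the main result use this, the converse
  with all coefficients \<open>c i j\<close> equal to 0.\<close>

theorem artinian_reduction:
  fixes I :: "('q::finite, 'k::field) polynomial set"
  assumes I: "homogeneous_ideal (vars n) I" and "is": "distinct is" "set is = UNIV"
    and nzd: "\<And>xs i ys u. is = xs @ i # ys \<Longrightarrow> u \<in> pol (vars n) \<Longrightarrow>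
      lin_form n c i * u \<in> pol.adj (vars n) I (map (lin_form n c) ys) \<Longrightarrow>
      u \<in> pol.adj (vars n) I (map (lin_form n c) ys)"
    and L: "L = pol.adj (vars n) I (map (lin_form n c) is)"
    and nil: "\<And>v. v \<in> vars0 n \<Longrightarrow> \<exists>t. var v ^ t \<in> L" and proper: "1 \<notin> L"
  shows "artinian_graded_quotient n (L \<inter> pol (vars0 n))"
    and "difference (hilbert (vars n) I) = hilbert (vars0 n) (L \<inter> pol (vars0 n))"
proof -
  let ?V = "vars n" and ?Z = "vars0 n" and ?l = "lin_form n c"
  define J where "J = L \<inter> pol ?Z"
  have I': "ideal_in (pol ?V) I" using I by (simp add: homogeneous_ideal_iff)
  have Lh: "homogeneous_ideal ?V L" unfolding L
    by (rule homogeneous_adj[OF I]) (use lin_form_component in auto)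
  have Lid: "ideal_in (pol ?V) L" using Lh by (simp add: homogeneous_ideal_iff)
  interpret L: ideal_in "pol ?V" L by (rule Lid)
  have V0: "pol ?Z \<subseteq> pol ?V" using vars0_subset by (auto simp: pol_def)
  have comp0: "component ?Z a \<subseteq> component ?V a" for a using V0 by (auto simp: component_eq)
  have lL: "?l i \<in> L" for i
    using pol.adj_superset[OF I', of "map ?l is"] lin_form_component "is"(2) unfolding L component_eq by auto
  have Jid: "ideal_in (pol ?Z) J"
  proof
    show "r * x \<in> J" if "r \<in> pol ?Z" "x \<in> J" for r x
      using that V0 pol.mult_mem by (auto simp: J_def intro: L.I_mult)
  qed (auto simp: J_def intro: L.I_add pol.add_mem)
  have Jh: "homogeneous_ideal ?Z J"
    using Jid Lh by (auto simp: homogeneous_ideal_iff J_def intro: hcomp_mem)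
  have J1: "1 \<notin> J" using proper by (simp add: J_def)
  then have Jp: "J \<noteq> pol ?Z" using pol.one_mem by blast
  have varV0: "var v \<in> pol ?Z" if "v \<in> ?Z" for v :: "'q \<times> nat"
    unfolding var_def using that by (intro single_in_pol) auto
  have "\<exists>t. var v ^ t \<in> J" if "v \<in> ?Z" for v
    using nil[OF that] varV0[OF that] pol.power_mem by (auto simp: J_def)
  then have "pol.finite_codim ?Z J" by (rule nilpotent_finite_codim[OF finite_vars0 Jid])
  then have "artinian_ring (ring_on (pol ?Z) Quot J)" by (rule pol.artinian_finite_codim[OF Jid])
  then show "artinian_graded_quotient n (L \<inter> pol ?Z)"
    using Jh Jp by (simp add: artinian_graded_quotient_def poly_ring_eq J_def)

  \<comment> \<open>The representative has to keep the degree \<open>a\<close> for the Hilbert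
    functions to agree. The property is multiplicative, which reduces it to the variables.\<close>
  define G where "G a p \<longleftrightarrow> (\<exists>p0\<in>component ?Z a. p - p0 \<in> L)" for a p
  have G_mult: "G (a + b) (p * q)" if p: "G a p" "p \<in> pol ?V" and q: "G b q" for a b p q
  proof -
    obtain p0 q0 where 0: "p0 \<in> component ?Z a" "p - p0 \<in> L" "q0 \<in> component ?Z b" "q - q0 \<in> L"
      using p q by (auto simp: G_def)
    have "q0 \<in> pol ?V" using 0(3) V0 by (auto simp: component_eq)
    then have "p * q - p0 * q0 \<in> L" by (rule L.cong_mult[OF p(2) _ 0(2,4)])
    then show ?thesis using component_mult[OF 0(1,3)] by (auto simp: G_def)
  qed
  have G0: "G a p" if "p \<in> component ?Z a" for a p
    using that by (auto simp: G_def intro!: bexI[of _ p])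
  have G_var: "G (axis (fst v) 1) (var v)" if v: "v \<in> ?V" for v :: "'q \<times> nat"
  proof (cases "v \<in> ?Z")
    case True
    then show ?thesis by (intro G0 var_component)
  next
    case False
    then obtain i where vi: "v = (i, 0)" using v by (cases v) (auto simp: vars_def vars0_def)
    define s where "s = (\<Sum>j = 1..n i. single 0 (c i j) * var (i, j))"
    have tm: "single 0 (c i j) * var (i, j) \<in> component ?Z (axis i 1)" if "j \<in> {1..n i}" for j
      using component_mult[OF const_component var_component[of "(i, j)" ?Z]] that by (simp add: vars0_def)
    have s: "s \<in> component ?Z (axis i 1)" unfolding s_def by (rule component_sum[OF tm])
    have z: "0 \<in> component ?Z (axis i 1)" by (simp add: component_eq)
    have ms: "0 - s \<in> component ?Z (axis i 1)"
      by (rule pol.lin_subspace_diff[OF lin_subspace_component z s])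
    have "var v - (0 - s) = ?l i" by (simp add: lin_form_def vi s_def)
    then show ?thesis using ms lL[of i] unfolding G_def vi by (intro bexI[of _ "0 - s"]) simp_all
  qed
  have G_mono: "G (mdeg m) (single m k)" if "keys m \<subseteq> ?V" for m k
    using that
  proof (induction rule: monomial_induct)
    case zero
    show ?case using G0[OF const_component] by simp
  next
    case (add m v)
    have "G (mdeg m + axis (fst v) 1) (single m k * var v)"
      by (rule G_mult[OF add(3) single_in_pol[OF add(1)] G_var[OF add(2)]])
    then show ?case unfolding single_var by (simp add: mdeg_add)
  qed
  have cover: "G a p" if p: "p \<in> component ?V a" for a p
  proof -
    have "\<exists>p0. (\<forall>m\<in>keys p. p0 m \<in> component ?Z a \<and>
        single m (lookup p m) - p0 m \<in> L)"
    proof (rule bchoice, rule ballI)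
      fix m assume m: "m \<in> keys p"
      then have "keys m \<subseteq> ?V" "mdeg m = a" using p by (auto simp: component_eq pol_def)
      then show "\<exists>y. y \<in> component ?Z a \<and> single m (lookup p m) - y \<in> L"
        using G_mono[of m "lookup p m"] unfolding G_def by blast
    qed
    then obtain p0 where p0: "\<And>m. m \<in> keys p \<Longrightarrow> p0 m \<in> component ?Z a"
      "\<And>m. m \<in> keys p \<Longrightarrow> single m (lookup p m) - p0 m \<in> L" by blast
    have "(\<Sum>m\<in>keys p. single m (lookup p m) - p0 m) \<in> L"
      by (rule L.I_sum) (rule p0(2))
    then have "p - (\<Sum>m\<in>keys p. p0 m) \<in> L"
      using poly_mapping_expand[of "keys p" p] by (simp add: sum_subtractf)
    moreover have "(\<Sum>m\<in>keys p. p0 m) \<in> component ?Z a"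
      by (rule component_sum) (rule p0(1))
    ultimately show ?thesis unfolding G_def by blast
  qed
  have hil: "hilbert ?V L a = hilbert ?Z J a" for a
  proof -
    obtain B where B: "pol.basis_mod J (component ?Z a) B" using component_basis[OF finite_vars0 Jid] by blast
    \<comment> \<open>One basis serves both quotients: independence because \<open>J\<close> is the
      intersection, spanning by \<open>cover\<close>.\<close>
    have "pol.basis_mod L (component ?V a) B"
      unfolding pol.basis_mod_def
    proof (intro conjI allI impI)
      show "finite B" "B \<subseteq> component ?V a" using B comp0[of a] by (auto simp: pol.basis_mod_def)
    next
      fix f assume f: "pol.lin_comb B f \<in> L"
      have "pol.lin_comb B f \<in> component ?Z a"
        using B by (intro pol.lin_comb_subspace lin_subspace_component) (auto simp: pol.basis_mod_def)
      then have "pol.lin_comb B f \<in> J" using f by (simp add: J_def component_eq)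
      then show "\<forall>b\<in>B. f b = 0" using B by (simp add: pol.basis_mod_def)
    next
      show "\<forall>u\<in>component ?V a. \<exists>f. u - pol.lin_comb B f \<in> L"
      proof
        fix u :: "('q, 'k) polynomial" assume "u \<in> component ?V a"
        then obtain p0 where p0: "p0 \<in> component ?Z a" "u - p0 \<in> L" using cover by (auto simp: G_def)
        then obtain f where "p0 - pol.lin_comb B f \<in> J" using B unfolding pol.basis_mod_def by blast
        then have "p0 - pol.lin_comb B f \<in> L" by (simp add: J_def)
        then have "u - pol.lin_comb B f \<in> L" by (rule L.cong_trans[OF p0(2)])
        then show "\<exists>f. u - pol.lin_comb B f \<in> L" by (intro exI)
      qed
    qed
    moreover have "L \<noteq> pol ?V" using proper pol.one_mem by blast
    ultimately show ?thesis using hilbert_eq_card[OF Lid] hilbert_eq_card[OF Jid Jp B] by simp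
  qed
  show "difference (hilbert ?V I) = hilbert ?Z (L \<inter> pol ?Z)"
  proof
    fix a
    have "hilbert ?V L a = diff_list is (hilbert ?V I) a" unfolding L
      by (rule hilbert_diff_list[OF finite_vars I lin_form_component nzd]) (use proper L in auto)
    then show "difference (hilbert ?V I) a = hilbert ?Z (L \<inter> pol ?Z) a"
      using hil difference_eq_diff_list[OF "is"] by (simp add: J_def)
  qed
qed

section \<open>Coordinate rings of the charts\<close>

definition exps :: "('q::finite \<Rightarrow> nat) \<Rightarrow> ('q \<times> nat) set \<Rightarrow> ('q \<times> nat \<Rightarrow>\<^sub>0 int) set" where
  "exps n D = {m. keys m \<subseteq> vars n \<and> (\<forall>v. lookup m v < 0 \<longrightarrow> v \<in> D) \<and> multidegree m = 0}"

definition sec :: "('q::finite \<Rightarrow> nat) \<Rightarrow> ('q \<times> nat) set \<Rightarrow> ('q, 'k::field) laurent set" where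
  "sec n D = {p. keys p \<subseteq> exps n D}"

lemma sections_eq: "sections n D = ring_on (sec n D)"
proof -
  have "{p. \<forall>m\<in>keys p. keys m \<subseteq> vars n \<and>
     (\<forall>v. lookup m v < 0 \<longrightarrow> v \<in> D) \<and> multidegree m = 0} = sec n D"
    by (auto simp: sec_def exps_def)
  then show ?thesis unfolding sections_def by (rule arg_cong)
qed

lemma exps_zero: "0 \<in> exps n D"
  by (simp add: exps_def)

lemma exps_add:
  assumes "m \<in> exps n D" "m' \<in> exps n D"
  shows "m + m' \<in> exps n D"
proof -
  have "v \<in> D" if "lookup (m + m') v < 0" for v
  proof -
    have "lookup m v < 0 \<or> lookup m' v < 0" using that by (auto simp: lookup_add)
    then show ?thesis using assms unfolding exps_def by blast
  qed
  then show ?thesis using assms Poly_Mapping.keys_add[of m m'] by (auto simp: exps_def multidegree_add)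
qed

lemma single_in_sec: "m \<in> exps n D \<Longrightarrow> single m c \<in> sec n D"
  by (auto simp: sec_def)

lemma comm_subring_sec: "comm_subring (sec n D :: ('q::finite, 'k::field) laurent set)"
proof
  show "0 \<in> sec n D" "1 \<in> sec n D" by (auto simp: sec_def exps_zero)
next
  fix p q :: "('q, 'k) laurent" assume pq: "p \<in> sec n D" "q \<in> sec n D"
  show "p + q \<in> sec n D" using pq Poly_Mapping.keys_add[of p q] unfolding sec_def by blast
  show "- p \<in> sec n D" using pq by (simp add: sec_def keys_def)
  show "p * q \<in> sec n D"
  proof -
    have "m \<in> exps n D" if "m \<in> keys (p * q)" for m
    proof -
      obtain a b where "m = a + b" "a \<in> keys p" "b \<in> keys q"
        using \<open>m \<in> keys (p * q)\<close> keys_mult[of p q] by blast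
      then show ?thesis using pq exps_add unfolding sec_def by blast
    qed
    then show ?thesis by (auto simp: sec_def)
  qed
qed

interpretation sec: scalars "sec n D :: ('q::finite, 'k::field) laurent set" "single 0" for n D
  by (rule scalars_poly_mapping[OF comm_subring_sec single_in_sec[OF exps_zero]])

lemma sec_induct [consumes 1, case_names zero add]:
  assumes "p \<in> sec n D" "P 0"
    and "\<And>p m c. p \<in> sec n D \<Longrightarrow> P p \<Longrightarrow> m \<in> exps n D \<Longrightarrow> P (p + single m c)"
  shows "P p"
proof -
  have "(\<Sum>m\<in>A. single m (lookup p m)) \<in> sec n D
      \<and> P (\<Sum>m\<in>A. single m (lookup p m))"
    if "A \<subseteq> keys p" "finite A" for A
    using that(2,1)
  proof (induction A)
    case (insert m A)
    then have m: "m \<in> exps n D" using assms(1) by (auto simp: sec_def)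
    let ?s = "\<Sum>m\<in>A. single m (lookup p m)"
    have s: "?s \<in> sec n D" "P ?s" using insert by auto
    have "?s + single m (lookup p m) \<in> sec n D"
      by (rule sec.add_mem[OF s(1) single_in_sec[OF m]])
    moreover have "P (?s + single m (lookup p m))" by (rule assms(3)[OF s m])
    ultimately show ?case using insert.hyps by (simp add: add.commute)
  qed (use assms in simp)
  from this[OF order.refl finite_keys] poly_mapping_expand[of "keys p" p]
  show ?thesis by simp
qed

definition ratio_exp :: "('q \<Rightarrow> nat) \<Rightarrow> 'q \<times> nat \<Rightarrow> ('q::finite \<times> nat \<Rightarrow>\<^sub>0 int)" where
  "ratio_exp \<sigma> v = single v 1 - single (fst v, \<sigma> (fst v)) 1"

text \<open>The affine coordinate \<open>x_v / x_(i, \<sigma> i)\<close> of the chart, where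
  \<open>i = fst v\<close>.\<close>

definition ratio :: "('q \<Rightarrow> nat) \<Rightarrow> 'q \<times> nat \<Rightarrow> ('q::finite, 'k::field) laurent" where
  "ratio \<sigma> v = single (ratio_exp \<sigma> v) 1"

lemma chart_vars: "\<sigma> \<in> charts n \<Longrightarrow> (i, \<sigma> i) \<in> vars n"
  by (auto simp: charts_def vars_def)

lemma ratio_exp_exps:
  assumes "\<sigma> \<in> charts n" "v \<in> vars n"
  shows "ratio_exp \<sigma> v \<in> exps n (inverted \<sigma>)"
proof -
  have "keys (ratio_exp \<sigma> v) \<subseteq> {v, (fst v, \<sigma> (fst v))}"
    by (auto simp: in_keys_iff ratio_exp_def lookup_minus lookup_single "when_def" split: if_splits)
  moreover have "w \<in> inverted \<sigma>" if "lookup (ratio_exp \<sigma> v) w < 0" for w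
    using that by (auto simp: ratio_exp_def lookup_minus lookup_single "when_def" inverted_def split: if_splits)
  ultimately show ?thesis
    using assms chart_vars[OF assms(1), of "fst v"] by (auto simp: exps_def ratio_exp_def multidegree_diff)
qed

lemma ratio_mem: "\<sigma> \<in> charts n \<Longrightarrow> v \<in> vars n \<Longrightarrow> ratio \<sigma> v \<in> sec n (inverted \<sigma>)"
  unfolding ratio_def by (intro single_in_sec ratio_exp_exps)

lemma ratio_self [simp]: "ratio \<sigma> (i, \<sigma> i) = 1"
  by (simp add: ratio_def ratio_exp_def)

text \<open>Each factor has only one inverted variable, so degree 0 forces its exponent to vanish
  once all others do.\<close>

lemma exps_inverted_zero:
  assumes m: "m \<in> exps n (inverted \<sigma>)" and zero: "\<And>v. v \<notin> inverted \<sigma> \<Longrightarrow> lookup m v = 0"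
  shows "m = 0"
proof (rule poly_mapping_eqI)
  fix v
  show "lookup m v = lookup 0 v"
  proof (cases "v \<in> inverted \<sigma>")
    case True
    then have v: "v = (fst v, \<sigma> (fst v))" by (auto simp: inverted_def)
    have "0 = multidegree m $ fst v" using m by (simp add: exps_def)
    also have "\<dots> = (\<Sum>w\<in>keys m. if w = v then lookup m v else 0)"
      unfolding multidegree_nth
    proof (rule sum.cong[OF refl])
      fix w assume w: "w \<in> keys m"
      have "w \<in> inverted \<sigma>" using zero[of w] w by (auto simp: in_keys_iff)
      then have "fst w = fst v \<longleftrightarrow> w = v" using v by (auto simp: inverted_def)
      then show "(if fst w = fst v then lookup m w else 0) = (if w = v then lookup m v else 0)"
        by auto
    qed
    also have "\<dots> = lookup m v" by (simp add: in_keys_iff)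
    finally show ?thesis by simp
  qed (use zero in simp)
qed

text \<open>Induction on the total exponent of the variables that are not inverted: dividing by the
  ratio of one that occurs lowers it by one and stays in the coordinate ring.\<close>

lemma single_in_alg_span:
  assumes \<sigma>: "\<sigma> \<in> charts n" and m: "m \<in> exps n (inverted \<sigma>)"
  shows "single m 1 \<in> (sec.alg_span (ratio \<sigma> ` vars n) :: ('q::finite, 'k::field) laurent set)"
  using m
proof (induction "\<Sum>v\<in>vars n - inverted \<sigma>. nat (lookup m v)" arbitrary: m rule: less_induct)
  case less
  let ?A = "sec.alg_span (ratio \<sigma> ` vars n) :: ('q, 'k) laurent set"
  interpret A: comm_subring ?A by (rule sec.comm_subring_alg_span)
  have fin: "finite (vars n - inverted \<sigma>)" by (rule finite_Diff[OF finite_vars])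
  show ?case
  proof (cases "\<forall>v. v \<notin> inverted \<sigma> \<longrightarrow> lookup m v = 0")
    case True
    then have "m = 0" using exps_inverted_zero[OF less.prems] by blast
    then show ?thesis using A.one_mem by simp
  next
    case False
    then obtain v where v: "v \<notin> inverted \<sigma>" "lookup m v \<noteq> 0" by blast
    have nn: "0 \<le> lookup m w" if "w \<notin> inverted \<sigma>" for w
      using less.prems that not_le unfolding exps_def by blast
    have pos: "0 < lookup m v" using nn[OF v(1)] v(2) by simp
    have vV: "v \<in> vars n" using v(2) less.prems by (auto simp: exps_def in_keys_iff)
    define m' where "m' = m - ratio_exp \<sigma> v"
    have m'l: "lookup m' w = lookup m w - (if w = v then 1 else 0)"
      if "w \<notin> inverted \<sigma>" for w
      using that by (auto simp: m'_def ratio_exp_def lookup_minus lookup_single "when_def" inverted_def)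
    have m'E: "m' \<in> exps n (inverted \<sigma>)"
      unfolding exps_def
    proof (intro CollectI conjI allI impI)
      show "keys m' \<subseteq> vars n"
        using keys_diff[of m "ratio_exp \<sigma> v"] less.prems ratio_exp_exps[OF \<sigma> vV] by (auto simp: m'_def exps_def)
      show "w \<in> inverted \<sigma>" if "lookup m' w < 0" for w
      proof (rule ccontr)
        assume w: "w \<notin> inverted \<sigma>"
        then show False using that m'l[OF w] nn[OF w] pos by (auto split: if_splits)
      qed
      show "multidegree m' = 0"
        using less.prems ratio_exp_exps[OF \<sigma> vV] by (auto simp: m'_def exps_def multidegree_diff)
    qed
    have lt: "(\<Sum>w\<in>vars n - inverted \<sigma>. nat (lookup m' w))
        < (\<Sum>w\<in>vars n - inverted \<sigma>. nat (lookup m w))"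
      by (rule sum_strict_mono_ex1[OF fin]) (use v vV pos m'l in \<open>auto intro!: bexI[of _ v]\<close>)
    have "single m' 1 \<in> ?A" by (rule less.hyps[OF lt m'E])
    moreover have "ratio \<sigma> v \<in> ?A" using vV by (intro sec.alg_span.gen) auto
    ultimately have "single m' 1 * ratio \<sigma> v \<in> ?A" by (rule A.mult_mem)
    then show ?thesis by (simp add: ratio_def mult_single m'_def)
  qed
qed

lemma sec_alg_span:
  assumes \<sigma>: "\<sigma> \<in> charts n"
  shows "(sec n (inverted \<sigma>) :: ('q::finite, 'k::field) laurent set) = sec.alg_span (ratio \<sigma> ` vars n)"
proof
  interpret A: comm_subring "sec.alg_span (ratio \<sigma> ` vars n)" by (rule sec.comm_subring_alg_span)
  show "sec.alg_span (ratio \<sigma> ` vars n) \<subseteq> sec n (inverted \<sigma>)"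
    by (rule sec.alg_span_subset[OF comm_subring_sec sec.scalar_mem]) (use ratio_mem[OF \<sigma>] in auto)
  show "(sec n (inverted \<sigma>) :: ('q, 'k) laurent set) \<subseteq> sec.alg_span (ratio \<sigma> ` vars n)"
  proof
    fix p :: "('q, 'k) laurent" assume "p \<in> sec n (inverted \<sigma>)"
    then show "p \<in> sec.alg_span (ratio \<sigma> ` vars n)"
    proof (induction rule: sec_induct)
      case (add p m c)
      have "single m c \<in> sec.alg_span (ratio \<sigma> ` vars n)"
        using A.mult_mem[OF sec.alg_span.scalar single_in_alg_span[OF \<sigma> add(2)]]
        by (simp add: mult_single)
      then show ?case using add by (intro A.add_mem)
    qed simp
  qed
qed

lemma finite_charts: "finite (charts n :: ('q::finite \<Rightarrow> nat) set)"
proof -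
  have "finite (PiE (UNIV :: 'q set) (\<lambda>i. {..n i}))" by (rule finite_PiE) auto
  moreover have "charts n \<subseteq> PiE UNIV (\<lambda>i. {..n i})" by (auto simp: charts_def)
  ultimately show ?thesis by (rule rev_finite_subset)
qed

subsection \<open>Forms on charts\<close>

definition emb :: "('q::finite, 'k::field) polynomial \<Rightarrow> ('q, 'k) laurent" where
  "emb p = (\<Sum>m\<in>keys p. single (Poly_Mapping.map int m) (lookup p m))"

lemma emb_superset:
  "finite A \<Longrightarrow> keys p \<subseteq> A \<Longrightarrow>
    emb p = (\<Sum>m\<in>A. single (Poly_Mapping.map int m) (lookup p m))"
  unfolding emb_def by (rule sum.mono_neutral_left) (auto simp: in_keys_iff)

lemma emb_zero [simp]: "emb 0 = 0"
  by (simp add: emb_def)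

lemma emb_add: "emb (p + q) = emb p + emb q"
proof -
  let ?A = "keys p \<union> keys q"
  have "keys (p + q) \<subseteq> ?A" by (rule Poly_Mapping.keys_add)
  then show ?thesis
    by (simp add: emb_superset[of ?A] lookup_add single_add sum.distrib)
qed

lemma emb_single: "emb (single m c) = single (Poly_Mapping.map int m) c"
  using emb_superset[of "{m}" "single m c"] by simp

lemma pol_UNIV: "p \<in> pol UNIV"
  by (simp add: pol_def)

lemma emb_mult: "emb (p * q) = emb p * emb q"
proof -
  have 1: "emb (p * single m c) = emb p * emb (single m c)" for m c
    using pol_UNIV[of p]
    by (induction rule: pol_induct) (auto simp: distrib_right emb_add emb_single mult_single map_int_add)
  from pol_UNIV[of q] show ?thesis
    by (induction rule: pol_induct) (auto simp: distrib_left emb_add 1)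
qed

lemma lookup_emb: "lookup (emb p) (Poly_Mapping.map int m) = lookup p m"
proof -
  have "lookup (emb p) (Poly_Mapping.map int m)
      = (\<Sum>k\<in>keys p. if k = m then lookup p m else 0)"
    unfolding emb_def lookup_sum by (rule sum.cong) (auto simp: lookup_single map_int_inject "when_def")
  then show ?thesis by (simp add: in_keys_iff)
qed

lemma keys_emb: "keys (emb p) = Poly_Mapping.map int ` keys p"
proof
  show "Poly_Mapping.map int ` keys p \<subseteq> keys (emb p)"
    by (auto simp: in_keys_iff lookup_emb)
  show "keys (emb p) \<subseteq> Poly_Mapping.map int ` keys p"
    unfolding emb_def
    using keys_sum[of "\<lambda>m. single (Poly_Mapping.map int m) (lookup p m)" "keys p"]
    by (auto split: if_splits)
qed

lemma emb_inject: "emb p = emb q \<Longrightarrow> p = q"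
  by (rule poly_mapping_eqI) (metis lookup_emb)

definition chart_exp :: "('q \<Rightarrow> nat) \<Rightarrow> int ^ 'q \<Rightarrow> ('q::finite \<times> nat \<Rightarrow>\<^sub>0 int)" where
  "chart_exp \<sigma> a = (\<Sum>i\<in>UNIV. single (i, \<sigma> i) (a $ i))"

lemma chart_exp_add: "chart_exp \<sigma> (a + b) = chart_exp \<sigma> a + chart_exp \<sigma> b"
  by (simp add: chart_exp_def single_add sum.distrib)

lemma multidegree_chart_exp [simp]: "multidegree (chart_exp \<sigma> a) = a"
  by (simp add: chart_exp_def multidegree_sum vec_eq_iff axis_def if_distrib cong: if_cong)

lemma keys_chart_exp: "keys (chart_exp \<sigma> a) \<subseteq> inverted \<sigma>"
  unfolding chart_exp_def using keys_sum[of "\<lambda>i. single (i, \<sigma> i) (a $ i)" UNIV]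
  by (auto simp: inverted_def split: if_splits)

text \<open>As a product with a fixed monomial, dehomogenization is visibly additive and, together
  with \<open>chart_exp_add\<close>, multiplicative.\<close>

lemma on_chart_eq: "on_chart \<sigma> a F = emb F * single (- chart_exp \<sigma> a) 1"
  by (simp add: on_chart_def emb_def chart_exp_def sum_distrib_right mult_single)

lemma on_chart_mult:
  fixes F G :: "('q::finite, 'k::field) polynomial"
  shows "on_chart \<sigma> (a + b) (F * G) = on_chart \<sigma> a F * on_chart \<sigma> b G"
proof -
  have "single (- chart_exp \<sigma> (a + b)) (1::'k)
      = single (- chart_exp \<sigma> a) 1 * single (- chart_exp \<sigma> b) 1"
    by (simp add: mult_single chart_exp_add)
  then show ?thesis unfolding on_chart_eq emb_mult by (simp add: ac_simps)
qed

lemma on_chart_add: "on_chart \<sigma> a (F + G) = on_chart \<sigma> a F + on_chart \<sigma> a G"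
  by (simp add: on_chart_eq emb_add distrib_right)

lemma on_chart_zero [simp]: "on_chart \<sigma> a 0 = 0"
  by (simp add: on_chart_eq)

lemma on_chart_sum: "on_chart \<sigma> a (\<Sum>i\<in>A. F i) = (\<Sum>i\<in>A. on_chart \<sigma> a (F i))"
  by (induction A rule: infinite_finite_induct) (auto simp: on_chart_add)

lemma on_chart_const: "on_chart \<sigma> 0 (single 0 c) = single 0 c"
proof -
  have "Poly_Mapping.map int (0 :: 'a \<times> nat \<Rightarrow>\<^sub>0 nat) = 0" by (rule poly_mapping_eqI) simp
  moreover have "chart_exp \<sigma> 0 = 0" by (simp add: chart_exp_def)
  ultimately show ?thesis by (simp add: on_chart_eq emb_single mult_single)
qed

lemma on_chart_var: "on_chart \<sigma> (axis (fst v) 1) (var v) = ratio \<sigma> v"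
proof -
  have "chart_exp \<sigma> (axis (fst v) 1) = (\<Sum>i\<in>UNIV. if i = fst v then single (fst v, \<sigma> (fst v)) 1 else 0)"
    unfolding chart_exp_def by (rule sum.cong) (auto simp: axis_def)
  then have "chart_exp \<sigma> (axis (fst v) 1) = single (fst v, \<sigma> (fst v)) 1" by simp
  then show ?thesis
    by (simp add: on_chart_eq var_def emb_single map_int_single mult_single ratio_def ratio_exp_def)
qed

lemma on_chart_mem:
  assumes \<sigma>: "\<sigma> \<in> charts n" and F: "F \<in> component (vars n) a"
  shows "on_chart \<sigma> a F \<in> sec n (inverted \<sigma>)"
proof -
  have "single (Poly_Mapping.map int m - chart_exp \<sigma> a) (lookup F m) \<in> sec n (inverted \<sigma>)"
    if m: "m \<in> keys F" for m
  proof (rule single_in_sec)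
    have mV: "keys m \<subseteq> vars n" "mdeg m = a" using F m by (auto simp: component_eq pol_def)
    show "Poly_Mapping.map int m - chart_exp \<sigma> a \<in> exps n (inverted \<sigma>)"
      unfolding exps_def
    proof (intro CollectI conjI allI impI)
      have "inverted \<sigma> \<subseteq> vars n" using chart_vars[OF \<sigma>] by (auto simp: inverted_def)
      then show "keys (Poly_Mapping.map int m - chart_exp \<sigma> a) \<subseteq> vars n"
        using keys_diff[of "Poly_Mapping.map int m" "chart_exp \<sigma> a"] mV keys_chart_exp[of \<sigma> a] by auto
      show "v \<in> inverted \<sigma>" if "lookup (Poly_Mapping.map int m - chart_exp \<sigma> a) v < 0" for v
      proof -
        have "lookup (chart_exp \<sigma> a) v \<noteq> 0" using that by (auto simp: lookup_minus)
        then show ?thesis using keys_chart_exp[of \<sigma> a] by (auto simp: in_keys_iff)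
      qed
      show "multidegree (Poly_Mapping.map int m - chart_exp \<sigma> a) = 0"
        using mV by (simp add: multidegree_diff mdeg_def)
    qed
  qed
  then show ?thesis unfolding on_chart_def chart_exp_def[symmetric] by (intro sec.sum_mem)
qed

text \<open>Vanishing forms are closed under addition within a degree and under multiplication by
  monomials, so the ideal they generate contains no further forms.\<close>

lemma vanishing_ideal_eq:
  fixes X :: "('q::finite, 'k::field) scheme_data"
  assumes X: "\<And>\<sigma>. \<sigma> \<in> charts n \<Longrightarrow> ideal_in (sec n (inverted \<sigma>)) (X \<sigma>)"
  shows "vanishing_ideal n X = {p \<in> pol (vars n). \<forall>a. hcomp a p \<in> vanishing_forms n X a}"
proof -
  let ?N = "{p \<in> pol (vars n). \<forall>a. hcomp a p \<in> vanishing_forms n X a}"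
  have vf_add: "F + G \<in> vanishing_forms n X a" if "F \<in> vanishing_forms n X a" "G \<in> vanishing_forms n X a" for F G a
    using that component_add[of F _ _ G] ideal_in.I_add[OF X] by (auto simp: vanishing_forms_def on_chart_add)
  have vf_zero: "0 \<in> vanishing_forms n X a" for a
    using ideal_in.I_zero[OF X] by (auto simp: vanishing_forms_def component_eq)
  have N: "ideal_in (pol (vars n)) ?N"
  proof
    fix r x :: "('q, 'k) polynomial" assume r: "r \<in> pol (vars n)" and x: "x \<in> ?N"
    have "\<forall>a. hcomp a (r * x) \<in> vanishing_forms n X a" using r
    proof (induction rule: pol_induct)
      case (add p m c)
      have "hcomp a (single m c * x) \<in> vanishing_forms n X a" for a
      proof -
        let ?s = "single m c"
        have s: "?s \<in> component (vars n) (mdeg m)" by (rule single_component[OF add(2)])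
        have h: "hcomp a (?s * x) = ?s * hcomp (a - mdeg m) x" using hcomp_mult[OF s, of x a] x by simp
        have hx: "hcomp (a - mdeg m) x \<in> vanishing_forms n X (a - mdeg m)" using x by blast
        have "?s * hcomp (a - mdeg m) x \<in> component (vars n) a"
          using component_mult[OF s, of "hcomp (a - mdeg m) x" "a - mdeg m"] hx
          by (simp add: vanishing_forms_def)
        moreover have "on_chart \<sigma> a (?s * hcomp (a - mdeg m) x) \<in> X \<sigma>" if \<sigma>: "\<sigma> \<in> charts n" for \<sigma>
          using on_chart_mult[of \<sigma> "mdeg m" "a - mdeg m" ?s "hcomp (a - mdeg m) x"]
            ideal_in.I_mult[OF X[OF \<sigma>] on_chart_mem[OF \<sigma> s]] hx \<sigma> by (simp add: vanishing_forms_def)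
        ultimately show ?thesis unfolding h vanishing_forms_def by blast
      qed
      then show ?case using add vf_add by (simp add: distrib_right hcomp_add)
    qed (simp add: vf_zero)
    then show "r * x \<in> ?N" using r x by (auto intro: pol.mult_mem)
  qed (auto simp: hcomp_add vf_zero intro: vf_add pol.add_mem)
  show ?thesis
    unfolding vanishing_ideal_def poly_ring_eq
  proof (rule pol.Idl_eqI[OF N])
    show "(\<Union>a. vanishing_forms n X a) \<subseteq> ?N"
    proof
      fix F assume "F \<in> (\<Union>a. vanishing_forms n X a)"
      then obtain a where F: "F \<in> vanishing_forms n X a" by blast
      then have Fc: "F \<in> component (vars n) a" by (simp add: vanishing_forms_def)
      have "hcomp b F \<in> vanishing_forms n X b" for b
        using hcomp_id[OF Fc] hcomp_other[OF Fc] F vf_zero by (cases "b = a") auto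
      then show "F \<in> ?N" using Fc by (auto simp: component_eq)
    qed
  next
    fix I' assume I': "ideal_in (pol (vars n)) I'" "(\<Union>a. vanishing_forms n X a) \<subseteq> I'"
    show "?N \<subseteq> I'"
    proof
      fix p assume "p \<in> ?N"
      then have "hcomp a p \<in> I'" for a using I'(2) by blast
      then show "p \<in> I'" using ideal_in.I_sum[OF I'(1)] hcomp_decomp[of p] by metis
    qed
  qed
qed

lemma vanishing_ideal_homogeneous:
  assumes X: "\<And>\<sigma>. \<sigma> \<in> charts n \<Longrightarrow> ideal_in (sec n (inverted \<sigma>)) (X \<sigma>)"
  shows "homogeneous_ideal (vars n) (vanishing_ideal n X)"
proof -
  have sub: "(\<Union>a. vanishing_forms n X a) \<subseteq> pol (vars n)"
    by (auto simp: vanishing_forms_def component_eq)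
  have id: "ideal_in (pol (vars n)) (vanishing_ideal n X)"
    unfolding vanishing_ideal_def poly_ring_eq by (rule pol.Idl_ideal_in[OF sub])
  have "\<forall>p\<in>vanishing_ideal n X. \<forall>a. hcomp a p \<in> vanishing_ideal n X"
  proof (intro ballI allI)
    fix p a assume "p \<in> vanishing_ideal n X"
    then have "hcomp a p \<in> vanishing_forms n X a" using vanishing_ideal_eq[OF X] by auto
    then show "hcomp a p \<in> vanishing_ideal n X"
      using pol.Idl_superset[OF sub] unfolding vanishing_ideal_def poly_ring_eq by blast
  qed
  then show ?thesis using id by (simp add: homogeneous_ideal_iff)
qed

lemma form_in_vanishing_ideal:
  assumes X: "\<And>\<sigma>. \<sigma> \<in> charts n \<Longrightarrow> ideal_in (sec n (inverted \<sigma>)) (X \<sigma>)"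
    and F: "F \<in> component (vars n) a"
  shows "F \<in> vanishing_ideal n X \<longleftrightarrow> (\<forall>\<sigma>\<in>charts n. on_chart \<sigma> a F \<in> X \<sigma>)"
proof
  assume "F \<in> vanishing_ideal n X"
  then have "hcomp a F \<in> vanishing_forms n X a" using vanishing_ideal_eq[OF X] by auto
  then show "\<forall>\<sigma>\<in>charts n. on_chart \<sigma> a F \<in> X \<sigma>" using hcomp_id[OF F] by (simp add: vanishing_forms_def)
next
  assume "\<forall>\<sigma>\<in>charts n. on_chart \<sigma> a F \<in> X \<sigma>"
  then have "F \<in> vanishing_forms n X a" using F by (simp add: vanishing_forms_def)
  moreover have "(\<Union>a. vanishing_forms n X a) \<subseteq> pol (vars n)"
    by (auto simp: vanishing_forms_def component_eq)
  ultimately show "F \<in> vanishing_ideal n X"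
    using pol.Idl_superset unfolding vanishing_ideal_def poly_ring_eq by blast
qed

section \<open>Zero-dimensional schemes avoid a general hyperplane in each factor\<close>

lemma on_chart_power:
  fixes p :: "('q::finite, 'k::field) polynomial"
  shows "on_chart \<sigma> (axis i (int k)) (p ^ k) = (on_chart \<sigma> (axis i 1) p) ^ k"
proof (induction k)
  case 0
  have z: "axis i (0::int) = 0" by (simp add: axis_def vec_eq_iff)
  have "on_chart \<sigma> 0 (1 :: ('q, 'k) polynomial) = 1" using on_chart_const[of \<sigma> "1::'k"] by simp
  then show ?case unfolding of_nat_0 z by simp
next
  case (Suc k)
  have "axis i (int (Suc k)) = axis i 1 + axis i (int k)" by (simp add: axis_add[symmetric])
  then show ?case using Suc on_chart_mult[of \<sigma> "axis i 1" "axis i (int k)" p "p ^ k"] by simp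
qed

lemma on_chart_scale: "on_chart \<sigma> a (single 0 c * p) = single 0 c * on_chart \<sigma> a p"
  using on_chart_mult[of \<sigma> 0 a "single 0 c" p] by (simp add: on_chart_const)

lemma on_chart_uminus: "on_chart \<sigma> a (- p) = - on_chart \<sigma> a p"
  using on_chart_add[of \<sigma> a p "- p"] by (simp add: eq_neg_iff_add_eq_0 add.commute)

lemma on_chart_diff: "on_chart \<sigma> a (p - q) = on_chart \<sigma> a p - on_chart \<sigma> a q"
  using on_chart_add[of \<sigma> a p "- q"] by (simp add: on_chart_uminus)

lemma on_chart_prod:
  "on_chart \<sigma> (\<Sum>i\<in>A. d i) (\<Prod>i\<in>A. p i) = (\<Prod>i\<in>A. on_chart \<sigma> (d i) (p i))"
proof (induction A rule: infinite_finite_induct)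
  case (insert x A)
  then show ?case by (simp add: on_chart_mult)
qed (use on_chart_const[of \<sigma> 1] in simp_all)

lemma component_prod:
  "(\<And>i. i \<in> A \<Longrightarrow> p i \<in> component V (d i)) \<Longrightarrow> (\<Prod>i\<in>A. p i) \<in> component V (\<Sum>i\<in>A. d i)"
proof (induction A rule: infinite_finite_induct)
  case (insert x A)
  then show ?case by (auto intro: component_mult)
qed (use const_component[of 1 V] in simp_all)

lemma (in ideal_in) cong_prod:
  "(\<And>i. i \<in> A \<Longrightarrow> x i \<in> R \<and> y i \<in> R \<and> x i - y i \<in> I) \<Longrightarrow> (\<Prod>i\<in>A. x i) - (\<Prod>i\<in>A. y i) \<in> I"
proof (induction A rule: infinite_finite_induct)
  case (insert a A)
  have "x a * (\<Prod>i\<in>A. x i) - y a * (\<Prod>i\<in>A. y i) \<in> I"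
    by (rule cong_mult) (use insert in \<open>auto intro!: prod_mem\<close>)
  then show ?case using insert by simp
qed auto

lemma on_chart_lin_form:
  fixes c :: "'q::finite \<Rightarrow> nat \<Rightarrow> 'k::field"
  shows "on_chart \<sigma> (axis i 1) (lin_form n c i)
    = ratio \<sigma> (i, 0) + (\<Sum>j = 1..n i. single 0 (c i j) * ratio \<sigma> (i, j))"
proof -
  have "on_chart \<sigma> (axis i 1) (var (i, j) :: ('q, 'k) polynomial) = ratio \<sigma> (i, j)" for j
    using on_chart_var[of \<sigma> "(i, j)"] by simp
  then show ?thesis by (simp add: lin_form_def on_chart_add on_chart_sum on_chart_scale)
qed

text \<open>Here \<open>w\<close> inverts \<open>u\<close> modulo \<open>I\<close>, so
  \<open>y * w\<close> stands for \<open>y / u\<close>; multiplying its monic equation by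
  \<open>u ^ D\<close> clears the denominators.\<close>

lemma (in ideal_in) homogenize_relation:
  assumes u: "u \<in> R" and w: "w \<in> R" "u * w - 1 \<in> I" and y: "y \<in> R" and k: "\<And>t. k t \<in> R"
    and rel: "(y * w) ^ D - (\<Sum>t<D. k t * (y * w) ^ t) \<in> I"
  shows "y ^ D - (\<Sum>t<D. k t * (y ^ t * u ^ (D - t))) \<in> I"
proof -
  have uw: "1 - (u * w) ^ t \<in> I" for t
  proof (induction t)
    case (Suc t)
    have "(1 - (u * w) ^ t) + (u * w) ^ t * - (u * w - 1) \<in> I"
      by (rule I_add[OF Suc I_mult[OF _ I_uminus[OF w(2)]]]) (use u w in \<open>auto intro: power_mem mult_mem\<close>)
    then show ?case by (simp add: algebra_simps)
  qed simp
  \<comment> \<open>Besides this multiple of the relation, two corrections are collected that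
    replace the powers of \<open>u * w\<close> by 1.\<close>
  have 1: "u ^ D * ((y * w) ^ D - (\<Sum>t<D. k t * (y * w) ^ t)) \<in> I"
    by (rule I_mult[OF _ rel]) (use u in \<open>auto intro: power_mem\<close>)
  have 2: "y ^ D * (1 - (u * w) ^ D) \<in> I" by (rule I_mult[OF _ uw]) (use y in \<open>auto intro: power_mem\<close>)
  have 3: "(\<Sum>t<D. (k t * (y ^ t * u ^ (D - t))) * (1 - (u * w) ^ t)) \<in> I"
    by (rule I_sum, rule I_mult[OF _ uw]) (use y u k in \<open>auto intro!: power_mem mult_mem\<close>)
  have "u ^ D * (\<Sum>t<D. k t * (y * w) ^ t) = (\<Sum>t<D. (k t * (y ^ t * u ^ (D - t))) * (u * w) ^ t)"
    unfolding sum_distrib_left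
  proof (rule sum.cong[OF refl])
    fix t assume "t \<in> {..<D}"
    then have "u ^ D = u ^ (D - t) * u ^ t" by (simp add: power_add[symmetric])
    then show "u ^ D * (k t * (y * w) ^ t) = k t * (y ^ t * u ^ (D - t)) * (u * w) ^ t"
      by (simp add: power_mult_distrib ac_simps)
  qed
  then have "u ^ D * ((y * w) ^ D - (\<Sum>t<D. k t * (y * w) ^ t)) + y ^ D * (1 - (u * w) ^ D)
      - (\<Sum>t<D. (k t * (y ^ t * u ^ (D - t))) * (1 - (u * w) ^ t))
      = y ^ D - (\<Sum>t<D. k t * (y ^ t * u ^ (D - t)))"
    by (simp add: right_diff_distrib sum_subtractf power_mult_distrib ac_simps)
  moreover have "u ^ D * ((y * w) ^ D - (\<Sum>t<D. k t * (y * w) ^ t)) + y ^ D * (1 - (u * w) ^ D)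
      - (\<Sum>t<D. (k t * (y ^ t * u ^ (D - t))) * (1 - (u * w) ^ t)) \<in> I"
    by (rule I_diff[OF I_add[OF 1 2] 3])
  ultimately show ?thesis by simp
qed

lemma irrelevant_ideal: "ideal_in (pol V) {p \<in> pol V. lookup p 0 = 0}"
proof
  fix r x :: "('a, 'b) polynomial"
  assume r: "r \<in> pol V" and x: "x \<in> {p \<in> pol V. lookup p 0 = 0}"
  have "0 \<notin> keys (r * x)"
  proof
    assume "0 \<in> keys (r * x)"
    then obtain a b where ab: "0 = a + b" "b \<in> keys x" using keys_mult[of r x] by blast
    have "b = 0"
    proof (rule poly_mapping_eqI)
      fix v
      have "lookup a v + lookup b v = 0"
        using ab(1) by (metis lookup_add lookup_zero)
      then show "lookup b v = lookup 0 v" by simp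
    qed
    then show False using ab(2) x by (simp add: in_keys_iff)
  qed
  then show "r * x \<in> {p \<in> pol V. lookup p 0 = 0}" using r x by (auto simp: in_keys_iff intro: pol.mult_mem)
qed (auto simp: lookup_add intro: pol.add_mem)

lemma mdeg_eq_zero: "mdeg m = 0 \<Longrightarrow> m = 0"
proof (rule poly_mapping_eqI)
  fix v assume "mdeg m = 0"
  then show "lookup m v = lookup 0 v" using lookup_le_mdeg[of m v] by simp
qed

lemma component_lookup_zero:
  assumes "p \<in> component V a" "a \<noteq> 0"
  shows "lookup p 0 = 0"
proof (rule ccontr)
  assume "lookup p 0 \<noteq> 0"
  then have "0 \<in> keys p" by (simp add: in_keys_iff)
  then have "mdeg 0 = a" using assms(1) unfolding component_eq by blast
  then show False using assms(2) by simp
qed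

theorem acm_artinian_quotient:
  fixes n :: "'q::finite \<Rightarrow> nat" and X :: "('q, 'k::field) scheme_data"
  assumes inf: "infinite (UNIV :: 'k set)" and zd: "zero_dimensional_subscheme n X" and acm: "ACM n X"
  shows "\<exists>J :: ('q, 'k) polynomial set. artinian_graded_quotient n J \<and>
    difference (hilbert (vars n) (vanishing_ideal n X)) = hilbert (vars0 n) J"
proof -
  let ?V = "vars n" and ?S = "\<lambda>\<sigma>. sec n (inverted \<sigma>) :: ('q, 'k) laurent set"
  define I where "I = vanishing_ideal n X"
  have X: "ideal_in (?S \<sigma>) (X \<sigma>)" if "\<sigma> \<in> charts n" for \<sigma>
    using zd that by (simp add: zero_dimensional_subscheme_def closed_subscheme_def sections_eq sec.ideal_ring_on_iff)
  have fc: "sec.finite_codim n (inverted \<sigma>) (X \<sigma>)" if \<sigma>: "\<sigma> \<in> charts n" for \<sigma>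
  proof -
    have "krull_dim (sections n (inverted \<sigma>) Quot X \<sigma>) \<le> scheme_dim n X"
      unfolding scheme_dim_def by (rule SUP_upper[OF \<sigma>])
    then have "krull_dim (ring_on (?S \<sigma>) Quot X \<sigma>) = 0"
      using zd by (simp add: zero_dimensional_subscheme_def sections_eq)
    then show ?thesis
      by (rule sec.krull_dim_0_finite_codim[OF X[OF \<sigma>] _ finite_imageI[OF finite_vars] sec_alg_span[OF \<sigma>]])
  qed
  \<comment> \<open>The default 0 makes \<open>y\<close> total within the ring, as
    \<open>finite_nonunits\<close> asks for \<open>y j \<in> R\<close> at every index. At
    \<open>j = \<sigma> i\<close> the ratio is 1, the member equal to 1 required there.\<close>
  define y where "y \<sigma> i j = (if j \<le> n i then ratio \<sigma> (i, j) else 0 :: ('q, 'k) laurent)" for \<sigma> i j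
  define bad where "bad \<sigma> i = {s. \<not> sec.unit_mod n (inverted \<sigma>) (X \<sigma>) (\<Sum>j\<le>n i. single 0 (s ^ j) * y \<sigma> i j)}" for \<sigma> i
  have "finite (bad \<sigma> i)" if \<sigma>: "\<sigma> \<in> charts n" for \<sigma> i
    unfolding bad_def
  proof (rule sec.finite_nonunits[OF X[OF \<sigma>] fc[OF \<sigma>]])
    show "y \<sigma> i j \<in> ?S \<sigma>" for j
      using ratio_mem[OF \<sigma>, of "(i, j)"] by (auto simp: y_def vars_def)
    show "\<sigma> i \<le> n i" using \<sigma> by (simp add: charts_def)
    then show "y \<sigma> i (\<sigma> i) = 1" by (simp add: y_def)
  qed
  then have "finite (\<Union>\<sigma>\<in>charts n. \<Union>i. bad \<sigma> i)" by (intro finite_UN_I finite_charts) simp_all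
  then obtain s where s: "s \<notin> (\<Union>\<sigma>\<in>charts n. \<Union>i. bad \<sigma> i)" using ex_new_if_finite[OF inf] by blast
  \<comment> \<open>At \<open>j = 0\<close> this would be \<open>s ^ 0 = 1\<close>, in accordance
    with the normalization of \<open>lin_form\<close>.\<close>
  define c where "c i j = s ^ j" for i :: 'q and j
  let ?l = "lin_form n c"
  have unit: "sec.unit_mod n (inverted \<sigma>) (X \<sigma>) (on_chart \<sigma> (axis i 1) (?l i))" if \<sigma>: "\<sigma> \<in> charts n" for \<sigma> i
  proof -
    have "{..n i} = insert 0 {1..n i}" by auto
    then have "(\<Sum>j\<le>n i. single 0 (s ^ j) * y \<sigma> i j)
        = single 0 1 * y \<sigma> i 0 + (\<Sum>j = 1..n i. single 0 (s ^ j) * y \<sigma> i j)" by simp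
    also have "\<dots> = on_chart \<sigma> (axis i 1) (?l i)"
      unfolding on_chart_lin_form by (simp add: y_def c_def)
    finally have "(\<Sum>j\<le>n i. single 0 (s ^ j) * y \<sigma> i j) = on_chart \<sigma> (axis i 1) (?l i)" .
    moreover have "s \<notin> bad \<sigma> i" using s \<sigma> by blast
    ultimately show ?thesis by (simp add: bad_def)
  qed
  obtain qs :: "'q list" where qs: "set qs = UNIV" "distinct qs"
    using finite_distinct_list[of "UNIV :: 'q set"] by auto
  define L where "L = pol.adj ?V I (map ?l qs)"
  have hom: "homogeneous_ideal ?V I" unfolding I_def by (rule vanishing_ideal_homogeneous[OF X])
  have I': "ideal_in (pol ?V) I" using hom by (simp add: homogeneous_ideal_iff)
  have lc: "?l i \<in> component ?V (axis i 1)" for i by (rule lin_form_component)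
  have lV: "?l i \<in> pol ?V" for i using lc[of i] by (simp add: component_eq)
  have Lid: "ideal_in (pol ?V) L" unfolding L_def by (rule pol.adj_ideal[OF I']) (use lV in auto)
  interpret L: ideal_in "pol ?V" L by (rule Lid)
  have IL: "I \<union> set (map ?l qs) \<subseteq> L" unfolding L_def by (rule pol.adj_superset[OF I']) (use lV in auto)
  then have lL: "?l i \<in> L" for i using qs by auto

  have nil: "\<exists>t. var v ^ t \<in> L" if v: "v \<in> ?V" for v
  proof -
    define i where "i = fst v"
    let ?x = "var v :: ('q, 'k) polynomial"
    have xc: "?x \<in> component ?V (axis i 1)" unfolding i_def by (rule var_component[OF v])
    have xV: "?x \<in> pol ?V" using xc by (simp add: component_eq)
    have "\<exists>F D. F \<in> component ?V (axis i (int D)) \<and> on_chart \<sigma> (axis i (int D)) F \<in> X \<sigma> \<and> ?x ^ D - F \<in> L"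
      if \<sigma>: "\<sigma> \<in> charts n" for \<sigma>
    proof -
      interpret X: ideal_in "?S \<sigma>" "X \<sigma>" by (rule X[OF \<sigma>])
      let ?u = "on_chart \<sigma> (axis i 1) (?l i)"
      have uR: "?u \<in> ?S \<sigma>" by (rule on_chart_mem[OF \<sigma> lc])
      have yR: "ratio \<sigma> v \<in> ?S \<sigma>" by (rule ratio_mem[OF \<sigma> v])
      obtain w where w: "w \<in> ?S \<sigma>" "?u * w - 1 \<in> X \<sigma>" using unit[OF \<sigma>] by (auto simp: sec.unit_mod_def)
      obtain D k where k: "(ratio \<sigma> v * w) ^ D - (\<Sum>j<D. single 0 (k j) * (ratio \<sigma> v * w) ^ j) \<in> X \<sigma>"
        using sec.finite_codim_monic[OF X[OF \<sigma>] fc[OF \<sigma>] sec.mult_mem[OF yR w(1)]] by (elim exE)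
      \<comment> \<open>The homogenization of the monic equation for
        \<open>ratio \<sigma> v * w\<close>, with the linear form as homogenizing variable. Every
        term but the first contains \<open>?l i\<close>, so \<open>F\<close> is congruent to
        \<open>?x ^ D\<close> modulo \<open>L\<close>.\<close>
      define F where "F = ?x ^ D - (\<Sum>t<D. single 0 (k t) * (?x ^ t * ?l i ^ (D - t)))"
      have tc: "?x ^ t * ?l i ^ (D - t) \<in> component ?V (axis i (int D))" if "t < D" for t
      proof -
        have "axis i (int D) = axis i (int t) + axis i (int (D - t))"
          using that by (simp add: axis_add[symmetric])
        then show ?thesis using component_mult[OF component_power[OF xc] component_power[OF lc]] by simp
      qed
      have "(\<Sum>t<D. single 0 (k t) * (?x ^ t * ?l i ^ (D - t))) \<in> component ?V (axis i (int D))"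
      proof (rule component_sum)
        fix t assume "t \<in> {..<D}"
        then show "single 0 (k t) * (?x ^ t * ?l i ^ (D - t)) \<in> component ?V (axis i (int D))"
          using component_mult[OF const_component tc[of t]] by simp
      qed
      then have Fc: "F \<in> component ?V (axis i (int D))"
        unfolding F_def by (rule pol.lin_subspace_diff[OF lin_subspace_component component_power[OF xc]])
      have ov: "on_chart \<sigma> (axis i 1) ?x = ratio \<sigma> v" unfolding i_def by (rule on_chart_var)
      have oc: "on_chart \<sigma> (axis i (int D)) (?x ^ t * ?l i ^ (D - t)) = ratio \<sigma> v ^ t * ?u ^ (D - t)" if "t < D" for t
      proof -
        have "axis i (int D) = axis i (int t) + axis i (int (D - t))"
          using that by (simp add: axis_add[symmetric])
        then show ?thesis
          using on_chart_mult[of \<sigma> "axis i (int t)" "axis i (int (D - t))" "?x ^ t" "?l i ^ (D - t)"]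
            ov by (simp add: on_chart_power)
      qed
      have "on_chart \<sigma> (axis i (int D)) F
          = ratio \<sigma> v ^ D - (\<Sum>t<D. single 0 (k t) * (ratio \<sigma> v ^ t * ?u ^ (D - t)))"
        by (simp add: F_def on_chart_diff on_chart_sum on_chart_scale on_chart_power oc ov)
      also have "\<dots> \<in> X \<sigma>"
        by (rule X.homogenize_relation[OF uR w yR sec.scalar_mem k])
      finally have "on_chart \<sigma> (axis i (int D)) F \<in> X \<sigma>" .
      moreover have "?x ^ D - F \<in> L"
      proof -
        have "(\<Sum>t<D. single 0 (k t) * (?x ^ t * ?l i ^ (D - t))) \<in> L"
        proof (rule L.I_sum)
          fix t assume "t \<in> {..<D}"
          then have e: "D - t = Suc (D - Suc t)" by simp
          have "(single 0 (k t) * (?x ^ t * ?l i ^ (D - Suc t))) * ?l i \<in> L"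
            by (rule L.I_mult[OF _ lL]) (use xV lV in \<open>intro pol.mult_mem pol.power_mem pol.scalar_mem\<close>)
          then show "single 0 (k t) * (?x ^ t * ?l i ^ (D - t)) \<in> L"
            unfolding e by (simp add: ac_simps)
        qed
        then show ?thesis by (simp add: F_def)
      qed
      ultimately show ?thesis using Fc by blast
    qed
    then have "\<exists>F D. \<forall>\<sigma>\<in>charts n. F \<sigma> \<in> component ?V (axis i (int (D \<sigma>))) \<and>
        on_chart \<sigma> (axis i (int (D \<sigma>))) (F \<sigma>) \<in> X \<sigma> \<and> ?x ^ D \<sigma> - F \<sigma> \<in> L" by metis
    then obtain F D where FD: "\<And>\<sigma>. \<sigma> \<in> charts n \<Longrightarrow> F \<sigma> \<in> component ?V (axis i (int (D \<sigma>)))"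
      "\<And>\<sigma>. \<sigma> \<in> charts n \<Longrightarrow> on_chart \<sigma> (axis i (int (D \<sigma>))) (F \<sigma>) \<in> X \<sigma>"
      "\<And>\<sigma>. \<sigma> \<in> charts n \<Longrightarrow> ?x ^ D \<sigma> - F \<sigma> \<in> L" by metis
    \<comment> \<open>\<open>F \<sigma>\<close> is known to vanish on \<open>X\<close> only in the
      chart \<sigma>; in the product each chart finds its own factor.\<close>
    let ?P = "\<Prod>\<sigma>\<in>charts n. F \<sigma>" and ?d = "\<Sum>\<sigma>\<in>charts n. axis i (int (D \<sigma>))"
    have Pc: "?P \<in> component ?V ?d" by (rule component_prod) (rule FD(1))
    have "on_chart \<tau> ?d ?P \<in> X \<tau>" if \<tau>: "\<tau> \<in> charts n" for \<tau>
    proof -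
      interpret X: ideal_in "?S \<tau>" "X \<tau>" by (rule X[OF \<tau>])
      have "on_chart \<tau> ?d ?P = on_chart \<tau> (axis i (int (D \<tau>))) (F \<tau>)
          * (\<Prod>\<sigma>\<in>charts n - {\<tau>}. on_chart \<tau> (axis i (int (D \<sigma>))) (F \<sigma>))"
        unfolding on_chart_prod by (rule prod.remove[OF finite_charts \<tau>])
      also have "\<dots> \<in> X \<tau>"
        by (rule X.I_mult2[OF _ FD(2)[OF \<tau>]]) (use FD(1) on_chart_mem[OF \<tau>] in \<open>auto intro!: sec.prod_mem\<close>)
      finally show ?thesis .
    qed
    then have "?P \<in> I" unfolding I_def using form_in_vanishing_ideal[OF X Pc] by blast
    then have PL: "?P \<in> L" using IL by blast
    have "(\<Prod>\<sigma>\<in>charts n. ?x ^ D \<sigma>) - ?P \<in> L"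
      by (rule L.cong_prod) (use FD(1,3) xV pol.power_mem in \<open>auto simp: component_eq\<close>)
    then have "(\<Prod>\<sigma>\<in>charts n. ?x ^ D \<sigma>) \<in> L" using PL by (rule L.cong_mem)
    then show ?thesis by (auto simp: power_sum[symmetric])
  qed

  \<comment> \<open>\<open>L\<close> stays inside the irrelevant ideal: the linear forms have no
    constant term, and a nonzero constant in \<open>I\<close> would make every chart ideal the whole
    ring, although \<open>X\<close> is nonempty.\<close>
  have proper: "1 \<notin> L"
  proof
    assume "1 \<in> L"
    let ?m = "{p \<in> pol ?V. lookup p 0 = (0::'k)}"
    have "I \<subseteq> ?m"
    proof
      fix p assume p: "p \<in> I"
      have pV: "p \<in> pol ?V" using ideal_in.I_memR[OF I' p] .
      have "lookup p 0 = 0"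
      proof (rule ccontr)
        assume p0: "lookup p 0 \<noteq> 0"
        define k where "k = lookup p 0"
        have "hcomp 0 p = single 0 k"
          by (rule poly_mapping_eqI) (auto simp: lookup_hcomp lookup_single k_def "when_def" dest: mdeg_eq_zero)
        then have "single 0 k \<in> I" using hom p by (metis homogeneous_ideal_iff)
        then have mem: "single 0 k \<in> X \<sigma>" if "\<sigma> \<in> charts n" for \<sigma>
          unfolding I_def using form_in_vanishing_ideal[OF X const_component, of k] that by (simp add: on_chart_const)
        have "X \<sigma> = ?S \<sigma>" if \<sigma>: "\<sigma> \<in> charts n" for \<sigma>
        proof -
          have "single 0 (inverse k) * single 0 k \<in> X \<sigma>"
            by (rule ideal_in.I_mult[OF X[OF \<sigma>] sec.scalar_mem mem[OF \<sigma>]])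
          then have "1 \<in> X \<sigma>" using p0 by (simp add: k_def mult_single)
          then show ?thesis using ideal_in.eq_carrier_iff[OF X[OF \<sigma>]] by simp
        qed
        then show False using zd
          by (auto simp: zero_dimensional_subscheme_def nonempty_scheme_def sections_eq)
      qed
      then show "p \<in> ?m" using pV by simp
    qed
    moreover have "set (map ?l qs) \<subseteq> ?m"
    proof -
      have "axis i 1 \<noteq> (0 :: int ^ 'q)" for i by (simp add: axis_eq_0_iff)
      then show ?thesis using component_lookup_zero[OF lc] lV by auto
    qed
    ultimately have "L \<subseteq> ?m" unfolding L_def by (intro pol.adj_minimal[OF irrelevant_ideal])
    then show False using \<open>1 \<in> L\<close> by (auto simp: lookup_one)
  qed

  have len: "length qs = CARD('q)" using qs distinct_card by metis
  have nzd: "u \<in> pol.adj ?V I (map ?l ys)"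
    if "qs = xs @ i # ys" "u \<in> pol ?V" "?l i * u \<in> pol.adj ?V I (map ?l ys)" for xs i ys u
  proof (rule depth_ge_nzd[OF hom lc _ _ that])
    show "\<exists>t. var v ^ t \<in> pol.adj ?V I (map ?l qs)" if "v \<in> ?V" for v using nil[OF that] by (simp add: L_def)
    show "enat (length qs) \<le> depth ?V I" using acm by (simp add: ACM_def I_def len)
  qed
  have nil0: "\<exists>t. var v ^ t \<in> L" if "v \<in> vars0 n" for v using nil that vars0_subset by blast
  show ?thesis
  proof (intro exI[of _ "L \<inter> pol (vars0 n)"] conjI)
    show "artinian_graded_quotient n (L \<inter> pol (vars0 n))"
      by (rule artinian_reduction(1)[OF hom qs(2,1) _ L_def _ proper]) (erule (2) nzd, erule nil0)
    show "difference (hilbert ?V (vanishing_ideal n X)) = hilbert (vars0 n) (L \<inter> pol (vars0 n))"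
      unfolding I_def[symmetric]
      by (rule artinian_reduction(2)[OF hom qs(2,1) _ L_def _ proper]) (erule (2) nzd, erule nil0)
  qed
qed

section \<open>Extending an ideal of the smaller polynomial ring\<close>

text \<open>With \<open>npart\<close>, the splitting of monomials that exhibits the full ring as
  polynomials in the \<open>x_i0\<close> over the smaller ring.\<close>

definition zpart :: "('q \<times> nat \<Rightarrow>\<^sub>0 nat) \<Rightarrow> ('q \<times> nat \<Rightarrow>\<^sub>0 nat)" where
  "zpart m = (\<Sum>v | v \<in> keys m \<and> snd v = 0. single v (lookup m v))"

definition npart :: "('q \<times> nat \<Rightarrow>\<^sub>0 nat) \<Rightarrow> ('q \<times> nat \<Rightarrow>\<^sub>0 nat)" where
  "npart m = m - zpart m"

lemma lookup_zpart: "lookup (zpart m) v = (if snd v = 0 then lookup m v else 0)"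
proof -
  let ?A = "{v. v \<in> keys m \<and> snd v = 0}"
  have fin: "finite ?A" by (rule finite_subset[of _ "keys m"]) auto
  have "lookup (zpart m) v = (\<Sum>w\<in>?A. if w = v then lookup m v else 0)"
    unfolding zpart_def lookup_sum by (rule sum.cong) (auto simp: lookup_single)
  then show ?thesis using fin by (auto simp: in_keys_iff)
qed

lemma lookup_npart: "lookup (npart m) v = (if snd v = 0 then 0 else lookup m v)"
  by (simp add: npart_def lookup_minus lookup_zpart)

lemma npart_zpart: "npart m + zpart m = m"
  by (rule poly_mapping_eqI) (simp add: lookup_add lookup_npart lookup_zpart)

lemma zpart_add: "zpart (m + m') = zpart m + zpart m'"
  by (rule poly_mapping_eqI) (simp add: lookup_add lookup_zpart)

lemma npart_add: "npart (m + m') = npart m + npart m'"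
  by (rule poly_mapping_eqI) (simp add: lookup_add lookup_npart)

lemma keys_npart: "keys m \<subseteq> vars n \<Longrightarrow> keys (npart m) \<subseteq> vars0 n"
proof
  fix v assume m: "keys m \<subseteq> vars n" and v: "v \<in> keys (npart m)"
  then have "snd v \<noteq> 0" "v \<in> keys m" by (auto simp: in_keys_iff lookup_npart split: if_splits)
  then show "v \<in> vars0 n" using m by (cases v) (auto simp: vars_def vars0_def)
qed

lemma zpart_zero [simp]: "zpart 0 = 0"
  by (simp add: zpart_def)

lemma zpart_npart_vars0:
  assumes "keys m \<subseteq> vars0 n"
  shows "zpart m = 0" "npart m = m"
proof -
  show "zpart m = 0"
  proof (rule poly_mapping_eqI)
    fix v
    have "lookup m v = 0" if "snd v = 0"
    proof (rule ccontr)
      assume "lookup m v \<noteq> 0"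
      then have "v \<in> vars0 n" using assms by (auto simp: in_keys_iff)
      then show False using that by (cases v) (simp add: vars0_def)
    qed
    then show "lookup (zpart m) v = lookup 0 v" by (simp add: lookup_zpart)
  qed
  then show "npart m = m" using npart_zpart[of m] by simp
qed

lemma zpart_npart_zero_vars:
  assumes "\<And>v. v \<in> keys m \<Longrightarrow> snd v = 0"
  shows "zpart m = m" "npart m = 0"
proof -
  show "zpart m = m"
  proof (rule poly_mapping_eqI)
    fix v
    have "lookup m v = 0" if "snd v \<noteq> 0" using assms[of v] that unfolding in_keys_iff by blast
    then show "lookup (zpart m) v = lookup m v" by (simp add: lookup_zpart)
  qed
  then show "npart m = 0" by (simp add: npart_def)
qed

text \<open>\<open>slice \<nu> p\<close> is the coefficient of the monomial \<open>\<nu>\<close> in the variables \<open>x_i0\<close>.\<close>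

definition slice :: "('q \<times> nat \<Rightarrow>\<^sub>0 nat) \<Rightarrow> ('q, 'k::field) polynomial \<Rightarrow> ('q, 'k) polynomial" where
  "slice \<nu> p = (\<Sum>m | m \<in> keys p \<and> zpart m = \<nu>. single (npart m) (lookup p m))"

lemma slice_superset:
  assumes "finite A" "keys p \<subseteq> A"
  shows "slice \<nu> p = (\<Sum>m\<in>A. if zpart m = \<nu> then single (npart m) (lookup p m) else 0)"
  unfolding slice_def
  by (rule sum.mono_neutral_cong_left) (use assms in \<open>auto simp: in_keys_iff\<close>)

lemma slice_zero [simp]: "slice \<nu> 0 = 0"
  by (simp add: slice_def)

lemma slice_add: "slice \<nu> (p + q) = slice \<nu> p + slice \<nu> q"
proof -
  let ?A = "keys p \<union> keys q"
  have sub: "finite ?A" "keys (p + q) \<subseteq> ?A" "keys p \<subseteq> ?A"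
    "keys q \<subseteq> ?A" using Poly_Mapping.keys_add[of p q] by auto
  show ?thesis
    unfolding slice_superset[OF sub(1,2)] slice_superset[OF sub(1,3)] slice_superset[OF sub(1,4)]
      sum.distrib[symmetric]
    by (rule sum.cong) (simp_all add: lookup_add single_add)
qed

lemma slice_single: "slice \<nu> (single m c) = (if zpart m = \<nu> then single (npart m) c else 0)"
  using slice_superset[of "{m}" "single m c" \<nu>] by simp

lemma slice_mult: "slice (zpart u + \<nu>) (single u c * p) = single (npart u) c * slice \<nu> p"
  using pol_UNIV[of p]
  by (induction rule: pol_induct)
    (auto simp: distrib_left slice_add mult_single slice_single zpart_add npart_add)

lemma slice_mult_zero:
  assumes "\<And>\<nu>'. \<nu> \<noteq> zpart u + \<nu>'"
  shows "slice \<nu> (single u c * p) = 0"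
  using pol_UNIV[of p]
proof (induction rule: pol_induct)
  case (add p m k)
  then show ?case using assms[of "zpart m"]
    by (auto simp: distrib_left slice_add mult_single slice_single zpart_add)
qed simp

lemma slice_hcomp: "slice \<nu> (hcomp a p) = hcomp (a - mdeg \<nu>) (slice \<nu> p)"
  using pol_UNIV[of p]
proof (induction rule: pol_induct)
  case (add p m c)
  have "mdeg m = mdeg (npart m) + mdeg (zpart m)" by (simp add: mdeg_add[symmetric] npart_zpart)
  then have "slice \<nu> (hcomp a (single m c)) = hcomp (a - mdeg \<nu>) (slice \<nu> (single m c))"
    by (auto simp: hcomp_single slice_single)
  then show ?case using add by (simp add: hcomp_add slice_add)
qed simp

lemma slice_vars0: "p \<in> pol (vars0 n) \<Longrightarrow> slice \<nu> p = (if \<nu> = 0 then p else 0)"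
  by (induction rule: pol_induct) (auto simp: slice_add slice_single zpart_npart_vars0)

text \<open>\<open>ext n J T\<close> is the ideal generated by \<open>J\<close> and the variables \<open>x_i0\<close> with \<open>i \<in> T\<close>.\<close>

definition ext :: "('q \<Rightarrow> nat) \<Rightarrow> ('q, 'k::field) polynomial set \<Rightarrow> 'q set \<Rightarrow> ('q, 'k) polynomial set" where
  "ext n J T = {p \<in> pol (vars n). \<forall>\<nu>. (\<forall>i\<in>T. lookup \<nu> (i, 0) = 0) \<longrightarrow> slice \<nu> p \<in> J}"

section \<open>Regularity of the variables \<open>x_i0\<close> on the extended ideal\<close>

context
  fixes n :: "'q::finite \<Rightarrow> nat" and J :: "('q, 'k::field) polynomial set"
  assumes J: "homogeneous_ideal (vars0 n) J"
begin

lemma J_ideal: "ideal_in (pol (vars0 n)) J"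
  using J by (simp add: homogeneous_ideal_iff)

interpretation J: ideal_in "pol (vars0 n)" J by (rule J_ideal)

lemma ext_ideal: "ideal_in (pol (vars n)) (ext n J T)"
proof
  show "ext n J T \<subseteq> pol (vars n)" by (auto simp: ext_def)
  show "0 \<in> ext n J T" by (simp add: ext_def)
  show "x + y \<in> ext n J T" if "x \<in> ext n J T" "y \<in> ext n J T" for x y
    using that by (auto simp: ext_def slice_add intro: pol.add_mem J.I_add)
next
  fix r x :: "('q, 'k) polynomial" assume r: "r \<in> pol (vars n)" and x: "x \<in> ext n J T"
  have "\<forall>\<nu>. (\<forall>i\<in>T. lookup \<nu> (i, 0) = 0) \<longrightarrow> slice \<nu> (r * x) \<in> J" using r
  proof (induction rule: pol_induct)
    case (add p u c)
    have "slice \<nu> (single u c * x) \<in> J" if \<nu>: "\<forall>i\<in>T. lookup \<nu> (i, 0) = 0" for \<nu>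
    \<comment> \<open>Either the \<open>x_i0\<close>-part of the monomial divides \<nu>, and the
      slice comes from a slice of \<open>x\<close> whose index still avoids \<open>T\<close>, or the
      slice vanishes.\<close>
    proof (cases "\<exists>\<nu>'. \<nu> = zpart u + \<nu>'")
      case True
      then obtain \<nu>' where \<nu>': "\<nu> = zpart u + \<nu>'" by blast
      have "\<forall>i\<in>T. lookup \<nu>' (i, 0) = 0" using \<nu> by (simp add: \<nu>' lookup_add)
      then have "slice \<nu>' x \<in> J" using x by (simp add: ext_def)
      moreover have "single (npart u) c \<in> pol (vars0 n)"
        by (rule single_in_pol[OF keys_npart[OF add(2)]])
      ultimately show ?thesis unfolding \<nu>' slice_mult by (intro J.I_mult)
    next
      case False
      then show ?thesis using slice_mult_zero[of \<nu> u c x] by simp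
    qed
    then show ?case using add(3) by (simp add: distrib_right slice_add J.I_add)
  qed simp
  then show "r * x \<in> ext n J T" using r x by (auto simp: ext_def intro: pol.mult_mem)
qed

lemma ext_homogeneous: "homogeneous_ideal (vars n) (ext n J T)"
  unfolding homogeneous_ideal_iff
proof (intro conjI ballI allI)
  show "ideal_in (pol (vars n)) (ext n J T)" by (rule ext_ideal)
  show "hcomp a p \<in> ext n J T" if "p \<in> ext n J T" for p a
    using that J by (auto simp: ext_def slice_hcomp homogeneous_ideal_iff intro: hcomp_mem)
qed

lemma J_subset_ext: "J \<subseteq> ext n J T"
proof
  fix p assume p: "p \<in> J"
  then have p0: "p \<in> pol (vars0 n)" by (rule J.I_memR)
  then have "p \<in> pol (vars n)" using vars0_subset by (auto simp: pol_def)
  then show "p \<in> ext n J T" using p slice_vars0[OF p0] by (simp add: ext_def)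
qed

lemma ext_inter: "ext n J T \<inter> pol (vars0 n) = J"
proof (intro equalityI subsetI)
  fix p assume p: "p \<in> ext n J T \<inter> pol (vars0 n)"
  then have "slice 0 p \<in> J" by (simp add: ext_def)
  then show "p \<in> J" using slice_vars0[of p n 0] p by simp
qed (use J_subset_ext J.I_memR in auto)

lemma one_in_ext: "1 \<in> ext n J T \<longleftrightarrow> 1 \<in> J"
  using ext_inter[of T] pol.one_mem[of "vars0 n"] by blast

text \<open>Multiplication by \<open>x_i0\<close> shifts the index of each slice; for
  \<open>i \<notin> T\<close> the shifted index still avoids \<open>T\<close>, so every slice of
  \<open>u\<close> that matters is a slice of the product.\<close>

lemma ext_nzd:
  assumes "i \<notin> T" "u \<in> pol (vars n)" "var (i, 0) * u \<in> ext n J T"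
  shows "u \<in> ext n J T"
proof -
  have "slice \<nu> u \<in> J" if \<nu>: "\<forall>i\<in>T. lookup \<nu> (i, 0) = 0" for \<nu>
  proof -
    let ?e = "single (i, 0::nat) (1::nat)"
    have z: "zpart ?e = ?e" "npart ?e = 0" using zpart_npart_zero_vars[of ?e] by auto
    have "\<forall>j\<in>T. lookup (zpart ?e + \<nu>) (j, 0) = 0"
      using \<nu> assms(1) unfolding z by (auto simp: lookup_add lookup_single "when_def")
    then have "slice (zpart ?e + \<nu>) (single ?e 1 * u) \<in> J"
      using assms(3) by (simp add: ext_def var_def)
    then have "single (npart ?e) 1 * slice \<nu> u \<in> J" by (simp only: slice_mult)
    then show ?thesis unfolding z(2) by simp
  qed
  then show ?thesis using assms(2) by (simp add: ext_def)
qed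

lemma var_in_ext: "i \<in> T \<Longrightarrow> var (i, 0) \<in> ext n J T"
proof -
  assume i: "i \<in> T"
  let ?e = "single (i, 0::nat) (1::nat)"
  have z: "zpart ?e = ?e" using zpart_npart_zero_vars[of ?e] by auto
  have "slice \<nu> (var (i, 0) :: ('q, 'k) polynomial) = 0" if "\<forall>i\<in>T. lookup \<nu> (i, 0) = 0" for \<nu>
  proof -
    have "zpart ?e \<noteq> \<nu>" unfolding z using that i by (metis lookup_single_eq one_neq_zero)
    then show ?thesis unfolding var_def slice_single by (rule if_not_P)
  qed
  moreover have "(var (i, 0) :: ('q, 'k) polynomial) \<in> pol (vars n)"
    unfolding var_def by (rule single_in_pol) (auto simp: vars_def)
  ultimately show ?thesis by (simp add: ext_def)
qed

text \<open>Removing from \<open>p\<close> the monomials divisible by \<open>x_i0\<close> leaves a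
  polynomial whose slices at indices involving \<open>x_i0\<close> vanish; for it the conditions for
  \<open>insert i T\<close> and for \<open>T\<close> coincide.\<close>

lemma adj_ext: "pol.adj (vars n) (ext n J T) [var (i, 0)] = ext n J (insert i T)"
proof
  have "ext n J T \<subseteq> ext n J (insert i T)" by (auto simp: ext_def)
  then show "pol.adj (vars n) (ext n J T) [var (i, 0)] \<subseteq> ext n J (insert i T)"
    using var_in_ext[of i "insert i T"] by (intro pol.adj_minimal[OF ext_ideal]) simp_all
next
  show "ext n J (insert i T) \<subseteq> pol.adj (vars n) (ext n J T) [var (i, 0)]"
  proof
    fix p assume p: "p \<in> ext n J (insert i T)"
    let ?e = "single (i, 0::nat) (1::nat)"
    have "\<exists>q r. q \<in> pol (vars n) \<and> r \<in> pol (vars n) \<and> p = q + r * var (i, 0) \<and>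
        (\<forall>\<nu>. slice \<nu> q = (if lookup \<nu> (i, 0) = 0 then slice \<nu> p else 0))"
      if "p \<in> pol (vars n)" for p :: "('q, 'k) polynomial"
      using that
    proof (induction rule: pol_induct)
      case zero
      show ?case by (intro exI[of _ 0]) simp
    next
      case (add p m c)
      then obtain q r where qr: "q \<in> pol (vars n)" "r \<in> pol (vars n)" "p = q + r * var (i, 0)"
        "\<And>\<nu>. slice \<nu> q = (if lookup \<nu> (i, 0) = 0 then slice \<nu> p else 0)" by blast
      let ?s = "single m c"
      have s: "?s \<in> pol (vars n)" by (rule single_in_pol[OF add(2)])
      have lz: "lookup (zpart m) (i, 0) = lookup m (i, 0)" by (simp add: lookup_zpart)
      show ?case
      proof (cases "lookup m (i, 0) = 0")
        case True
        have "slice \<nu> (q + ?s) = (if lookup \<nu> (i, 0) = 0 then slice \<nu> (p + ?s) else 0)" for \<nu>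
          using qr(4)[of \<nu>] True lz by (auto simp: slice_add slice_single)
        moreover have "p + ?s = (q + ?s) + r * var (i, 0)" by (simp add: qr(3))
        ultimately show ?thesis using pol.add_mem[OF qr(1) s] qr(2) by blast
      next
        case False
        define m' where "m' = m - ?e"
        have m: "m = m' + ?e"
          by (rule poly_mapping_eqI) (use False in \<open>auto simp: m'_def lookup_add lookup_minus lookup_single "when_def"\<close>)
        have "keys m' \<subseteq> vars n"
          using add(2) by (auto simp: m'_def in_keys_iff lookup_minus)
        then have "r + single m' c \<in> pol (vars n)" by (intro pol.add_mem qr(2) single_in_pol)
        moreover have "p + ?s = q + (r + single m' c) * var (i, 0)"
          by (simp add: qr(3) distrib_right single_var[symmetric] m add.assoc)
        moreover have "slice \<nu> q = (if lookup \<nu> (i, 0) = 0 then slice \<nu> (p + ?s) else 0)" for \<nu>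
          using qr(4)[of \<nu>] False lz by (auto simp: slice_add slice_single)
        ultimately show ?thesis using qr(1) by blast
      qed
    qed
    moreover have pV: "p \<in> pol (vars n)" using p by (simp add: ext_def)
    ultimately obtain q r where qr: "q \<in> pol (vars n)" "r \<in> pol (vars n)" "p = q + r * var (i, 0)"
      "\<forall>\<nu>. slice \<nu> q = (if lookup \<nu> (i, 0) = 0 then slice \<nu> p else 0)"
      by meson
    have "q \<in> pol.adj (vars n) (ext n J T) []" using qr(1,4) p by (simp add: ext_def)
    then show "p \<in> pol.adj (vars n) (ext n J T) [var (i, 0)]"
      unfolding qr(3) by (rule pol.adj_ConsI[OF _ qr(2)])
  qed
qed

lemma adj_ext_list: "pol.adj (vars n) (ext n J {}) (map (\<lambda>i. var (i, 0)) is) = ext n J (set is)"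
proof (induction "is")
  case (Cons i "is")
  have "pol.adj (vars n) (ext n J {}) (map (\<lambda>i. var (i, 0)) (i # is))
      = pol.adj (vars n) (ext n J (set is)) [var (i, 0)]"
    using Cons by simp
  then show ?case using adj_ext[of "set is" i] by simp
qed simp

lemma nzd_seq_ext: "distinct is \<Longrightarrow> set is \<inter> T = {} \<Longrightarrow>
    pol.nzd_seq (vars n) (ext n J T) (map (\<lambda>i. var (i, 0)) is)"
proof (induction "is" arbitrary: T)
  case (Cons i "is")
  have 1: "\<forall>g\<in>pol (vars n). var (i, 0) * g \<in> ext n J T \<longrightarrow> g \<in> ext n J T"
    using ext_nzd[of i T] Cons.prems by simp
  have 2: "pol.nzd_seq (vars n) (pol.adj (vars n) (ext n J T) [var (i, 0)]) (map (\<lambda>i. var (i, 0)) is)"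
    unfolding adj_ext by (rule Cons.IH) (use Cons.prems in auto)
  show ?case unfolding list.map pol.nzd_seq.simps by (rule conjI[OF 1 2])
qed simp

text \<open>Saturation with respect to the monomials in the \<open>x_i0\<close>: no form is lost on
  the chart where all \<open>x_i0\<close> are inverted.\<close>

lemma monomial_nzd_ext:
  assumes "\<And>v. v \<in> keys \<mu> \<Longrightarrow> snd v = 0" "u \<in> pol (vars n)"
    "single \<mu> 1 * u \<in> ext n J {}"
  shows "u \<in> ext n J {}"
proof -
  have "slice \<nu> u \<in> J" for \<nu>
  proof -
    have "slice (zpart \<mu> + \<nu>) (single \<mu> 1 * u) \<in> J" using assms(3) by (simp add: ext_def)
    then have "single (npart \<mu>) 1 * slice \<nu> u \<in> J" by (simp only: slice_mult)
    moreover have "npart \<mu> = 0" by (rule zpart_npart_zero_vars(2)) (rule assms(1))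
    ultimately show ?thesis by simp
  qed
  then show ?thesis using assms(2) by (simp add: ext_def)
qed

lemma monomial_notin_ext:
  assumes "\<And>v. v \<in> keys \<mu> \<Longrightarrow> snd v = 0" "1 \<notin> J"
  shows "single \<mu> 1 \<notin> ext n J {}"
proof
  assume "single \<mu> 1 \<in> ext n J {}"
  then have "slice \<mu> (single \<mu> 1) \<in> J" by (simp add: ext_def)
  moreover have "zpart \<mu> = \<mu>" "npart \<mu> = 0" using zpart_npart_zero_vars[of \<mu>] assms(1) by auto
  ultimately show False using assms(2) by (simp add: slice_single)
qed

end

section \<open>The scheme of an artinian quotient\<close>

lemma (in comm_subring) prime_quotient_vimage:
  assumes I: "ideal_in R I" and P: "primeideal P (ring_on R Quot I)"
  shows "prime_in {r \<in> R. I +>\<^bsub>ring_on R\<^esub> r \<in> P}"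
proof -
  interpret i: ideal I "ring_on R" using I by (simp add: ideal_ring_on_iff)
  interpret P: primeideal P "ring_on R Quot I" by (rule P)
  let ?p = "\<lambda>f. I +>\<^bsub>ring_on R\<^esub> f"
  have car: "carrier (ring_on R Quot I) = ?p ` R" by (auto simp: FactRing_def A_RCOSETS_def')
  have mult: "?p (x * y) = ?p x \<otimes>\<^bsub>ring_on R Quot I\<^esub> ?p y" if "x \<in> R" "y \<in> R" for x y
    using i.rcoset_mult_add[of x y] that by (simp add: FactRing_def)
  have "?p 1 \<notin> P"
  proof
    assume "?p 1 \<in> P"
    then have "\<one>\<^bsub>ring_on R Quot I\<^esub> \<in> P" by (simp add: FactRing_def)
    then show False using P.one_imp_carrier P.I_notcarr by simp
  qed
  moreover have "?p x \<in> P \<or> ?p y \<in> P" if "x \<in> R" "y \<in> R" "?p (x * y) \<in> P" for x y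
    using P.I_prime[of "?p x" "?p y"] mult[of x y] that car by auto
  ultimately show ?thesis
    unfolding prime_in_def using ideal_quotient_vimage(1)[OF I P.is_ideal] mult_mem by auto
qed

lemma (in comm_subring) krull_dim_eq_0:
  assumes I: "ideal_in R I"
    and max: "\<And>P P'. prime_in P \<Longrightarrow> prime_in P' \<Longrightarrow> I \<subseteq> P \<Longrightarrow> P \<subseteq> P' \<Longrightarrow> P' \<subseteq> P"
  shows "krull_dim (ring_on R Quot I) = 0"
proof -
  have "krull_dim (ring_on R Quot I) \<le> 0"
    unfolding krull_dim_def
  proof (rule Sup_least)
    fix x assume "x \<in> {enat (length Ps - 1) | Ps. Ps \<noteq> [] \<and>
        (\<forall>P\<in>set Ps. primeideal P (ring_on R Quot I)) \<and> sorted_wrt (\<subset>) Ps}"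
    then obtain Ps where Ps: "x = enat (length Ps - 1)"
      "\<forall>P\<in>set Ps. primeideal P (ring_on R Quot I)" "sorted_wrt (\<subset>) Ps" by blast
    have "length Ps \<le> 1"
    proof (rule ccontr)
      assume l: "\<not> length Ps \<le> 1"
      define P P' where "P = Ps ! 0" and "P' = Ps ! 1"
      have sub: "P \<subset> P'" unfolding P_def P'_def using sorted_wrt_nth_less[OF Ps(3), of 0 1] l by simp
      have "P \<in> set Ps" "P' \<in> set Ps"
        unfolding P_def P'_def using l by (intro nth_mem; linarith)+
      then have pr: "primeideal P (ring_on R Quot I)" "primeideal P' (ring_on R Quot I)"
        using Ps(2) by blast+
      let ?v = "\<lambda>P. {r \<in> R. I +>\<^bsub>ring_on R\<^esub> r \<in> P}"
      have id: "ideal P (ring_on R Quot I)" "ideal P' (ring_on R Quot I)"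
        using pr by (auto intro: primeideal.axioms(1))
      have "?v P' \<subseteq> ?v P"
        by (rule max[OF prime_quotient_vimage[OF I pr(1)] prime_quotient_vimage[OF I pr(2)]
              ideal_quotient_vimage(2)[OF I id(1)]]) (use sub in auto)
      then have "(\<lambda>r. I +>\<^bsub>ring_on R\<^esub> r) ` ?v P' \<subseteq> (\<lambda>r. I +>\<^bsub>ring_on R\<^esub> r) ` ?v P" by (rule image_mono)
      then have "P' \<subseteq> P"
        unfolding ideal_quotient_vimage(3)[OF I id(1), symmetric] ideal_quotient_vimage(3)[OF I id(2), symmetric] .
      then show False using sub by blast
    qed
    then show "x \<le> 0" by (simp add: Ps(1) zero_enat_def)
  qed
  then show ?thesis by simp
qed

section \<open>Localized ideals on the charts\<close>

lemma lookup_map_poly_mapping: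
  "f 0 = 0 \<Longrightarrow> lookup (Poly_Mapping.map f m) v = f (lookup m v)"
  by (simp add: Poly_Mapping.map.rep_eq "when_def")

lemma emb_single_mult: "emb (single m c * p) = single (Poly_Mapping.map int m) c * emb p"
  by (simp add: emb_mult emb_single)

text \<open>Negative exponents go into the denominator \<open>u\<close>, positive ones into the
  numerator \<open>w\<close>.\<close>

lemma exps_denominator:
  assumes "m \<in> exps n D"
  obtains u w where "Poly_Mapping.map int u + m = Poly_Mapping.map int w"
    "keys u \<subseteq> D" "keys w \<subseteq> vars n"
proof
  let ?u = "Poly_Mapping.map (\<lambda>z. nat (- z)) m" and ?w = "Poly_Mapping.map nat m"
  show "Poly_Mapping.map int ?u + m = Poly_Mapping.map int ?w"
    by (rule poly_mapping_eqI) (simp add: lookup_add lookup_map_poly_mapping)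
  show "keys ?u \<subseteq> D"
    using assms by (auto simp: in_keys_iff lookup_map_poly_mapping exps_def)
  show "keys ?w \<subseteq> vars n"
    using assms by (auto simp: in_keys_iff lookup_map_poly_mapping exps_def subset_iff)
qed

lemma chart_exp_nat:
  assumes "\<And>i. 0 \<le> a $ i"
  obtains u where "Poly_Mapping.map int u = chart_exp \<sigma> a" "keys u \<subseteq> inverted \<sigma>"
proof
  let ?u = "\<Sum>i\<in>UNIV. single (i, \<sigma> i) (nat (a $ i))"
  show eq: "Poly_Mapping.map int ?u = chart_exp \<sigma> a"
  proof (rule poly_mapping_eqI)
    fix v
    show "lookup (Poly_Mapping.map int ?u) v = lookup (chart_exp \<sigma> a) v"
      unfolding lookup_map_int chart_exp_def lookup_sum of_nat_sum
      by (rule sum.cong) (use assms in \<open>auto simp: lookup_single "when_def"\<close>)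
  qed
  show "keys ?u \<subseteq> inverted \<sigma>"
    using keys_map_int[of ?u] keys_chart_exp[of \<sigma> a] unfolding eq by simp
qed

text \<open>The degree 0 part of the localization of \<open>Q\<close> at the variables in
  \<open>D\<close>, expressed by clearing denominators with a monomial \<open>u\<close>.\<close>

definition chart_ideal ::
    "('q::finite \<Rightarrow> nat) \<Rightarrow> ('q, 'k::field) polynomial set \<Rightarrow> ('q \<times> nat) set \<Rightarrow> ('q, 'k) laurent set" where
  "chart_ideal n Q D = {p \<in> sec n D. \<exists>u. keys u \<subseteq> D \<and>
     single (Poly_Mapping.map int u) 1 * p \<in> emb ` Q}"

lemma inverted_vars: "\<sigma> \<in> charts n \<Longrightarrow> inverted \<sigma> \<subseteq> vars n"
  using chart_vars by (auto simp: inverted_def)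

lemma chart_ideal_ideal:
  fixes Q :: "('q::finite, 'k::field) polynomial set"
  assumes Q: "ideal_in (pol (vars n)) Q" and D: "D \<subseteq> vars n"
  shows "ideal_in (sec n D) (chart_ideal n Q D)"
proof -
  interpret Q: ideal_in "pol (vars n)" Q by (rule Q)
  let ?m = "\<lambda>u. single (Poly_Mapping.map int u) (1::'k)"
  have plus: "x + y \<in> chart_ideal n Q D" if xy: "x \<in> chart_ideal n Q D" "y \<in> chart_ideal n Q D" for x y
  proof -
    obtain u F where u: "keys u \<subseteq> D" "?m u * x = emb F" "F \<in> Q"
      using xy(1) by (auto simp: chart_ideal_def)
    obtain w G where w: "keys w \<subseteq> D" "?m w * y = emb G" "G \<in> Q"
      using xy(2) by (auto simp: chart_ideal_def)
    have "?m (u + w) * (x + y) = ?m w * (?m u * x) + ?m u * (?m w * y)"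
      by (simp add: map_int_add distrib_left mult.assoc[symmetric] mult_single add.commute)
    also have "\<dots> = emb (single w 1 * F + single u 1 * G)"
      unfolding u(2) w(2) by (simp add: emb_add emb_single_mult)
    finally have "?m (u + w) * (x + y) \<in> emb ` Q"
      using u w D by (auto intro!: Q.I_add Q.I_mult single_in_pol)
    moreover have "keys (u + w) \<subseteq> D" using Poly_Mapping.keys_add[of u w] u w by auto
    moreover have "x + y \<in> sec n D" using xy by (auto simp: chart_ideal_def intro: sec.add_mem)
    ultimately show ?thesis unfolding chart_ideal_def by blast
  qed
  have zero: "0 \<in> chart_ideal n Q D"
    unfolding chart_ideal_def by (auto intro!: exI[of _ 0] image_eqI[of _ _ 0])
  show ?thesis
  proof
    show "chart_ideal n Q D \<subseteq> sec n D" by (auto simp: chart_ideal_def)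
  next
    fix r x :: "('q, 'k) laurent" assume r: "r \<in> sec n D" and x: "x \<in> chart_ideal n Q D"
    from r show "r * x \<in> chart_ideal n Q D"
    proof (induction rule: sec_induct)
      case (add p m c)
      obtain u w where uw: "Poly_Mapping.map int u + m = Poly_Mapping.map int w"
        "keys u \<subseteq> D" "keys w \<subseteq> vars n"
        by (rule exps_denominator[OF add(2)])
      obtain t F where t: "keys t \<subseteq> D" "?m t * x = emb F" "F \<in> Q"
        using x by (auto simp: chart_ideal_def)
      have "?m (u + t) * (single m c * x) = (?m u * single m c) * (?m t * x)"
        by (simp add: map_int_add mult_single ac_simps mult.assoc[symmetric])
      also have "\<dots> = emb (single w c * F)"
        unfolding t(2) by (simp add: mult_single uw(1) emb_single_mult)
      finally have "?m (u + t) * (single m c * x) \<in> emb ` Q"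
        using t uw by (auto intro!: Q.I_mult single_in_pol)
      moreover have "keys (u + t) \<subseteq> D" using Poly_Mapping.keys_add[of u t] uw t by auto
      moreover have "single m c * x \<in> sec n D"
        using x by (auto simp: chart_ideal_def intro: sec.mult_mem single_in_sec[OF add(2)])
      ultimately have "single m c * x \<in> chart_ideal n Q D" unfolding chart_ideal_def by blast
      then show ?case using add(3) plus
        by (simp add: distrib_right)
    qed (simp add: zero)
  qed (use plus zero in auto)
qed

lemma component_nonneg:
  assumes "F \<in> component V a" "F \<noteq> 0"
  shows "0 \<le> a $ i"
proof -
  obtain m where "m \<in> keys F" using assms(2) by fastforce
  then have "mdeg m = a" using assms(1) by (simp add: component_eq)
  then show ?thesis using mdeg_nonneg[of m i] by simp
qed

lemma on_chart_in_chart_ideal: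
  fixes Q :: "('q::finite, 'k::field) polynomial set"
  assumes Q: "ideal_in (pol (vars n)) Q" and F: "F \<in> component (vars n) a" "F \<in> Q" and \<sigma>: "\<sigma> \<in> charts n"
  shows "on_chart \<sigma> a F \<in> chart_ideal n Q (inverted \<sigma>)"
proof (cases "F = 0")
  case True
  then show ?thesis using ideal_in.I_zero[OF chart_ideal_ideal[OF Q inverted_vars[OF \<sigma>]]] by simp
next
  case False
  obtain u where u: "Poly_Mapping.map int u = chart_exp \<sigma> a" "keys u \<subseteq> inverted \<sigma>"
    by (rule chart_exp_nat[OF component_nonneg[OF F(1) False]])
  have "single (chart_exp \<sigma> a) 1 * on_chart \<sigma> a F
      = emb F * (single (chart_exp \<sigma> a) 1 * single (- chart_exp \<sigma> a) 1)"
    unfolding on_chart_eq by (simp only: ac_simps)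
  also have "\<dots> = emb F" by (simp add: mult_single)
  finally have "single (Poly_Mapping.map int u) 1 * on_chart \<sigma> a F = emb F" by (simp add: u(1))
  then show ?thesis unfolding chart_ideal_def using on_chart_mem[OF \<sigma> F(1)] u(2) F(2) by blast
qed

text \<open>After clearing denominators, an element of the ideal on the smaller open set becomes a
  form in \<open>Q\<close>; the dehomogenization of that form lies in the ideal of the chart
  \<sigma> and differs from the element by a Laurent monomial allowed by \<open>D\<close>. For the
  union \<open>D\<close> of two charts the right-hand side is symmetric in them, which is the gluing
  condition.\<close>

lemma chart_ideal_glue:
  fixes Q :: "('q::finite, 'k::field) polynomial set"
  assumes Q: "ideal_in (pol (vars n)) Q" and \<sigma>: "\<sigma> \<in> charts n" and D: "inverted \<sigma> \<subseteq> D" "D \<subseteq> vars n"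
  shows "Idl\<^bsub>sections n D\<^esub> (chart_ideal n Q (inverted \<sigma>)) = chart_ideal n Q D"
  unfolding sections_eq
proof (rule sec.Idl_eqI[OF chart_ideal_ideal[OF Q D(2)]])
  have "(sec n (inverted \<sigma>) :: ('q, 'k) laurent set) \<subseteq> sec n D"
    using D(1) unfolding sec_def exps_def by blast
  then show "chart_ideal n Q (inverted \<sigma>) \<subseteq> chart_ideal n Q D"
    using D(1) unfolding chart_ideal_def by blast
next
  fix I' :: "('q, 'k) laurent set"
  assume I': "ideal_in (sec n D) I'" "chart_ideal n Q (inverted \<sigma>) \<subseteq> I'"
  show "chart_ideal n Q D \<subseteq> I'"
  proof
    fix p assume p: "p \<in> chart_ideal n Q D"
    then obtain u F where u: "keys u \<subseteq> D" "F \<in> Q"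
      "single (Poly_Mapping.map int u) 1 * p = emb F"
      by (auto simp: chart_ideal_def)
    have pS: "p \<in> sec n D" using p by (simp add: chart_ideal_def)
    let ?a = "mdeg u"
    have "F \<in> component (vars n) ?a"
      unfolding component_eq
    proof (intro CollectI conjI ballI)
      show "F \<in> pol (vars n)" using u(2) ideal_in.I_memR[OF Q] by blast
      fix m assume "m \<in> keys F"
      then have "Poly_Mapping.map int m \<in> keys (single (Poly_Mapping.map int u) 1 * p)"
        unfolding u(3) keys_emb by (rule imageI)
      then obtain k where k: "Poly_Mapping.map int m = Poly_Mapping.map int u + k" "k \<in> keys p"
        using keys_mult[of "single (Poly_Mapping.map int u) 1" p] by auto
      have "multidegree k = 0" using k(2) pS by (auto simp: sec_def exps_def)
      then show "mdeg m = ?a" by (simp add: mdeg_def k(1) multidegree_add)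
    qed
    then have F: "on_chart \<sigma> ?a F \<in> I'" using on_chart_in_chart_ideal[OF Q _ u(2) \<sigma>] I'(2) by blast
    \<comment> \<open>The exponent of the monomial that turns \<open>on_chart \<sigma> ?a F\<close>
      back into \<open>p\<close>.\<close>
    define e where "e = chart_exp \<sigma> ?a - Poly_Mapping.map int u"
    have "e \<in> exps n D"
      unfolding exps_def
    proof (intro CollectI conjI allI impI)
      show "keys e \<subseteq> vars n"
        using keys_diff[of "chart_exp \<sigma> ?a" "Poly_Mapping.map int u"] keys_chart_exp[of \<sigma> ?a] D u(1)
        unfolding e_def keys_map_int by blast
      show "v \<in> D" if "lookup e v < 0" for v
      proof (rule ccontr)
        assume v: "v \<notin> D"
        then have "lookup u v = 0" using u(1) by (auto simp: in_keys_iff)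
        moreover have "lookup (chart_exp \<sigma> ?a) v = 0"
          using keys_chart_exp[of \<sigma> ?a] D(1) v by (auto simp: in_keys_iff)
        ultimately show False using that by (simp add: e_def lookup_minus)
      qed
      show "multidegree e = 0" by (simp add: e_def multidegree_diff mdeg_def)
    qed
    then have "single e 1 * on_chart \<sigma> ?a F \<in> I'"
      by (intro ideal_in.I_mult[OF I'(1) _ F] single_in_sec)
    also have "single e 1 * on_chart \<sigma> ?a F
        = (single e 1 * single (- chart_exp \<sigma> ?a) 1 * single (Poly_Mapping.map int u) 1) * p"
      unfolding on_chart_eq u(3)[symmetric] by (simp only: ac_simps)
    also have "\<dots> = p" by (simp add: mult_single e_def)
    finally show "p \<in> I'" .
  qed
qed

section \<open>The scheme of a fixed artinian quotient\<close>

context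
  fixes n :: "'q::finite \<Rightarrow> nat" and J :: "('q, 'k::field) polynomial set"
  assumes J: "artinian_graded_quotient n J"
begin

abbreviation (input) Q :: "('q, 'k) polynomial set" where "Q \<equiv> ext n J {}"

abbreviation (input) X :: "('q, 'k) scheme_data" where "X \<equiv> \<lambda>\<sigma>. chart_ideal n Q (inverted \<sigma>)"

lemma hom_J: "homogeneous_ideal (vars0 n) J"
  using J by (simp add: artinian_graded_quotient_def)

lemma one_notin_J: "1 \<notin> J"
proof -
  have "ideal_in (pol (vars0 n)) J" using hom_J by (simp add: homogeneous_ideal_iff)
  then show ?thesis
    using J ideal_in.eq_carrier_iff by (auto simp: artinian_graded_quotient_def poly_ring_eq)
qed

lemma ideal_Q: "ideal_in (pol (vars n)) Q"
  by (rule ext_ideal[OF hom_J])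

lemma ideal_X: "\<sigma> \<in> charts n \<Longrightarrow> ideal_in (sec n (inverted \<sigma>)) (X \<sigma>)"
  by (rule chart_ideal_ideal[OF ideal_Q inverted_vars])

lemma zero_chart: "(\<lambda>i. 0) \<in> charts n"
  by (simp add: charts_def)

text \<open>From right to left by localization. Conversely, clearing denominators on the chart of
  the \<open>x_i0\<close> multiplies \<open>F\<close> by a monomial in the \<open>x_i0\<close> only,
  which \<open>monomial_nzd_ext\<close> cancels.\<close>

lemma forms_on_charts:
  assumes F: "F \<in> component (vars n) a"
  shows "(\<forall>\<sigma>\<in>charts n. on_chart \<sigma> a F \<in> X \<sigma>) \<longleftrightarrow> F \<in> Q"
proof
  assume "F \<in> Q"
  then show "\<forall>\<sigma>\<in>charts n. on_chart \<sigma> a F \<in> X \<sigma>" using on_chart_in_chart_ideal[OF ideal_Q F] by blast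
next
  interpret Q: ideal_in "pol (vars n)" Q by (rule ideal_Q)
  let ?\<sigma> = "\<lambda>i::'q. 0::nat"
  let ?m = "\<lambda>u. single (Poly_Mapping.map int u) (1::'k)"
  assume "\<forall>\<sigma>\<in>charts n. on_chart \<sigma> a F \<in> X \<sigma>"
  then have "on_chart ?\<sigma> a F \<in> X ?\<sigma>" using zero_chart by blast
  then obtain u G where u: "keys u \<subseteq> inverted ?\<sigma>" "G \<in> Q" "?m u * on_chart ?\<sigma> a F = emb G"
    by (auto simp: chart_ideal_def)
  show "F \<in> Q"
  proof (cases "F = 0")
    case False
    obtain w where w: "Poly_Mapping.map int w = chart_exp ?\<sigma> a" "keys w \<subseteq> inverted ?\<sigma>"
      by (rule chart_exp_nat[OF component_nonneg[OF F False]])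
    have "emb (single w 1 * G) = ?m w * (?m u * on_chart ?\<sigma> a F)"
      by (simp add: emb_single_mult u(3))
    also have "\<dots> = ?m u * emb F * (?m w * single (- chart_exp ?\<sigma> a) 1)"
      unfolding on_chart_eq by (simp only: ac_simps)
    also have "\<dots> = emb (single u 1 * F)" by (simp add: w(1) mult_single emb_single_mult)
    finally have eq: "single w 1 * G = single u 1 * F" by (rule emb_inject)
    have "keys w \<subseteq> vars n" using w(2) inverted_vars[OF zero_chart] by blast
    then have "single u 1 * F \<in> Q"
      unfolding eq[symmetric] by (intro Q.I_mult[OF _ u(2)] single_in_pol)
    moreover have "snd v = 0" if "v \<in> keys u" for v using that u(1) by (auto simp: inverted_def)
    moreover have "F \<in> pol (vars n)" using F by (simp add: component_eq)
    ultimately show ?thesis by (rule monomial_nzd_ext[OF hom_J, rotated 2])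
  qed simp
qed

text \<open>Both ideals are homogeneous and contain the same forms.\<close>

lemma vanishing_ideal_X: "vanishing_ideal n X = Q"
proof -
  have eq: "F \<in> vanishing_ideal n X \<longleftrightarrow> F \<in> Q" if F: "F \<in> component (vars n) a" for F a
    using form_in_vanishing_ideal[OF ideal_X F] forms_on_charts[OF F] by simp
  have hom: "homogeneous_ideal (vars n) (vanishing_ideal n X)" "homogeneous_ideal (vars n) Q"
    by (rule vanishing_ideal_homogeneous[OF ideal_X], simp) (rule ext_homogeneous[OF hom_J])
  have sub: "I \<subseteq> I'" if I: "homogeneous_ideal (vars n) I" "homogeneous_ideal (vars n) I'"
    and le: "\<And>F a. F \<in> component (vars n) a \<Longrightarrow> F \<in> I \<Longrightarrow> F \<in> I'" for I I' :: "('q, 'k) polynomial set"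
  proof
    fix p assume p: "p \<in> I"
    have "p \<in> pol (vars n)" using I(1) p ideal_in.I_memR unfolding homogeneous_ideal_iff by blast
    then have "hcomp a p \<in> I'" for a
      using le[OF hcomp_component] I(1) p by (auto simp: homogeneous_ideal_iff)
    moreover have "ideal_in (pol (vars n)) I'" using I(2) by (simp add: homogeneous_ideal_iff)
    ultimately have "(\<Sum>a\<in>mdeg ` keys p. hcomp a p) \<in> I'" by (intro ideal_in.I_sum)
    then show "p \<in> I'" using hcomp_decomp[of p] by simp
  qed
  show ?thesis using sub[OF hom] sub[OF hom(2,1)] eq by blast
qed

lemma ratio_nilpotent:
  assumes \<sigma>: "\<sigma> \<in> charts n" and v: "v \<in> vars0 n"
  shows "\<exists>t. ratio \<sigma> v ^ t \<in> X \<sigma>"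
proof -
  obtain t where t: "(var v :: ('q, 'k) polynomial) ^ t \<in> J" using artinian_nilpotent[OF J v] by blast
  then have "(var v :: ('q, 'k) polynomial) ^ t \<in> Q" using J_subset_ext[OF hom_J] by blast
  moreover have "v \<in> vars n" using v vars0_subset by blast
  then have "(var v :: ('q, 'k) polynomial) ^ t \<in> component (vars n) (axis (fst v) (int t))"
    by (intro component_power var_component)
  ultimately have "on_chart \<sigma> (axis (fst v) (int t)) (var v ^ t) \<in> X \<sigma>"
    using on_chart_in_chart_ideal[OF ideal_Q _ _ \<sigma>] by blast
  then show ?thesis unfolding on_chart_power on_chart_var by blast
qed

text \<open>Primes over the chart ideal contain the ratios that are nilpotent modulo it. If some
  inverted variable is not an \<open>x_i0\<close>, one of these ratios is 1 and there are no such
  primes; on the remaining chart every element is constant modulo such a prime, which is therefore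
  maximal.\<close>

lemma krull_dim_X:
  assumes \<sigma>: "\<sigma> \<in> charts n"
  shows "krull_dim (sections n (inverted \<sigma>) Quot X \<sigma>) = 0"
  unfolding sections_eq
proof (rule sec.krull_dim_eq_0[OF ideal_X[OF \<sigma>]])
  let ?S = "sec n (inverted \<sigma>) :: ('q, 'k) laurent set"
  fix P P' assume P: "sec.prime_in n (inverted \<sigma>) P" "sec.prime_in n (inverted \<sigma>) P'" "X \<sigma> \<subseteq> P" "P \<subseteq> P'"
  interpret P: ideal_in ?S P using P by (simp add: sec.prime_in_def)
  interpret P': ideal_in ?S P' using P by (simp add: sec.prime_in_def)
  have one: "1 \<notin> P" "1 \<notin> P'" using P by (auto simp: sec.prime_in_def)
  have rad: "x \<in> P" if "x ^ t \<in> P" "x \<in> ?S" for x t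
    using that(1)
  proof (induction t)
    case (Suc t)
    have "x ^ t \<in> ?S" using that(2) by (rule sec.power_mem)
    then show ?case using Suc P(1) that(2) by (auto simp: sec.prime_in_def)
  qed (use one in simp)
  have ratP: "ratio \<sigma> v \<in> P" if v: "v \<in> vars0 n" for v
  proof -
    obtain t where "ratio \<sigma> v ^ t \<in> X \<sigma>" using ratio_nilpotent[OF \<sigma> v] by blast
    then show ?thesis using rad P(3) ratio_mem[OF \<sigma>] v vars0_subset by blast
  qed
  have \<sigma>0: "\<sigma> i = 0" for i
  proof (rule ccontr)
    assume "\<sigma> i \<noteq> 0"
    then have "(i, \<sigma> i) \<in> vars0 n" using \<sigma> by (auto simp: vars0_def charts_def)
    from ratP[OF this] show False using one by simp
  qed
  have const: "\<exists>c. x - single 0 c \<in> P" if "x \<in> sec.alg_span (ratio \<sigma> ` vars n)" for x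
    using that
  proof induction
    case (scalar c)
    show ?case by (intro exI[of _ c]) simp
  next
    case (gen y)
    then obtain v where v: "v \<in> vars n" "y = ratio \<sigma> v" by auto
    show ?case
    proof (cases "v \<in> vars0 n")
      case True
      then show ?thesis using ratP v by (intro exI[of _ 0]) simp
    next
      case False
      then have "v = (fst v, \<sigma> (fst v))" using v(1) \<sigma>0 by (cases v) (auto simp: vars_def vars0_def)
      then have "y = 1" using v(2) ratio_self by metis
      then show ?thesis by (intro exI[of _ 1]) simp
    qed
  next
    case (add x y)
    then obtain c d where cd: "x - single 0 c \<in> P" "y - single 0 d \<in> P" by blast
    then have "x + y - single 0 (c + d) \<in> P"
      using P.cong_add[OF cd] by (simp add: single_add)
    then show ?case by blast
  next
    case (mult x y)
    then obtain c d where cd: "x - single 0 c \<in> P" "y - single 0 d \<in> P" by blast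
    have "x \<in> ?S" using mult sec_alg_span[OF \<sigma>] by blast
    then have "x * y - single 0 c * single 0 d \<in> P"
      by (rule P.cong_mult[OF _ sec.scalar_mem cd])
    then have "x * y - single 0 (c * d) \<in> P" by (simp add: mult_single)
    then show ?case by blast
  qed
  show "P' \<subseteq> P"
  proof
    fix x assume x: "x \<in> P'"
    then have "x \<in> sec.alg_span (ratio \<sigma> ` vars n)" using P'.I_memR sec_alg_span[OF \<sigma>] by blast
    then obtain c where c: "x - single 0 c \<in> P" using const by blast
    have "x - (x - single 0 c) \<in> P'" by (rule P'.I_diff[OF x]) (use c P(4) in blast)
    then have cP: "single 0 c \<in> P'" by simp
    have "c = 0"
    proof (rule ccontr)
      assume "c \<noteq> 0"
      have "single 0 (inverse c) * single 0 c \<in> P'"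
        by (rule P'.I_mult[OF sec.scalar_mem cP])
      then show False using one \<open>c \<noteq> 0\<close> by (simp add: mult_single)
    qed
    then show "x \<in> P" using c by simp
  qed
qed

lemma zero_dimensional_X: "zero_dimensional_subscheme n X"
  unfolding zero_dimensional_subscheme_def
proof (intro conjI)
  show "closed_subscheme n X"
    unfolding closed_subscheme_def
  proof (intro conjI ballI)
    fix \<sigma> assume \<sigma>: "\<sigma> \<in> charts n"
    show "ideal (X \<sigma>) (sections n (inverted \<sigma>))"
      using ideal_X[OF \<sigma>] by (simp add: sections_eq sec.ideal_ring_on_iff)
    fix \<tau> assume \<tau>: "\<tau> \<in> charts n"
    show "Idl\<^bsub>sections n (inverted \<sigma> \<union> inverted \<tau>)\<^esub> (X \<sigma>) = Idl\<^bsub>sections n (inverted \<sigma> \<union> inverted \<tau>)\<^esub> (X \<tau>)"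
      using chart_ideal_glue[OF ideal_Q \<sigma>, of "inverted \<sigma> \<union> inverted \<tau>"]
        chart_ideal_glue[OF ideal_Q \<tau>, of "inverted \<sigma> \<union> inverted \<tau>"] inverted_vars[OF \<sigma>] inverted_vars[OF \<tau>]
      by simp
  qed
  show "nonempty_scheme n X"
    unfolding nonempty_scheme_def
  \<comment> \<open>On the chart of the \<open>x_i0\<close>, the function 1 in the ideal would mean
    that a monomial in the \<open>x_i0\<close> lies in \<open>Q\<close>.\<close>
  proof (rule bexI[OF _ zero_chart], rule notI)
    let ?\<sigma> = "\<lambda>i::'q. 0::nat"
    assume "X ?\<sigma> = carrier (sections n (inverted ?\<sigma>))"
    then have "1 \<in> X ?\<sigma>" by (simp add: sections_eq)
    then obtain u G where u: "keys u \<subseteq> inverted ?\<sigma>" "G \<in> Q"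
      "single (Poly_Mapping.map int u) 1 = emb G"
      by (auto simp: chart_ideal_def)
    then have "single u 1 = G" by (intro emb_inject) (simp add: emb_single)
    moreover have "snd v = 0" if "v \<in> keys u" for v using that u(1) by (auto simp: inverted_def)
    ultimately show False using monomial_notin_ext[OF hom_J _ one_notin_J, of u] u(2) by blast
  qed
  have "scheme_dim n X \<le> 0"
    unfolding scheme_dim_def by (rule SUP_least) (simp add: krull_dim_X)
  then show "scheme_dim n X = 0" by simp
qed

lemma lin_form_zero: "lin_form n (\<lambda>_ _. 0) i = var (i, 0)"
  by (simp add: lin_form_def)

lemma adj_Q: "pol.adj (vars n) Q (map (lin_form n (\<lambda>_ _. 0)) is) = ext n J (set is)"
  unfolding lin_form_zero[abs_def] by (rule adj_ext_list[OF hom_J])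

lemma nilpotent_ext:
  assumes "v \<in> vars n"
  shows "\<exists>t. var v ^ t \<in> ext n J UNIV"
proof (cases "v \<in> vars0 n")
  case True
  then show ?thesis using artinian_nilpotent[OF J] J_subset_ext[OF hom_J] by blast
next
  case False
  then have "v = (fst v, 0)" using assms by (cases v) (auto simp: vars_def vars0_def)
  then have "var v ^ 1 \<in> ext n J UNIV" using var_in_ext[OF hom_J, of "fst v" UNIV] by simp
  then show ?thesis by blast
qed

text \<open>The \<open>x_i0\<close> themselves are a regular sequence of the required length, and
  \<open>depth_le\<close> applied to the same forms excludes longer ones.\<close>

lemma ACM_X: "ACM n X"
proof -
  obtain qs :: "'q list" where qs: "set qs = UNIV" "distinct qs"
    using finite_distinct_list[of "UNIV :: 'q set"] by auto
  have len: "length qs = CARD('q)" using qs distinct_card by metis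
  have A: "pol.adj (vars n) Q (map (lin_form n (\<lambda>_ _. 0)) qs) = ext n J UNIV"
    unfolding adj_Q qs(1) ..
  have one: "1 \<notin> ext n J UNIV" using one_in_ext[OF hom_J] one_notin_J by blast
  have "depth (vars n) Q \<le> enat (length qs)"
  proof (rule depth_le[OF ext_homogeneous[OF hom_J] lin_form_component])
    show "\<exists>t. var v ^ t \<in> pol.adj (vars n) Q (map (lin_form n (\<lambda>_ _. 0)) qs)" if "v \<in> vars n" for v
      unfolding A by (rule nilpotent_ext[OF that])
    show "1 \<notin> pol.adj (vars n) Q (map (lin_form n (\<lambda>_ _. 0)) qs)" unfolding A by (rule one)
  qed
  moreover have "enat (length qs) \<le> depth (vars n) Q"
    unfolding depth_def
  proof (rule Sup_upper, rule CollectI, intro exI conjI)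
    let ?fs = "map (\<lambda>i. var (i, 0)) qs :: ('q, 'k) polynomial list"
    show "enat (length qs) = enat (length ?fs)" by simp
    have varV: "(var (i, 0) :: ('q, 'k) polynomial) \<in> pol (vars n)" "(i, 0) \<in> vars n" for i
      using var_component[of "(i, 0)" "vars n"] by (auto simp: component_eq vars_def)
    have "pol.nzd_seq (vars n) Q ?fs" by (rule nzd_seq_ext[OF hom_J qs(2)]) simp
    moreover have "pol.adj (vars n) Q ?fs \<noteq> pol (vars n)"
      unfolding adj_ext_list[OF hom_J] qs(1) using one pol.one_mem by blast
    ultimately show "regular_sequence (poly_ring (vars n)) Q ?fs"
      unfolding poly_ring_eq pol.regular_sequence_iff[OF ideal_Q] using varV by auto
    have "var ` vars n \<subseteq> (pol (vars n) :: ('q, 'k) polynomial set)"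
      using var_component by (fastforce simp: component_eq)
    from pol.Idl_superset[OF this] show "set ?fs \<subseteq> Idl\<^bsub>poly_ring (vars n)\<^esub> (var ` vars n)"
      unfolding poly_ring_eq using varV(2) by auto
  qed
  ultimately show ?thesis unfolding ACM_def vanishing_ideal_X len by (rule order.antisym)
qed

text \<open>This is \<open>artinian_reduction\<close> with all coefficients 0: the linear forms are
  the \<open>x_i0\<close>, and adding them to \<open>Q\<close> and restricting to the smaller ring
  gives back \<open>J\<close>.\<close>

lemma difference_X: "difference (hilbert (vars n) (vanishing_ideal n X)) = hilbert (vars0 n) J"
proof -
  obtain qs :: "'q list" where qs: "set qs = UNIV" "distinct qs"
    using finite_distinct_list[of "UNIV :: 'q set"] by auto
  have "difference (hilbert (vars n) Q) = hilbert (vars0 n) (ext n J UNIV \<inter> pol (vars0 n))"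
  proof (rule artinian_reduction(2)[OF ext_homogeneous[OF hom_J] qs(2,1)])
    fix xs i ys u assume s: "qs = xs @ i # ys" and u: "u \<in> pol (vars n)"
      "lin_form n (\<lambda>_ _. 0) i * u \<in> pol.adj (vars n) Q (map (lin_form n (\<lambda>_ _. 0)) ys)"
    have "i \<notin> set ys" using qs(2) s by simp
    then show "u \<in> pol.adj (vars n) Q (map (lin_form n (\<lambda>_ _. 0)) ys)"
      using ext_nzd[OF hom_J _ u(1)] u(2) unfolding adj_Q lin_form_zero by blast
  next
    show "ext n J UNIV = pol.adj (vars n) Q (map (lin_form n (\<lambda>_ _. 0)) qs)" unfolding adj_Q qs(1) ..
    show "\<exists>t. var v ^ t \<in> ext n J UNIV" if "v \<in> vars0 n" for v
      using nilpotent_ext that vars0_subset by blast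
    show "1 \<notin> ext n J UNIV" using one_in_ext[OF hom_J] one_notin_J by blast
  qed
  then show ?thesis unfolding vanishing_ideal_X ext_inter[OF hom_J] .
qed

end

theorem theorem6p6:
  fixes n :: "'q::finite \<Rightarrow> nat"
  assumes "infinite (UNIV :: 'k::field set)"
    and "\<And>i. n i \<ge> 1"
  shows "(\<forall>X :: ('q, 'k) scheme_data. zero_dimensional_subscheme n X \<and> ACM n X \<longrightarrow>
           (\<exists>J :: ('q, 'k) polynomial set. artinian_graded_quotient n J \<and>
              difference (hilbert (vars n) (vanishing_ideal n X)) = hilbert (vars0 n) J)) \<and>
         (\<forall>J :: ('q, 'k) polynomial set. artinian_graded_quotient n J \<longrightarrow>
           (\<exists>X :: ('q, 'k) scheme_data. zero_dimensional_subscheme n X \<and> ACM n X \<and>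
              difference (hilbert (vars n) (vanishing_ideal n X)) = hilbert (vars0 n) J))"
proof (intro conjI allI impI)
  fix X :: "('q, 'k) scheme_data"
  assume "zero_dimensional_subscheme n X \<and> ACM n X"
  then show "\<exists>J :: ('q, 'k) polynomial set. artinian_graded_quotient n J \<and>
      difference (hilbert (vars n) (vanishing_ideal n X)) = hilbert (vars0 n) J"
    using acm_artinian_quotient[OF assms(1)] by blast
next
  fix J :: "('q, 'k) polynomial set"
  assume J: "artinian_graded_quotient n J"
  show "\<exists>X :: ('q, 'k) scheme_data. zero_dimensional_subscheme n X \<and> ACM n X \<and>
      difference (hilbert (vars n) (vanishing_ideal n X)) = hilbert (vars0 n) J"
    using zero_dimensional_X[OF J] ACM_X[OF J] difference_X[OF J] by blast
qed

end
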